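(* Let $n\geq 1$ and $1\leq k\leq n$. The set $\{f_\pi : \pi\in\mathrm{NC}(n,k)\}$ descends to a basis of $(FDR_n)_{n-k,k-1}$ (that is, the images of the $f_\pi$ in the quotient ring $FDR_n$, for $\pi\in \mathrm{NC}(n,k)$, form a basis of the bidegree $(n-k,k-1)$ component). Consequently, the set $\{f_\pi:\pi\in\mathrm{NC}(n)\}$ descends to a basis of $\overline{FDR_n}=\bigoplus_{k=1}^n (FDR_n)_{n-k,k-1}$.
   Context: $\Pi(n)$ is the set of all set partitions of $[n]$; $\mathrm{NC}(n)$ is the set of noncrossing ones (whenever $a<b<c<d$ with $a,c$ in the same block and $b,d$ in the same block, all four are in the same block); $\mathrm{NC}(n,k)$ is the set of noncrossing partitions with $k$ blocks. $\wedge\{\Theta_n,\Xi_n\}$ is the exterior algebra over $\mathbb{C}$ on $2n$ anticommuting generators $\theta_1,\dots,\theta_n,\xi_1,\dots,\xi_n$, bigraded by ($\theta$-degree, $\xi$-degree), with $\mathfrak{S}_n$ acting by algebra automorphisms $w\cdot\theta_i=\theta_{w(i)}$, $w\cdot\xi_i=\xi_{w(i)}$. $FDR_n$ is the quotient of $\wedge\{\Theta_n,\Xi_n\}$ by the ideal generated by all $\mathfrak{S}_n$-invariants with vanishing constant term. For a generator $\omega$, contraction $\omega\odot(-)$ is the linear operator sending a product $\omega_1\cdots\omega_r$ of distinct generators to $(-1)^{s-1}\omega_1\cdots\widehat{\omega_s}\cdots\omega_r$ if $\omega=\omega_s$ and to $0$ if $\omega\notin\{\omega_1,\dots,\omega_r\}$;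 extend linearly in the first argument to linear combinations of generators. For nonempty $B\subseteq[n]$ define the block operator $\rho_B$ by $\rho_B(f)=\sum_{i,j\in B,\ i\neq j}\xi_i\cdot(\theta_j\odot f)$ if $|B|>1$ and $\rho_B(f)=\xi_i\cdot(\theta_i\odot f)$ if $B=\{i\}$. These operators commute pairwise. For $\pi=\{B_1/\cdots/B_k\}\in\Pi(n)$ put $F_\pi=(\rho_{B_1}\circ\cdots\circ\rho_{B_k})(\theta_1\theta_2\cdots\theta_n)$ and $f_\pi=(\xi_1+\cdots+\xi_n)\odot F_\pi$. If $\pi$ has $k$ blocks, $f_\pi$ has bidegree $(n-k,k-1)$. *)

theory Defs
  imports
    "HOL-Algebra.QuotRing"
    "HOL-Combinatorics.Permutations"
    "HOL-Library.Disjoint_Sets"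
    "Jordan_Normal_Form.VS_Connect"
begin

section \<open>Noncrossing partitions\<close>

definition NC :: "nat \<Rightarrow> nat set set set" where
  "NC n = {\<pi>. partition_on {1..n} \<pi> \<and>
     (\<forall>a b c d. a < b \<and> b < c \<and> c < d \<and>
        (\<exists>B\<in>\<pi>. a \<in> B \<and> c \<in> B) \<and> (\<exists>B\<in>\<pi>. b \<in> B \<and> d \<in> B)
        \<longrightarrow> (\<exists>B\<in>\<pi>. {a, b, c, d} \<subseteq> B))}"

definition NC_blocks :: "nat \<Rightarrow> nat \<Rightarrow> nat set set set" where
  "NC_blocks n k = {\<pi> \<in> NC n. card \<pi> = k}"

section \<open>The exterior algebra\<close>

datatype gen = Theta nat | Xi nat

text \<open>The generators are ordered
  \<open>\<theta>\<^sub>1 < \<theta>\<^sub>2 < \<dots> < \<xi>\<^sub>1 < \<xi>\<^sub>2 < \<dots>\<close>.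
  This only serves to fix a standard monomial for every set of generators.\<close>

instantiation gen :: linorder
begin

definition less_eq_gen :: "gen \<Rightarrow> gen \<Rightarrow> bool" where
  "less_eq_gen x y = (case (x, y) of
      (Theta i, Theta j) \<Rightarrow> i \<le> j
    | (Theta i, Xi j) \<Rightarrow> True
    | (Xi i, Theta j) \<Rightarrow> False
    | (Xi i, Xi j) \<Rightarrow> i \<le> j)"

definition less_gen :: "gen \<Rightarrow> gen \<Rightarrow> bool" where
  "less_gen x y = (x \<le> y \<and> \<not> y \<le> x)"

instance
  by intro_classes (auto simp: less_eq_gen_def less_gen_def split: gen.splits)

end

definition gens :: "nat \<Rightarrow> gen set" where
  "gens n = Theta ` {1..n} \<union> Xi ` {1..n}"

text \<open>An element of the exterior algebra is represented by its coefficient function: \<open>f S\<close> is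
  the coefficient of \<open>e\<^sub>S\<close>, the product of the generators in the finite set \<open>S\<close> taken in
  increasing order.  Multiplication comes from \<open>e\<^sub>S e\<^sub>T = 0\<close> if \<open>S\<close> and \<open>T\<close> meet and
  \<open>e\<^sub>S e\<^sub>T = (-1)\<^sup>m e\<^bsub>S \<union> T\<^esub>\<close> otherwise, where \<open>m\<close> is the number of pairs \<open>(s, t) \<in> S \<times> T\<close>
  with \<open>t < s\<close>.\<close>

type_synonym ext = "gen set \<Rightarrow> complex"

definition ext_monom :: "gen set \<Rightarrow> ext" where
  "ext_monom S = (\<lambda>T. if T = S then 1 else 0)"

definition shuffle_sign :: "gen set \<Rightarrow> gen set \<Rightarrow> complex" where
  "shuffle_sign S T = (-1) ^ card {(s, t). s \<in> S \<and> t \<in> T \<and> t < s}"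

definition ext_mult :: "ext \<Rightarrow> ext \<Rightarrow> ext" where
  "ext_mult f g = (\<lambda>U. \<Sum>S\<in>Pow U. shuffle_sign S (U - S) * f S * g (U - S))"

definition ext_alg :: "nat \<Rightarrow> (complex, ext) module" where
  "ext_alg n = \<lparr>carrier = {f. \<forall>S. f S \<noteq> 0 \<longrightarrow> S \<subseteq> gens n},
     mult = ext_mult, one = ext_monom {}, zero = (\<lambda>S. 0),
     add = (\<lambda>f g S. f S + g S), smult = (\<lambda>c f S. c * f S)\<rparr>"

definition gprod :: "gen list \<Rightarrow> ext" where
  "gprod xs = foldr (\<lambda>\<omega> f. ext_mult (ext_monom {\<omega>}) f) xs (ext_monom {})"

definition bihomogeneous :: "nat \<Rightarrow> nat \<Rightarrow> nat \<Rightarrow> ext set" where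
  "bihomogeneous n a b = {f \<in> carrier (ext_alg n).
     \<forall>S. f S \<noteq> 0 \<longrightarrow> card (S \<inter> range Theta) = a \<and> card (S \<inter> range Xi) = b}"

section \<open>The quotient by the symmetric group invariants\<close>

primrec perm_gen :: "(nat \<Rightarrow> nat) \<Rightarrow> gen \<Rightarrow> gen" where
  "perm_gen w (Theta i) = Theta (w i)"
| "perm_gen w (Xi i) = Xi (w i)"

text \<open>\<open>w \<cdot> (\<omega>\<^sub>1 \<cdots> \<omega>\<^sub>r) = (w \<cdot> \<omega>\<^sub>1) \<cdots> (w \<cdot> \<omega>\<^sub>r)\<close>, extended linearly.\<close>

definition perm_act :: "(nat \<Rightarrow> nat) \<Rightarrow> ext \<Rightarrow> ext" where
  "perm_act w f =
     (\<lambda>T. \<Sum>S | f S \<noteq> 0. f S * gprod (map (perm_gen w) (sorted_list_of_set S)) T)"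

definition invariants :: "nat \<Rightarrow> ext set" where
  "invariants n = {f \<in> carrier (ext_alg n). \<forall>w. w permutes {1..n} \<longrightarrow> perm_act w f = f}"

definition FDR_ideal :: "nat \<Rightarrow> ext set" where
  "FDR_ideal n = Idl\<^bsub>ext_alg n\<^esub> {f \<in> invariants n. f {} = 0}"

text \<open>The scalar multiplication on cosets is given in the same style as the library's
  \<^const>\<open>rcoset_mult\<close>.\<close>

definition FDR :: "nat \<Rightarrow> (complex, ext set) module" where
  "FDR n = ring.extend (ext_alg n Quot FDR_ideal n)
     (module.fields (\<lambda>c X. \<Union>f\<in>X. FDR_ideal n +>\<^bsub>ext_alg n\<^esub> (c \<odot>\<^bsub>ext_alg n\<^esub> f)))"

definition to_FDR :: "nat \<Rightarrow> ext \<Rightarrow> ext set" where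
  "to_FDR n f = FDR_ideal n +>\<^bsub>ext_alg n\<^esub> f"

definition FDR_component :: "nat \<Rightarrow> nat \<Rightarrow> nat \<Rightarrow> ext set set" where
  "FDR_component n a b = to_FDR n ` bihomogeneous n a b"

text \<open>The direct sum is taken inside \<^const>\<open>FDR\<close>, as a sum of components of a bigraded ring.\<close>

definition FDR_bar :: "nat \<Rightarrow> ext set set" where
  "FDR_bar n = {finsum (FDR n) x {1..n} | x. \<forall>k\<in>{1..n}. x k \<in> FDR_component n (n - k) (k - 1)}"

section \<open>Block operators\<close>

text \<open>On standard monomials, \<open>contract \<omega> e\<^bsub>S\<^esub> = (-1)\<^sup>m e\<^bsub>S - {\<omega>}\<^esub>\<close> if \<open>\<omega> \<in> S\<close>, where \<open>m\<close>
  is the number of elements of \<open>S\<close> below \<open>\<omega>\<close>, and \<open>contract \<omega> e\<^bsub>S\<^esub> = 0\<close> if \<open>\<omega> \<notin> S\<close>.  The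
  definition reads off the coefficient of \<open>e\<^bsub>T\<^esub>\<close> in the linear extension.\<close>

definition contract :: "gen \<Rightarrow> ext \<Rightarrow> ext" where
  "contract \<omega> f = (\<lambda>T. if \<omega> \<in> T then 0 else (-1) ^ card {t \<in> T. t < \<omega>} * f (insert \<omega> T))"

definition block_op :: "nat set \<Rightarrow> ext \<Rightarrow> ext" where
  "block_op B f =
     (if card B = 1
      then ext_mult (ext_monom {Xi (the_elem B)}) (contract (Theta (the_elem B)) f)
      else (\<lambda>T. \<Sum>(i, j) | i \<in> B \<and> j \<in> B \<and> i \<noteq> j.
              ext_mult (ext_monom {Xi i}) (contract (Theta j) f) T))"

text \<open>The composition over all blocks, in any order: the block operators commute, see
  \<open>comp_fun_commute_block_op\<close> below.\<close>

definition F_part :: "nat \<Rightarrow> nat set set \<Rightarrow> ext" where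
  "F_part n \<pi> = Finite_Set.fold block_op (gprod (map Theta [1..<Suc n])) \<pi>"

definition f_part :: "nat \<Rightarrow> nat set set \<Rightarrow> ext" where
  "f_part n \<pi> = (\<lambda>T. \<Sum>i\<in>{1..n}. contract (Xi i) (F_part n \<pi>) T)"

section \<open>Bases\<close>

text \<open>Distinct indices are required to give distinct vectors, so this is a basis as a family.\<close>

definition descends_to_basis :: "nat \<Rightarrow> nat set set set \<Rightarrow> ext set set \<Rightarrow> bool" where
  "descends_to_basis n P W \<longleftrightarrow>
     inj_on (\<lambda>\<pi>. to_FDR n (f_part n \<pi>)) P \<and>
     vectorspace.basis class_ring (FDR n\<lparr>carrier := W\<rparr>) ((\<lambda>\<pi>. to_FDR n (f_part n \<pi>)) ` P)"


section \<open>Well-definedness\<close>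

subsection \<open>The exterior algebra is a ring, \<open>FDR\<close> is a complex vector space\<close>

lemma shuffle_sign_Un_left:
  assumes "finite A" "finite B" "finite C" "A \<inter> B = {}"
  shows "shuffle_sign (A \<union> B) C = shuffle_sign A C * shuffle_sign B C"
proof -
  have "{(s, t). s \<in> A \<union> B \<and> t \<in> C \<and> t < s}
      = {(s, t). s \<in> A \<and> t \<in> C \<and> t < s} \<union> {(s, t). s \<in> B \<and> t \<in> C \<and> t < s}" by auto
  moreover have "finite {(s, t). s \<in> A \<and> t \<in> C \<and> t < s}"
    by (rule finite_subset[of _ "A \<times> C"]) (use assms in auto)
  moreover have "finite {(s, t). s \<in> B \<and> t \<in> C \<and> t < s}"
    by (rule finite_subset[of _ "B \<times> C"]) (use assms in auto)
  moreover have "{(s, t). s \<in> A \<and> t \<in> C \<and> t < s} \<inter> {(s, t). s \<in> B \<and> t \<in> C \<and> t < s} = {}"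
    using assms(4) by auto
  ultimately show ?thesis
    unfolding shuffle_sign_def by (simp add: card_Un_disjoint power_add)
qed

lemma shuffle_sign_Un_right:
  assumes "finite A" "finite B" "finite C" "B \<inter> C = {}"
  shows "shuffle_sign A (B \<union> C) = shuffle_sign A B * shuffle_sign A C"
proof -
  have "{(s, t). s \<in> A \<and> t \<in> B \<union> C \<and> t < s}
      = {(s, t). s \<in> A \<and> t \<in> B \<and> t < s} \<union> {(s, t). s \<in> A \<and> t \<in> C \<and> t < s}" by auto
  moreover have "finite {(s, t). s \<in> A \<and> t \<in> B \<and> t < s}"
    by (rule finite_subset[of _ "A \<times> B"]) (use assms in auto)
  moreover have "finite {(s, t). s \<in> A \<and> t \<in> C \<and> t < s}"
    by (rule finite_subset[of _ "A \<times> C"]) (use assms in auto)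
  moreover have "{(s, t). s \<in> A \<and> t \<in> B \<and> t < s} \<inter> {(s, t). s \<in> A \<and> t \<in> C \<and> t < s} = {}"
    using assms(4) by auto
  ultimately show ?thesis
    unfolding shuffle_sign_def by (simp add: card_Un_disjoint power_add)
qed

lemma ext_mult_assoc: "ext_mult (ext_mult f g) h = ext_mult f (ext_mult g h)"
proof
  fix U :: "gen set"
  show "ext_mult (ext_mult f g) h U = ext_mult f (ext_mult g h) U"
  proof (cases "finite U")
    case False
    then show ?thesis by (simp add: ext_mult_def)
  next
    case True
    have fin: "finite S" if "S \<subseteq> U" for S using that True by (rule finite_subset)
    have key: "shuffle_sign A (U - A) * shuffle_sign (S - A) (U - A - (S - A)) * f A * g (S - A) * h (U - A - (S - A))
        = shuffle_sign S (U - S) * shuffle_sign A (S - A) * f A * g (S - A) * h (U - S)"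
      if SA: "S \<subseteq> U" "A \<subseteq> S" for S A
    proof -
      have e: "U - A = (S - A) \<union> (U - S)" "U - A - (S - A) = U - S" using SA by auto
      have f: "finite A" "finite (S - A)" "finite (U - S)" using SA fin by auto
      have "shuffle_sign S (U - S) = shuffle_sign (A \<union> (S - A)) (U - S)"
        using SA by (simp add: Un_absorb1)
      then have 1: "shuffle_sign S (U - S) = shuffle_sign A (U - S) * shuffle_sign (S - A) (U - S)"
        using shuffle_sign_Un_left[OF f] by auto
      have 2: "shuffle_sign A (U - A) = shuffle_sign A (S - A) * shuffle_sign A (U - S)"
        unfolding e(1) by (rule shuffle_sign_Un_right) (use f in auto)
      show ?thesis by (simp only: e(2) 1 2 mult_ac)
    qed
    have "ext_mult (ext_mult f g) h U =
        (\<Sum>(S, A)\<in>(SIGMA S:Pow U. Pow S).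
           shuffle_sign S (U - S) * shuffle_sign A (S - A) * f A * g (S - A) * h (U - S))"
      unfolding ext_mult_def
      by (subst sum.Sigma[symmetric])
        (auto simp: True fin sum_distrib_left sum_distrib_right mult_ac intro!: sum.cong)
    also have "\<dots> = (\<Sum>(A, B)\<in>(SIGMA A:Pow U. Pow (U - A)).
           shuffle_sign A (U - A) * shuffle_sign B (U - A - B) * f A * g B * h (U - A - B))"
      by (rule sum.reindex_bij_witness[where i = "\<lambda>(A, B). (A \<union> B, A)" and j = "\<lambda>(S, A). (A, S - A)"])
        (auto simp: key)
    also have "\<dots> = ext_mult f (ext_mult g h) U"
      unfolding ext_mult_def
      by (subst sum.Sigma[symmetric])
        (auto simp: True fin sum_distrib_left sum_distrib_right mult_ac intro!: sum.cong)
    finally show ?thesis .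
  qed
qed


lemma finite_gens: "finite (gens n)"
  by (simp add: gens_def)

lemma ext_mult_one_left:
  assumes "\<And>S. f S \<noteq> 0 \<Longrightarrow> finite S"
  shows "ext_mult (ext_monom {}) f = f"
proof
  fix U
  have "ext_mult (ext_monom {}) f U = (\<Sum>S\<in>{S \<in> Pow U. S = {}}. shuffle_sign S (U - S) * f (U - S))"
    if "finite U"
    unfolding ext_mult_def ext_monom_def sum.inter_filter[OF finite_Pow_iff[THEN iffD2, OF that]]
    by (rule sum.cong) auto
  moreover have "{S \<in> Pow U. S = {}} = {{}}" by auto
  moreover have "f U = 0" if "infinite U" using assms that by auto
  ultimately show "ext_mult (ext_monom {}) f U = f U"
    by (cases "finite U") (auto simp: shuffle_sign_def ext_mult_def)
qed

lemma ext_mult_one_right: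
  assumes "\<And>S. f S \<noteq> 0 \<Longrightarrow> finite S"
  shows "ext_mult f (ext_monom {}) = f"
proof
  fix U
  have "ext_mult f (ext_monom {}) U = (\<Sum>S\<in>{S \<in> Pow U. S = U}. shuffle_sign S (U - S) * f S)"
    if "finite U"
    unfolding ext_mult_def ext_monom_def sum.inter_filter[OF finite_Pow_iff[THEN iffD2, OF that]]
    by (rule sum.cong) auto
  moreover have "{S \<in> Pow U. S = U} = {U}" by auto
  moreover have "f U = 0" if "infinite U" using assms that by auto
  ultimately show "ext_mult f (ext_monom {}) U = f U"
    by (cases "finite U") (auto simp: shuffle_sign_def ext_mult_def)
qed

lemma ext_mult_carrier:
  assumes "f \<in> carrier (ext_alg n)" "g \<in> carrier (ext_alg n)"
  shows "ext_mult f g \<in> carrier (ext_alg n)"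
proof -
  have "U \<subseteq> gens n" if "ext_mult f g U \<noteq> 0" for U
  proof -
    from that obtain S where "S \<in> Pow U" "shuffle_sign S (U - S) * f S * g (U - S) \<noteq> 0"
      unfolding ext_mult_def by (rule sum.not_neutral_contains_not_neutral)
    then have "S \<subseteq> gens n" "U - S \<subseteq> gens n" using assms by (auto simp: ext_alg_def)
    then show ?thesis by auto
  qed
  then show ?thesis by (simp add: ext_alg_def)
qed

lemma ring_ext_alg: "ring (ext_alg n)"
proof (rule ringI)
  show "abelian_group (ext_alg n)"
  proof (rule abelian_groupI)
    fix x assume "x \<in> carrier (ext_alg n)"
    then show "\<exists>y\<in>carrier (ext_alg n). y \<oplus>\<^bsub>ext_alg n\<^esub> x = \<zero>\<^bsub>ext_alg n\<^esub>"
      by (intro bexI[of _ "\<lambda>S. - x S"]) (auto simp: ext_alg_def)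
  next
    fix x y assume "x \<in> carrier (ext_alg n)" "y \<in> carrier (ext_alg n)"
    then show "x \<oplus>\<^bsub>ext_alg n\<^esub> y \<in> carrier (ext_alg n)"
      unfolding ext_alg_def by force
  qed (simp_all add: ext_alg_def add_ac)
  show "Group.monoid (ext_alg n)"
  proof (rule monoidI)
    fix x y assume "x \<in> carrier (ext_alg n)" "y \<in> carrier (ext_alg n)"
    then show "x \<otimes>\<^bsub>ext_alg n\<^esub> y \<in> carrier (ext_alg n)"
      using ext_mult_carrier[of x n y] by (simp add: ext_alg_def)
  next
    fix x assume x: "x \<in> carrier (ext_alg n)"
    then have fin: "finite S" if "x S \<noteq> 0" for S
      using that finite_subset[OF _ finite_gens, of S n] by (simp add: ext_alg_def)
    show "\<one>\<^bsub>ext_alg n\<^esub> \<otimes>\<^bsub>ext_alg n\<^esub> x = x"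
      using ext_mult_one_left[OF fin] by (simp add: ext_alg_def)
    show "x \<otimes>\<^bsub>ext_alg n\<^esub> \<one>\<^bsub>ext_alg n\<^esub> = x"
      using ext_mult_one_right[OF fin] by (simp add: ext_alg_def)
  qed (simp_all add: ext_alg_def ext_mult_assoc ext_monom_def)
  show "(x \<oplus>\<^bsub>ext_alg n\<^esub> y) \<otimes>\<^bsub>ext_alg n\<^esub> z = x \<otimes>\<^bsub>ext_alg n\<^esub> z \<oplus>\<^bsub>ext_alg n\<^esub> y \<otimes>\<^bsub>ext_alg n\<^esub> z" for x y z
    by (simp add: ext_alg_def ext_mult_def fun_eq_iff algebra_simps sum.distrib)
  show "z \<otimes>\<^bsub>ext_alg n\<^esub> (x \<oplus>\<^bsub>ext_alg n\<^esub> y) = z \<otimes>\<^bsub>ext_alg n\<^esub> x \<oplus>\<^bsub>ext_alg n\<^esub> z \<otimes>\<^bsub>ext_alg n\<^esub> y" for x y z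
    by (simp add: ext_alg_def ext_mult_def fun_eq_iff algebra_simps sum.distrib)
qed

lemma ideal_FDR_ideal: "ideal (FDR_ideal n) (ext_alg n)"
  unfolding FDR_ideal_def
  by (rule ring.genideal_ideal[OF ring_ext_alg]) (auto simp: invariants_def)

lemma ext_mult_const_left: "finite U \<Longrightarrow> ext_mult (\<lambda>S. c * ext_monom {} S) f U = c * f U"
proof -
  assume "finite U"
  have "ext_mult (\<lambda>S. c * ext_monom {} S) f U = c * ext_mult (ext_monom {}) f U"
    by (simp add: ext_mult_def sum_distrib_left mult_ac)
  also have "ext_mult (ext_monom {}) f U = ext_mult (ext_monom {}) (\<lambda>S. if finite S then f S else 0) U"
    unfolding ext_mult_def using \<open>finite U\<close> by (intro sum.cong) auto
  also have "\<dots> = f U" using \<open>finite U\<close> by (subst ext_mult_one_left) (auto split: if_splits)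
  finally show ?thesis .
qed

lemma smult_ext_alg:
  assumes "f \<in> carrier (ext_alg n)"
  shows "c \<odot>\<^bsub>ext_alg n\<^esub> f = (c \<odot>\<^bsub>ext_alg n\<^esub> \<one>\<^bsub>ext_alg n\<^esub>) \<otimes>\<^bsub>ext_alg n\<^esub> f"
proof -
  have "f U = 0" if "infinite U" for U
    using assms that finite_subset[OF _ finite_gens, of U n] by (auto simp: ext_alg_def)
  then have "c * f U = ext_mult (\<lambda>S. c * ext_monom {} S) f U" for U
    by (cases "finite U") (auto simp: ext_mult_const_left, simp add: ext_mult_def)
  then show ?thesis by (simp add: ext_alg_def fun_eq_iff)
qed

lemma smult_to_FDR:
  assumes "f \<in> carrier (ext_alg n)"
  shows "c \<odot>\<^bsub>FDR n\<^esub> to_FDR n f = to_FDR n (c \<odot>\<^bsub>ext_alg n\<^esub> f)"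
proof -
  interpret ideal "FDR_ideal n" "ext_alg n" by (rule ideal_FDR_ideal)
  let ?E = "ext_alg n" and ?I = "FDR_ideal n"
  have sm: "c \<odot>\<^bsub>?E\<^esub> g \<in> carrier ?E" if "g \<in> carrier ?E" for g
    using that by (auto simp: ext_alg_def)
  have "?I +>\<^bsub>?E\<^esub> (c \<odot>\<^bsub>?E\<^esub> g) = ?I +>\<^bsub>?E\<^esub> (c \<odot>\<^bsub>?E\<^esub> f)" if "g \<in> ?I +>\<^bsub>?E\<^esub> f" for g
  proof -
    from that obtain i where i: "i \<in> ?I" "g = i \<oplus>\<^bsub>?E\<^esub> f" by (auto simp: a_r_coset_def')
    have ic: "i \<in> carrier ?E" using i a_subset by auto
    have "c \<odot>\<^bsub>?E\<^esub> g = c \<odot>\<^bsub>?E\<^esub> i \<oplus>\<^bsub>?E\<^esub> c \<odot>\<^bsub>?E\<^esub> f"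
      by (simp add: i ext_alg_def distrib_left)
    moreover have "c \<odot>\<^bsub>?E\<^esub> i \<in> ?I"
      unfolding smult_ext_alg[OF ic] by (rule I_l_closed[OF i(1)]) (auto simp: sm)
    ultimately have "c \<odot>\<^bsub>?E\<^esub> g \<in> ?I +>\<^bsub>?E\<^esub> (c \<odot>\<^bsub>?E\<^esub> f)" by (auto simp: a_r_coset_def')
    then show ?thesis using a_repr_independence'[of _ "c \<odot>\<^bsub>?E\<^esub> f"] sm assms by simp
  qed
  moreover have "f \<in> ?I +>\<^bsub>?E\<^esub> f" using a_rcos_self assms by simp
  ultimately have "(\<Union>g\<in>?I +>\<^bsub>?E\<^esub> f. ?I +>\<^bsub>?E\<^esub> (c \<odot>\<^bsub>?E\<^esub> g)) = ?I +>\<^bsub>?E\<^esub> (c \<odot>\<^bsub>?E\<^esub> f)"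
    by (metis (no_types, lifting) SUP_eq_const empty_iff)
  then show ?thesis
    by (simp only: FDR_def to_FDR_def ring.defs module.defs module.simps)
qed

lemma vectorspace_FDR: "vectorspace class_ring (FDR n)"
proof -
  interpret ideal "FDR_ideal n" "ext_alg n" by (rule ideal_FDR_ideal)
  interpret Q: ring "ext_alg n Quot FDR_ideal n" by (rule quotient_is_ring)
  have ops: "carrier (FDR n) = to_FDR n ` carrier (ext_alg n)"
    "\<And>x y. x \<oplus>\<^bsub>FDR n\<^esub> y = x \<oplus>\<^bsub>ext_alg n Quot FDR_ideal n\<^esub> y"
    "\<zero>\<^bsub>FDR n\<^esub> = \<zero>\<^bsub>ext_alg n Quot FDR_ideal n\<^esub>"
    "carrier (FDR n) = carrier (ext_alg n Quot FDR_ideal n)"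
    by (auto simp: FDR_def ring.defs module.defs FactRing_def A_RCOSETS_def' to_FDR_def)
  have add: "to_FDR n f \<oplus>\<^bsub>FDR n\<^esub> to_FDR n g = to_FDR n (f \<oplus>\<^bsub>ext_alg n\<^esub> g)"
    if "f \<in> carrier (ext_alg n)" "g \<in> carrier (ext_alg n)" for f g
    using that a_rcos_sum unfolding ops by (simp add: FactRing_def to_FDR_def)
  have sm: "c \<odot>\<^bsub>ext_alg n\<^esub> g \<in> carrier (ext_alg n)" if "g \<in> carrier (ext_alg n)" for g c
    using that by (auto simp: ext_alg_def)
  interpret A: abelian_group "FDR n"
  proof (rule abelian_groupI; unfold ops(2,3,4))
    fix x assume "x \<in> carrier (ext_alg n Quot FDR_ideal n)"
    then show "\<exists>y\<in>carrier (ext_alg n Quot FDR_ideal n).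
        y \<oplus>\<^bsub>ext_alg n Quot FDR_ideal n\<^esub> x = \<zero>\<^bsub>ext_alg n Quot FDR_ideal n\<^esub>"
      using Q.l_neg Q.a_inv_closed by blast
  qed (fact Q.add.m_closed Q.zero_closed Q.a_assoc Q.a_comm Q.l_zero)+
  have "module class_ring (FDR n)"
  proof (rule Module.moduleI[OF class_cring.is_cring A.abelian_group_axioms])
    fix a b x y
    assume "x \<in> carrier (FDR n)" "y \<in> carrier (FDR n)"
    then obtain f g where f: "f \<in> carrier (ext_alg n)" "x = to_FDR n f"
      and g: "g \<in> carrier (ext_alg n)" "y = to_FDR n g" unfolding ops(1) by auto
    show "a \<odot>\<^bsub>FDR n\<^esub> (x \<oplus>\<^bsub>FDR n\<^esub> y) = a \<odot>\<^bsub>FDR n\<^esub> x \<oplus>\<^bsub>FDR n\<^esub> a \<odot>\<^bsub>FDR n\<^esub> y"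
      using f g by (simp add: add sm smult_to_FDR) (simp add: ext_alg_def algebra_simps)
  next
    fix a b x
    assume "x \<in> carrier (FDR n)"
    then obtain f where f: "f \<in> carrier (ext_alg n)" "x = to_FDR n f"
      unfolding ops(1) by auto
    show "a \<odot>\<^bsub>FDR n\<^esub> x \<in> carrier (FDR n)"
      using f by (simp add: sm smult_to_FDR ops(1))
    show "(a \<oplus>\<^bsub>class_ring\<^esub> b) \<odot>\<^bsub>FDR n\<^esub> x = a \<odot>\<^bsub>FDR n\<^esub> x \<oplus>\<^bsub>FDR n\<^esub> b \<odot>\<^bsub>FDR n\<^esub> x"
      using f by (simp add: add sm smult_to_FDR) (simp add: ext_alg_def algebra_simps)
    show "(a \<otimes>\<^bsub>class_ring\<^esub> b) \<odot>\<^bsub>FDR n\<^esub> x = a \<odot>\<^bsub>FDR n\<^esub> (b \<odot>\<^bsub>FDR n\<^esub> x)"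
      using f by (simp add: sm smult_to_FDR) (simp add: ext_alg_def algebra_simps)
    show "\<one>\<^bsub>class_ring\<^esub> \<odot>\<^bsub>FDR n\<^esub> x = x"
      using f by (simp add: smult_to_FDR) (simp add: ext_alg_def)
  qed
  then show ?thesis by (simp add: vectorspace_def class_field)
qed


subsection \<open>Block operators commute\<close>

definition below :: "gen \<Rightarrow> gen set \<Rightarrow> complex" where
  "below \<omega> T = (-1) ^ card {t \<in> T. t < \<omega>}"

lemma below_insert:
  assumes "finite T" "\<eta> \<notin> T" "\<eta> \<noteq> \<omega>"
  shows "below \<omega> (insert \<eta> T) = (if \<eta> < \<omega> then - below \<omega> T else below \<omega> T)"
proof -
  have "{t \<in> insert \<eta> T. t < \<omega>} = (if \<eta> < \<omega> then insert \<eta> {t \<in> T. t < \<omega>} else {t \<in> T. t < \<omega>})"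
    by auto
  then show ?thesis using assms by (simp add: below_def)
qed

lemma below_remove:
  assumes "finite T" "\<eta> \<in> T" "\<eta> \<noteq> \<omega>"
  shows "below \<omega> (T - {\<eta>}) = (if \<eta> < \<omega> then - below \<omega> T else below \<omega> T)"
  using below_insert[of "T - {\<eta>}" \<eta> \<omega>] assms by (auto simp: insert_absorb)

lemma below_sq: "below \<omega> T * below \<omega> T = 1" "below \<omega> T * (below \<omega> T * x) = x"
  by (simp_all add: below_def flip: power_mult_distrib mult.assoc)

lemma ext_mult_gen:
  "ext_mult (ext_monom {\<omega>}) f U =
     (if finite U \<and> \<omega> \<in> U then below \<omega> U * f (U - {\<omega>}) else 0)"
proof (cases "finite U")
  case True
  have "ext_mult (ext_monom {\<omega>}) f U
      = (\<Sum>S\<in>{S \<in> Pow U. S = {\<omega>}}. shuffle_sign S (U - S) * f (U - S))"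
    unfolding ext_mult_def ext_monom_def sum.inter_filter[OF finite_Pow_iff[THEN iffD2, OF True]]
    by (rule sum.cong) auto
  also have "{S \<in> Pow U. S = {\<omega>}} = (if \<omega> \<in> U then {{\<omega>}} else {})" by auto
  finally have e: "ext_mult (ext_monom {\<omega>}) f U
      = (if \<omega> \<in> U then shuffle_sign {\<omega>} (U - {\<omega>}) * f (U - {\<omega>}) else 0)" by simp
  have "{(s, t). s \<in> {\<omega>} \<and> t \<in> U - {\<omega>} \<and> t < s} = Pair \<omega> ` {t \<in> U. t < \<omega>}" by auto
  then have "shuffle_sign {\<omega>} (U - {\<omega>}) = below \<omega> U"
    unfolding shuffle_sign_def below_def by (simp add: card_image inj_on_def)
  with e True show ?thesis by simp
qed (simp add: ext_mult_def)

lemma contract_alt: "contract \<omega> f T = (if \<omega> \<in> T then 0 else below \<omega> T * f (insert \<omega> T))"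
  by (simp add: contract_def below_def)

lemma contract_mult_gen:
  assumes "\<And>S. f S \<noteq> 0 \<Longrightarrow> finite S"
  shows "contract \<omega> (ext_mult (ext_monom {\<eta>}) f)
     = (\<lambda>T. (if \<omega> = \<eta> then f T else 0) - ext_mult (ext_monom {\<eta>}) (contract \<omega> f) T)"
proof
  fix T
  have "f T = 0" "f (insert \<omega> T - {\<eta>}) = 0" if "infinite T"
    using assms[of T] assms[of "insert \<omega> T - {\<eta>}"] that by auto
  then show "contract \<omega> (ext_mult (ext_monom {\<eta>}) f) T
     = (if \<omega> = \<eta> then f T else 0) - ext_mult (ext_monom {\<eta>}) (contract \<omega> f) T"
  proof (cases "finite T")
    case True
    consider "\<omega> = \<eta>" "\<omega> \<in> T" | "\<omega> = \<eta>" "\<omega> \<notin> T" | "\<omega> \<noteq> \<eta>" "\<omega> \<in> T" | "\<omega> \<noteq> \<eta>" "\<omega> \<notin> T" by blast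
    then show ?thesis
    proof cases
      case 4
      then show ?thesis using True
        by (auto simp: contract_alt ext_mult_gen below_insert below_remove insert_Diff_if)
    next
      case 2
      have "below \<omega> (insert \<omega> T) = below \<omega> T"
        unfolding below_def by (intro arg_cong[where f = "\<lambda>A. (-1) ^ card A"]) auto
      with 2 show ?thesis using True by (simp add: contract_alt ext_mult_gen below_sq)
    next
      case 1
      have "below \<omega> (T - {\<omega>}) = below \<omega> T"
        unfolding below_def by (intro arg_cong[where f = "\<lambda>A. (-1) ^ card A"]) auto
      with 1 show ?thesis using True by (simp add: contract_alt ext_mult_gen below_sq insert_absorb)
    qed (use True in \<open>auto simp: contract_alt ext_mult_gen\<close>)
  qed (auto simp: contract_alt ext_mult_gen)
qed


lemma mult_gen_anticommute:
  "ext_mult (ext_monom {\<omega>}) (ext_mult (ext_monom {\<eta>}) f)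
     = (\<lambda>T. - ext_mult (ext_monom {\<eta>}) (ext_mult (ext_monom {\<omega>}) f) T)"
  by (auto simp: fun_eq_iff ext_mult_gen below_remove Diff_insert2[symmetric] insert_commute)

lemma finite_below_Theta: "finite {t. t < Theta j}"
proof (rule finite_subset)
  show "{t. t < Theta j} \<subseteq> Theta ` {..<j}"
  proof
    fix t assume "t \<in> {t. t < Theta j}"
    then show "t \<in> Theta ` {..<j}"
      by (cases t) (auto simp: less_gen_def less_eq_gen_def)
  qed
qed auto

lemma below_Theta_insert:
  assumes "\<eta> \<notin> T" "\<eta> \<noteq> Theta j"
  shows "below (Theta j) (insert \<eta> T) = (if \<eta> < Theta j then - below (Theta j) T else below (Theta j) T)"
proof -
  have "{t \<in> insert \<eta> T. t < Theta j}
      = (if \<eta> < Theta j then insert \<eta> {t \<in> T. t < Theta j} else {t \<in> T. t < Theta j})"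
    by auto
  moreover have "finite {t \<in> T. t < Theta j}" by (rule finite_subset[OF _ finite_below_Theta]) auto
  ultimately show ?thesis using assms by (simp add: below_def)
qed

lemma contract_Theta_anticommute:
  "contract (Theta i) (contract (Theta j) f) = (\<lambda>T. - contract (Theta j) (contract (Theta i) f) T)"
proof
  fix T
  have "Theta i < Theta j \<longleftrightarrow> i < j" for i j by (auto simp: less_gen_def less_eq_gen_def)
  then show "contract (Theta i) (contract (Theta j) f) T = - contract (Theta j) (contract (Theta i) f) T"
    by (cases "i < j"; cases "i = j")
      (auto simp: contract_alt below_Theta_insert insert_commute[of "Theta i" "Theta j"])
qed

lemma mult_Xi_contract_Theta:
  "ext_mult (ext_monom {Xi i}) (contract (Theta j) (ext_mult (ext_monom {Xi k}) g))
     = (\<lambda>T. - ext_mult (ext_monom {Xi i}) (ext_mult (ext_monom {Xi k}) (contract (Theta j) g)) T)"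
  by (auto simp: fun_eq_iff ext_mult_gen contract_alt below_insert below_remove insert_Diff_if)

definition hook :: "nat \<Rightarrow> nat \<Rightarrow> ext \<Rightarrow> ext" where
  "hook i j f = ext_mult (ext_monom {Xi i}) (contract (Theta j) f)"

lemma neg_lin: "ext_mult (ext_monom {\<omega>}) (\<lambda>T. - f T) = (\<lambda>T. - ext_mult (ext_monom {\<omega>}) f T)"
  "contract \<omega> (\<lambda>T. - f T) = (\<lambda>T. - contract \<omega> f T)"
  by (auto simp: fun_eq_iff ext_mult_gen contract_alt)

lemma hook_commute: "hook i j (hook k l f) = hook k l (hook i j f)"
proof -
  let ?X = "\<lambda>i. ext_mult (ext_monom {Xi i})" and ?D = "\<lambda>j. contract (Theta j)"
  have "hook i j (hook k l f) = (\<lambda>T. - ?X i (?X k (?D j (?D l f))) T)"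
    by (simp add: hook_def mult_Xi_contract_Theta)
  also have "\<dots> = (\<lambda>T. ?X k (?X i (?D j (?D l f))) T)"
    by (subst mult_gen_anticommute) simp
  also have "\<dots> = (\<lambda>T. - ?X k (?X i (?D l (?D j f))) T)"
    by (subst contract_Theta_anticommute) (simp add: neg_lin)
  also have "\<dots> = hook k l (hook i j f)"
    by (simp add: hook_def mult_Xi_contract_Theta)
  finally show ?thesis .
qed

lemma hook_sum: "hook i j (\<lambda>T. \<Sum>p\<in>A. g p T) = (\<lambda>T. \<Sum>p\<in>A. hook i j (g p) T)"
  by (auto simp: fun_eq_iff hook_def ext_mult_gen contract_alt sum_distrib_left)

lemma block_op_eq_hooks:
  obtains P where "block_op B = (\<lambda>f T. \<Sum>(i, j)\<in>P. hook i j f T)"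
proof (cases "card B = 1")
  case True
  then show ?thesis
    by (intro that[of "{(the_elem B, the_elem B)}"]) (simp add: block_op_def fun_eq_iff hook_def)
next
  case False
  then show ?thesis
    by (intro that[of "{(i, j). i \<in> B \<and> j \<in> B \<and> i \<noteq> j}"]) (simp add: block_op_def fun_eq_iff hook_def)
qed

lemma comp_fun_commute_block_op: "comp_fun_commute block_op"
proof
  fix A B
  obtain P where P: "block_op A = (\<lambda>f T. \<Sum>(i, j)\<in>P. hook i j f T)" by (rule block_op_eq_hooks)
  obtain Q where Q: "block_op B = (\<lambda>f T. \<Sum>(i, j)\<in>Q. hook i j f T)" by (rule block_op_eq_hooks)
  have "block_op A (block_op B f) T = block_op B (block_op A f) T" for f T
  proof -
    have "block_op A (block_op B f) T = (\<Sum>(i, j)\<in>P. \<Sum>(k, l)\<in>Q. hook i j (hook k l f) T)"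
      by (simp add: P Q hook_sum split_def)
    also have "\<dots> = (\<Sum>(k, l)\<in>Q. \<Sum>(i, j)\<in>P. hook k l (hook i j f) T)"
      unfolding split_def by (subst sum.swap) (simp add: hook_commute)
    also have "\<dots> = block_op B (block_op A f) T"
      by (simp add: P Q hook_sum split_def)
    finally show ?thesis .
  qed
  then show "block_op B \<circ> block_op A = block_op A \<circ> block_op B" by (simp add: fun_eq_iff)
qed

subsection \<open>Products of generators\<close>

lemma gprod_Cons: "gprod (x # xs) = ext_mult (ext_monom {x}) (gprod xs)"
  by (simp add: gprod_def)

lemma gprod_finite: "gprod xs S \<noteq> 0 \<Longrightarrow> finite S"
  by (cases xs) (simp_all add: gprod_Cons ext_mult_gen gprod_def[of "[]"] ext_monom_def[of "{}"]
      split: if_splits)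

lemma contract_gprod_notin: "\<omega> \<notin> set xs \<Longrightarrow> contract \<omega> (gprod xs) = (\<lambda>T. 0)"
proof (induction xs)
  case Nil
  then show ?case by (auto simp: contract_def gprod_def ext_monom_def)
next
  case (Cons x xs)
  then show ?case
    by (simp add: gprod_Cons contract_mult_gen[OF gprod_finite]) (simp add: ext_mult_gen fun_eq_iff)
qed

lemma contract_gprod:
  assumes "distinct xs" "s < length xs"
  shows "contract (xs ! s) (gprod xs) = (\<lambda>T. (-1) ^ s * gprod (take s xs @ drop (Suc s) xs) T)"
  using assms
proof (induction xs arbitrary: s)
  case (Cons x xs)
  show ?case
  proof (cases s)
    case 0
    then show ?thesis using Cons.prems
      by (simp add: gprod_Cons contract_mult_gen[OF gprod_finite] contract_gprod_notin)
        (simp add: ext_mult_gen fun_eq_iff)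
  next
    case (Suc r)
    then have "xs ! r \<noteq> x" using Cons.prems by auto
    then show ?thesis using Suc Cons.prems Cons.IH[of r]
      by (simp add: gprod_Cons contract_mult_gen[OF gprod_finite]) (simp add: ext_mult_gen fun_eq_iff)
  qed
qed simp

lemma gprod_sorted_list_of_set:
  "finite S \<Longrightarrow> gprod (sorted_list_of_set S) = ext_monom S"
proof (induction "card S" arbitrary: S)
  case 0
  then show ?case by (simp add: gprod_def)
next
  case (Suc m)
  then have ne: "S \<noteq> {}" by auto
  let ?x = "Min S"
  have "gprod (sorted_list_of_set S) = ext_mult (ext_monom {?x}) (gprod (sorted_list_of_set (S - {?x})))"
    using sorted_list_of_set_nonempty[OF \<open>finite S\<close> ne] by (simp add: gprod_Cons)
  also have "gprod (sorted_list_of_set (S - {?x})) = ext_monom (S - {?x})"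
    using Suc ne by (intro Suc.hyps(1)) auto
  also have "ext_mult (ext_monom {?x}) (ext_monom (S - {?x})) = ext_monom S"
  proof
    fix U
    have "{t \<in> S. t < ?x} = {}" using Suc.prems by (auto simp: not_less)
    then have "below ?x S = 1" unfolding below_def by (simp only: card.empty power_0)
    moreover have "U - {?x} = S - {?x} \<and> ?x \<in> U \<longleftrightarrow> U = S" using Min_in[OF Suc.prems ne] by auto
    ultimately show "ext_mult (ext_monom {?x}) (ext_monom (S - {?x})) U = ext_monom S U"
      using Suc.prems unfolding ext_mult_gen unfolding ext_monom_def[of S] ext_monom_def[of "S - {Min S}"] by auto
  qed
  finally show ?case .
qed

end

theory Submission
  imports Defs "HOL-Library.Function_Algebras"
begin

text \<open>The ideal of invariants is generated by \<open>\<Sum>\<theta>\<^sub>i\<close>, \<open>\<Sum>\<xi>\<^sub>i\<close> and \<open>\<Sum>\<theta>\<^sub>i\<xi>\<^sub>i\<close>.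

  Independence.  Let \<open>G\<^sub>\<sigma>\<close> be defined like \<open>F\<^sub>\<sigma>\<close>, but with the full sums
  \<open>\<Sum>\<^bsub>i,j\<in>B\<^esub> \<xi>\<^sub>i(\<theta>\<^sub>j \<odot> -)\<close> as block operators.  Then \<open>(\<Sum>\<xi>\<^sub>i) \<odot> G\<^sub>\<sigma>\<close> is orthogonal to the ideal, and
  its pairing with \<open>f\<^sub>\<pi>\<close> is \<open>n \<langle>F\<^sub>\<pi>, G\<^sub>\<sigma>\<rangle>\<close>.  This vanishes unless every singleton of \<open>\<sigma>\<close> is one of
  \<open>\<pi>\<close>, and it equals \<open>\<langle>F\<^sub>\<pi>, F\<^sub>\<sigma>\<rangle>\<close> if \<open>\<pi>\<close> and \<open>\<sigma>\<close> have the same singletons.  So the pairing matrix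
  is block triangular with Gram matrices on the diagonal, and it suffices that the \<open>F\<^sub>\<pi>\<close> with \<open>\<pi>\<close>
  noncrossing are independent.  They are, because a noncrossing partition is determined by its block
  minima and maxima, which index a leading coefficient.

  Spanning.  Modulo \<open>\<Sum>\<theta>\<^sub>i\<close> and \<open>\<Sum>\<xi>\<^sub>i\<close> the elements \<open>a\<^sub>i = \<theta>\<^sub>1 + \<dots> + \<theta>\<^sub>i\<close> and
  \<open>b\<^sub>i = \<xi>\<^sub>i - \<xi>\<^bsub>i+1\<^esub>\<close> with \<open>i < n\<close> generate, and \<open>\<Sum>\<theta>\<^sub>i\<xi>\<^sub>i\<close> becomes \<open>\<Sum>a\<^sub>ib\<^sub>i\<close>.  This relation
  straightens every monomial of degree \<open>(n-k, k-1)\<close> into those indexed by two-coloured Motzkin paths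
  of length \<open>n - 1\<close>, and reading off the block minima and maxima shows that there are at most as many
  of these as noncrossing partitions with \<open>k\<close> blocks.\<close>

section \<open>Linear operators on the exterior algebra\<close>

text \<open>For a block B with several elements the off-diagonal operator does not factor. With the
  diagonal added it is multiplication by the sum of the \<open>\<xi>\<^sub>i\<close> over B after
  contraction by the sum of the \<open>\<theta>\<^sub>j\<close> over B, two anticommuting operators
  of square zero. This is why the adjoints of the three generators kill the test vectors. The price
  is that \<open>G\<^sub>\<sigma>\<close> has extra monomials, in which a block adds
  \<open>\<xi>\<^sub>i\<close> and deletes \<open>\<theta>\<^sub>i\<close> for the same i; in
  \<open>F\<^sub>\<sigma>\<close> only singletons do this, hence the role of the singletons. All
  coefficients are -1, 0 or 1, so conjugation fixes the vectors and a combination orthogonal to its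
  own constituents has norm zero. The new generators come from summation by parts:
  \<open>\<Sum>\<theta>\<^sub>i\<xi>\<^sub>i\<close> is the sum of the
  \<open>a\<^sub>ib\<^sub>i\<close> with i < n plus \<open>a\<^sub>n\<xi>\<^sub>n\<close>, and
  \<open>a\<^sub>n\<close> is in the ideal. The products \<open>a\<^sub>ib\<^sub>i\<close> are even,
  so they can be moved without signs and the relation becomes one about sets of positions.
  Independence bounds the dimension from below and ballot monomials bound it from above, so neither
  family is ever expressed through the other.\<close>

abbreviation mul :: "gen \<Rightarrow> ext \<Rightarrow> ext" where
  "mul \<omega> \<equiv> ext_mult (ext_monom {\<omega>})"

text \<open>All subspaces below live in the full function type with pointwise operations, so spans
  and linear maps come without carrier conditions. The scaling agrees with the module operation of
  \<open>ext_alg n\<close>, see \<open>ext_alg_ops\<close>.\<close>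

definition ext_scale :: "complex \<Rightarrow> ext \<Rightarrow> ext" where
  "ext_scale c f = (\<lambda>S. c * f S)"

interpretation ext: vector_space ext_scale
  by unfold_locales (auto simp: ext_scale_def fun_eq_iff algebra_simps)

abbreviation "ext_linear \<equiv> Vector_Spaces.linear ext_scale ext_scale"

lemma sum_fun_apply: "(\<Sum>i\<in>A. f i) x = (\<Sum>i\<in>A. f i x)"
  by (induction A rule: infinite_finite_induct) auto

lemma ext_linearI:
  assumes "\<And>f g. L (f + g) = L f + L g" "\<And>c f. L (ext_scale c f) = ext_scale c (L f)"
  shows "ext_linear L"
  unfolding Vector_Spaces.linear_iff
  using assms ext.vector_space_axioms by auto

lemma ext_linear_add: "ext_linear L \<Longrightarrow> L (f + g) = L f + L g"
  and ext_linear_diff: "ext_linear L \<Longrightarrow> L (f - g) = L f - L g"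
  and ext_linear_neg: "ext_linear L \<Longrightarrow> L (- f) = - L f"
  and ext_linear_zero: "ext_linear L \<Longrightarrow> L 0 = 0"
  and ext_linear_scale: "ext_linear L \<Longrightarrow> L (ext_scale c f) = ext_scale c (L f)"
  and ext_linear_sum: "ext_linear L \<Longrightarrow> L (\<Sum>i\<in>A. F i) = (\<Sum>i\<in>A. L (F i))"
  by (simp_all add: Vector_Spaces.linear.axioms module_hom.add module_hom.diff module_hom.neg
      module_hom.zero module_hom.scale module_hom.sum Vector_Spaces.linear_iff_module_hom)

lemma linear_ext_mult: "ext_linear (ext_mult f)" "ext_linear (\<lambda>g. ext_mult g f)"
  by (auto intro!: ext_linearI simp: ext_mult_def ext_scale_def fun_eq_iff algebra_simps sum.distrib sum_distrib_left)

lemma linear_contract: "ext_linear (contract \<omega>)"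
  by (auto intro!: ext_linearI simp: contract_def ext_scale_def fun_eq_iff algebra_simps)

lemma ext_linear_comp: "ext_linear L \<Longrightarrow> ext_linear M \<Longrightarrow> ext_linear (\<lambda>f. L (M f))"
  by (intro ext_linearI) (simp_all only: ext_linear_add[of L] ext_linear_add[of M] ext_linear_scale[of L] ext_linear_scale[of M])

lemma ext_linear_sum_op:
  assumes "\<And>i. i \<in> A \<Longrightarrow> ext_linear (L i)"
  shows "ext_linear (\<lambda>f. \<Sum>i\<in>A. L i f)"
proof (intro ext_linearI)
  fix f g :: ext and c
  show "(\<Sum>i\<in>A. L i (f + g)) = (\<Sum>i\<in>A. L i f) + (\<Sum>i\<in>A. L i g)"
    using ext_linear_add[OF assms] by (simp only: sum.distrib[symmetric] cong: sum.cong)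
  show "(\<Sum>i\<in>A. L i (ext_scale c f)) = ext_scale c (\<Sum>i\<in>A. L i f)"
    using ext_linear_scale[OF assms] by (simp only: ext.scale_sum_right cong: sum.cong)
qed

lemma ext_linear_diff_op: "ext_linear L \<Longrightarrow> ext_linear M \<Longrightarrow> ext_linear (\<lambda>f. L f - M f)"
  by (intro ext_linearI)
    (simp_all only: ext_linear_add[of L] ext_linear_add[of M] ext_linear_scale[of L] ext_linear_scale[of M]
      ext.scale_right_diff_distrib add_diff_add)

lemmas mul_linear_simps =
  ext_linear_add[OF linear_ext_mult(1)] ext_linear_diff[OF linear_ext_mult(1)] ext_linear_neg[OF linear_ext_mult(1)]
  ext_linear_zero[OF linear_ext_mult(1)] ext_linear_scale[OF linear_ext_mult(1)] ext_linear_sum[OF linear_ext_mult(1)]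

lemmas contract_linear_simps =
  ext_linear_add[OF linear_contract] ext_linear_diff[OF linear_contract] ext_linear_neg[OF linear_contract]
  ext_linear_zero[OF linear_contract] ext_linear_scale[OF linear_contract] ext_linear_sum[OF linear_contract]

abbreviation "ext_space n \<equiv> carrier (ext_alg n)"

lemma ext_space_iff: "f \<in> ext_space n \<longleftrightarrow> (\<forall>S. f S \<noteq> 0 \<longrightarrow> S \<subseteq> gens n)"
  by (simp add: ext_alg_def)

lemma ext_space_subspace: "ext.subspace (ext_space n)"
  unfolding ext.subspace_def by (force simp: ext_space_iff ext_scale_def)

lemma ext_space_finite: "f \<in> ext_space n \<Longrightarrow> f S \<noteq> 0 \<Longrightarrow> finite S"
  using finite_subset[OF _ finite_gens] by (auto simp: ext_space_iff)

lemma ext_space_mul: "\<omega> \<in> gens n \<Longrightarrow> f \<in> ext_space n \<Longrightarrow> mul \<omega> f \<in> ext_space n"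
  by (rule ext_mult_carrier) (auto simp: ext_space_iff ext_monom_def split: if_splits)

lemma ext_space_contract: "f \<in> ext_space n \<Longrightarrow> contract \<omega> f \<in> ext_space n"
  by (auto simp: ext_space_iff contract_def split: if_splits)

lemma ext_space_monom: "S \<subseteq> gens n \<Longrightarrow> ext_monom S \<in> ext_space n"
  by (auto simp: ext_space_iff ext_monom_def split: if_splits)

lemma ext_space_gprod: "set xs \<subseteq> gens n \<Longrightarrow> gprod xs \<in> ext_space n"
  by (induction xs) (auto simp: gprod_Cons ext_space_mul, simp add: gprod_def ext_space_monom)

lemma mul_anti: "mul \<omega> (mul \<eta> f) = - mul \<eta> (mul \<omega> f)"
  by (subst mult_gen_anticommute) (simp add: fun_eq_iff)

lemma mul_sq: "mul \<omega> (mul \<omega> f) = 0"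
  by (simp add: fun_eq_iff ext_mult_gen)

text \<open>Membership in \<open>ext_space n\<close> disposes of infinite index sets: there the
  exponent of a sign may be the cardinality of an infinite set, hence 0, and no longer tracks
  insertions, but both coefficients of f vanish.\<close>

lemma contract_anti:
  assumes "f \<in> ext_space n"
  shows "contract \<omega> (contract \<eta> f) = - contract \<eta> (contract \<omega> f)"
proof
  fix T
  show "contract \<omega> (contract \<eta> f) T = (- contract \<eta> (contract \<omega> f)) T"
  proof (cases "finite T")
    case True
    then show ?thesis
      by (cases "\<omega> < \<eta>"; cases "\<omega> = \<eta>")
        (auto simp: contract_alt below_insert insert_commute[of \<omega> \<eta>])
  next
    case False
    then have "f (insert \<omega> (insert \<eta> T)) = 0" "f (insert \<eta> (insert \<omega> T)) = 0"
      using ext_space_finite[OF assms] by (meson finite_insert)+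
    then show ?thesis by (simp add: contract_alt)
  qed
qed

text \<open>This is the Clifford relation between multiplication and contraction. Together with the
  two anticommutation laws it yields the commutation rules for block sums.\<close>

lemma contract_mul:
  assumes "f \<in> ext_space n"
  shows "contract \<omega> (mul \<eta> f) = (if \<omega> = \<eta> then f else 0) - mul \<eta> (contract \<omega> f)"
  using contract_mult_gen[of f, OF ext_space_finite[OF assms]] by (auto simp: fun_eq_iff)

section \<open>The bilinear form for which the standard monomials are orthonormal\<close>

definition pairing :: "nat \<Rightarrow> ext \<Rightarrow> ext \<Rightarrow> complex" where
  "pairing n f g = (\<Sum>U\<in>Pow (gens n). f U * g U)"

lemma pairing_add: "pairing n (f + g) h = pairing n f h + pairing n g h"
  and pairing_scale: "pairing n (ext_scale c f) h = c * pairing n f h"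
  and pairing_sum: "pairing n (\<Sum>i\<in>A. F i) h = (\<Sum>i\<in>A. pairing n (F i) h)"
  and pairing_sum_right: "pairing n h (\<Sum>i\<in>A. F i) = (\<Sum>i\<in>A. pairing n h (F i))"
  and pairing_zero_right: "pairing n h 0 = 0"
  and pairing_sym: "pairing n f h = pairing n h f"
  by (simp_all add: pairing_def ext_scale_def sum_fun_apply algebra_simps sum.distrib sum_distrib_left
      sum.swap[of _ _ A] del: sum.swap_restrict)

lemma below_remove_self: "below \<omega> (T - {\<omega>}) = below \<omega> T"
  unfolding below_def by (intro arg_cong[where f = "\<lambda>A. (-1) ^ card A"]) auto

text \<open>Both sides match the coefficient at T with the one at T enlarged by
  \<open>\<omega>\<close>, and the sign \<open>below \<omega>\<close> does not see whether
  \<open>\<omega>\<close> itself belongs to the set.\<close>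

lemma pairing_adjoint:
  assumes "\<omega> \<in> gens n"
  shows "pairing n (mul \<omega> f) g = pairing n f (contract \<omega> g)"
proof -
  have "pairing n (mul \<omega> f) g = (\<Sum>U\<in>{U \<in> Pow (gens n). \<omega> \<in> U}. below \<omega> U * f (U - {\<omega>}) * g U)"
    unfolding pairing_def
    by (rule sum.mono_neutral_cong_right)
      (auto simp: finite_gens ext_mult_gen intro: finite_subset[OF _ finite_gens])
  also have "\<dots> = (\<Sum>T\<in>{T \<in> Pow (gens n). \<omega> \<notin> T}. f T * (below \<omega> T * g (insert \<omega> T)))"
    by (rule sum.reindex_bij_witness[where i = "insert \<omega>" and j = "\<lambda>U. U - {\<omega>}"])
      (use assms in \<open>auto simp: insert_absorb below_remove_self\<close>)
  also have "\<dots> = pairing n f (contract \<omega> g)"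
    unfolding pairing_def
    by (rule sum.mono_neutral_cong_left) (auto simp: finite_gens contract_alt)
  finally show ?thesis .
qed

section \<open>The ideal generated by the invariants\<close>

definition theta_mul :: "nat \<Rightarrow> ext \<Rightarrow> ext" where
  "theta_mul n f = (\<Sum>i\<in>{1..n}. mul (Theta i) f)"

definition xi_mul :: "nat \<Rightarrow> ext \<Rightarrow> ext" where
  "xi_mul n f = (\<Sum>i\<in>{1..n}. mul (Xi i) f)"

definition theta_xi_mul :: "nat \<Rightarrow> ext \<Rightarrow> ext" where
  "theta_xi_mul n f = (\<Sum>i\<in>{1..n}. mul (Theta i) (mul (Xi i) f))"

text \<open>Only right multiples of the three sums are taken. Right closure is then associativity,
  and left closure holds because every generator commutes with each sum up to sign, see
  \<open>mul_ops\<close>.\<close>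

definition sum_ideal :: "nat \<Rightarrow> ext set" where
  "sum_ideal n = {theta_mul n a + xi_mul n b + theta_xi_mul n c | a b c. a \<in> ext_space n \<and> b \<in> ext_space n \<and> c \<in> ext_space n}"

lemma linear_theta_mul: "ext_linear (theta_mul n)" and linear_xi_mul: "ext_linear (xi_mul n)" and linear_theta_xi_mul: "ext_linear (theta_xi_mul n)"
proof -
  show "ext_linear (theta_mul n)" unfolding theta_mul_def[abs_def] by (intro ext_linear_sum_op linear_ext_mult)
  show "ext_linear (xi_mul n)" unfolding xi_mul_def[abs_def] by (intro ext_linear_sum_op linear_ext_mult)
  show "ext_linear (theta_xi_mul n)" unfolding theta_xi_mul_def[abs_def]
    by (rule ext_linear_sum_op, rule ext_linear_comp, rule linear_ext_mult, rule linear_ext_mult)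
qed

lemma gens_mem [simp]: "Theta i \<in> gens n \<longleftrightarrow> i \<in> {1..n}" "Xi i \<in> gens n \<longleftrightarrow> i \<in> {1..n}"
  by (auto simp: gens_def)

lemma ext_space_ops:
  assumes "f \<in> ext_space n"
  shows "theta_mul n f \<in> ext_space n" "xi_mul n f \<in> ext_space n" "theta_xi_mul n f \<in> ext_space n"
  unfolding theta_mul_def xi_mul_def theta_xi_mul_def using assms
  by (auto intro!: ext.subspace_sum[OF ext_space_subspace] ext_space_mul)

lemma sum_ideal_subset: "sum_ideal n \<subseteq> ext_space n"
  by (auto simp: sum_ideal_def intro!: ext.subspace_add[OF ext_space_subspace] ext_space_ops)

lemma ext_space_zero: "0 \<in> ext_space n" by (simp add: ext_space_iff)

lemma sum_ideal_I:
  assumes "f \<in> ext_space n"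
  shows "theta_mul n f \<in> sum_ideal n" "xi_mul n f \<in> sum_ideal n" "theta_xi_mul n f \<in> sum_ideal n"
proof -
  note z = ext_space_zero[of n] ext_linear_zero[OF linear_theta_mul] ext_linear_zero[OF linear_xi_mul] ext_linear_zero[OF linear_theta_xi_mul]
  have "theta_mul n f = theta_mul n f + xi_mul n 0 + theta_xi_mul n 0" "xi_mul n f = theta_mul n 0 + xi_mul n f + theta_xi_mul n 0"
    "theta_xi_mul n f = theta_mul n 0 + xi_mul n 0 + theta_xi_mul n f" by (simp_all add: z)
  then show "theta_mul n f \<in> sum_ideal n" "xi_mul n f \<in> sum_ideal n" "theta_xi_mul n f \<in> sum_ideal n"
    unfolding sum_ideal_def using assms ext_space_zero by blast+
qed

lemma sum_ideal_E:
  assumes "x \<in> sum_ideal n"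
  obtains a b c where "a \<in> ext_space n" "b \<in> ext_space n" "c \<in> ext_space n" "x = theta_mul n a + xi_mul n b + theta_xi_mul n c"
  using assms by (auto simp: sum_ideal_def)

lemma sum_ideal_subspace: "ext.subspace (sum_ideal n)"
proof (rule ext.subspaceI)
  show "0 \<in> sum_ideal n" using sum_ideal_I(1)[OF ext_space_zero] by (simp add: ext_linear_zero[OF linear_theta_mul])
next
  fix x y assume "x \<in> sum_ideal n" "y \<in> sum_ideal n"
  from \<open>x \<in> sum_ideal n\<close> obtain a b c where
    1: "a \<in> ext_space n" "b \<in> ext_space n" "c \<in> ext_space n" "x = theta_mul n a + xi_mul n b + theta_xi_mul n c"
    by (rule sum_ideal_E)
  from \<open>y \<in> sum_ideal n\<close> obtain a' b' c' where
    2: "a' \<in> ext_space n" "b' \<in> ext_space n" "c' \<in> ext_space n" "y = theta_mul n a' + xi_mul n b' + theta_xi_mul n c'"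
    by (rule sum_ideal_E)
  note * = 1 2
  have "x + y = theta_mul n (a + a') + xi_mul n (b + b') + theta_xi_mul n (c + c')"
    by (simp only: * ext_linear_add[OF linear_theta_mul] ext_linear_add[OF linear_xi_mul] ext_linear_add[OF linear_theta_xi_mul] ac_simps)
  then show "x + y \<in> sum_ideal n"
    unfolding sum_ideal_def using * ext.subspace_add[OF ext_space_subspace] by blast
next
  fix x k assume "x \<in> sum_ideal n"
  then obtain a b c where
    *: "a \<in> ext_space n" "b \<in> ext_space n" "c \<in> ext_space n" "x = theta_mul n a + xi_mul n b + theta_xi_mul n c"
    by (rule sum_ideal_E)
  have "ext_scale k x = theta_mul n (ext_scale k a) + xi_mul n (ext_scale k b) + theta_xi_mul n (ext_scale k c)"
    by (simp only: * ext_linear_scale[OF linear_theta_mul] ext_linear_scale[OF linear_xi_mul] ext_linear_scale[OF linear_theta_xi_mul] ext.scale_right_distrib)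
  then show "ext_scale k x \<in> sum_ideal n"
    unfolding sum_ideal_def using * ext.subspace_scale[OF ext_space_subspace] by blast
qed

lemma mul_ops:
  "mul \<omega> (theta_mul n f) = - theta_mul n (mul \<omega> f)"
  "mul \<omega> (xi_mul n f) = - xi_mul n (mul \<omega> f)"
  "mul \<omega> (theta_xi_mul n f) = theta_xi_mul n (mul \<omega> f)"
  unfolding theta_mul_def xi_mul_def theta_xi_mul_def
    apply (simp add: mul_linear_simps mul_anti[of \<omega>] sum_negf)
   apply (simp add: mul_linear_simps mul_anti[of \<omega>] sum_negf)
  apply (simp add: mul_linear_simps)
  apply (rule sum.cong[OF refl])
  apply (subst mul_anti, subst (2) mul_anti)
  apply (simp add: mul_linear_simps)
  done

lemma sum_ideal_mul:
  assumes "x \<in> sum_ideal n" "\<omega> \<in> gens n"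
  shows "mul \<omega> x \<in> sum_ideal n"
proof -
  from assms(1) obtain a b c where
    *: "a \<in> ext_space n" "b \<in> ext_space n" "c \<in> ext_space n" "x = theta_mul n a + xi_mul n b + theta_xi_mul n c"
    by (rule sum_ideal_E)
  show ?thesis
    using * assms(2)
    by (auto simp: mul_linear_simps mul_ops intro!: ext.subspace_add[OF sum_ideal_subspace]
        ext.subspace_diff[OF sum_ideal_subspace] ext.subspace_neg[OF sum_ideal_subspace] sum_ideal_I ext_space_mul)
qed

lemma ops_mult_right:
  "ext_mult (theta_mul n f) g = theta_mul n (ext_mult f g)"
  "ext_mult (xi_mul n f) g = xi_mul n (ext_mult f g)"
  "ext_mult (theta_xi_mul n f) g = theta_xi_mul n (ext_mult f g)"
  unfolding theta_mul_def xi_mul_def theta_xi_mul_def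
  by (simp_all add: ext_linear_sum[OF linear_ext_mult(2)] ext_mult_assoc)

lemma sum_ideal_mult_right:
  assumes "x \<in> sum_ideal n" "g \<in> ext_space n"
  shows "ext_mult x g \<in> sum_ideal n"
proof -
  from assms(1) obtain a b c where
    *: "a \<in> ext_space n" "b \<in> ext_space n" "c \<in> ext_space n" "x = theta_mul n a + xi_mul n b + theta_xi_mul n c"
    by (rule sum_ideal_E)
  show ?thesis
    using * assms(2)
    by (auto simp: ext_linear_add[OF linear_ext_mult(2)] ops_mult_right intro!: ext.subspace_add[OF sum_ideal_subspace]
        sum_ideal_I ext_mult_carrier)
qed

lemma ext_space_expand:
  assumes "f \<in> ext_space n"
  shows "f = (\<Sum>S\<in>Pow (gens n). ext_scale (f S) (ext_monom S))"
proof
  fix T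
  have "(\<Sum>S\<in>Pow (gens n). ext_scale (f S) (ext_monom S)) T = (\<Sum>S\<in>Pow (gens n). if S = T then f T else 0)"
    unfolding sum_fun_apply by (rule sum.cong) (auto simp: ext_scale_def ext_monom_def)
  also have "\<dots> = f T" using assms finite_gens[of n] by (auto simp: ext_space_iff)
  finally show "f T = (\<Sum>S\<in>Pow (gens n). ext_scale (f S) (ext_monom S)) T" by simp
qed

lemma ext_monom_mult:
  assumes "set xs \<subseteq> gens n" "x \<in> ext_space n"
  shows "ext_mult (gprod xs) x = foldr mul xs x"
  using assms(1)
proof (induction xs)
  case Nil
  then show ?case using ext_mult_one_left[OF ext_space_finite[OF assms(2)]] by (simp add: gprod_def)
next
  case (Cons y xs)
  then show ?case by (simp add: gprod_Cons ext_mult_assoc)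
qed

lemma sum_ideal_mult_left:
  assumes "x \<in> sum_ideal n" "g \<in> ext_space n"
  shows "ext_mult g x \<in> sum_ideal n"
proof -
  have fold: "foldr mul xs x \<in> sum_ideal n" if "set xs \<subseteq> gens n" for xs
    using that by (induction xs) (auto simp: assms sum_ideal_mul)
  have 1: "ext_mult (ext_monom S) x \<in> sum_ideal n" if "S \<in> Pow (gens n)" for S
  proof -
    have "finite S" using that finite_subset[OF _ finite_gens] by auto
    then show ?thesis
      using that fold[of "sorted_list_of_set S"] ext_monom_mult[of "sorted_list_of_set S" n x]
        subsetD[OF sum_ideal_subset assms(1)] by (auto simp: gprod_sorted_list_of_set)
  qed
  have "ext_mult g x = (\<Sum>S\<in>Pow (gens n). ext_scale (g S) (ext_mult (ext_monom S) x))"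
    by (subst ext_space_expand[OF assms(2)])
      (simp only: ext_linear_sum[OF linear_ext_mult(2)] ext_linear_scale[OF linear_ext_mult(2)])
  then show ?thesis
    using 1 by (auto intro!: ext.subspace_sum[OF sum_ideal_subspace] ext.subspace_scale[OF sum_ideal_subspace])
qed

lemma ext_alg_ops: "x \<otimes>\<^bsub>ext_alg n\<^esub> y = ext_mult x y" "x \<oplus>\<^bsub>ext_alg n\<^esub> y = x + y"
  "\<zero>\<^bsub>ext_alg n\<^esub> = 0" "c \<odot>\<^bsub>ext_alg n\<^esub> x = ext_scale c x"
  by (auto simp: ext_alg_def fun_eq_iff ext_scale_def)

lemma ideal_sum_ideal: "ideal (sum_ideal n) (ext_alg n)"
proof (rule idealI[OF ring_ext_alg])
  interpret ring "ext_alg n" by (rule ring_ext_alg)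
  show "subgroup (sum_ideal n) (add_monoid (ext_alg n))"
  proof (rule add.subgroupI)
    show "sum_ideal n \<subseteq> ext_space n" by (rule sum_ideal_subset)
    show "sum_ideal n \<noteq> {}" using ext.subspace_0[OF sum_ideal_subspace] by auto
    fix x assume x: "x \<in> sum_ideal n"
    have "(- x) \<oplus>\<^bsub>ext_alg n\<^esub> x = \<zero>\<^bsub>ext_alg n\<^esub>" by (simp add: ext_alg_ops)
    moreover have "- x \<in> sum_ideal n" using x by (rule ext.subspace_neg[OF sum_ideal_subspace])
    moreover have "- x \<in> ext_space n" "x \<in> ext_space n" using x calculation(2) sum_ideal_subset by auto
    ultimately show "\<ominus>\<^bsub>ext_alg n\<^esub> x \<in> sum_ideal n"
      using minus_equality[of "- x" x] by simp
    fix y assume "y \<in> sum_ideal n"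
    then show "x \<oplus>\<^bsub>ext_alg n\<^esub> y \<in> sum_ideal n"
      using x by (simp add: ext_alg_ops ext.subspace_add[OF sum_ideal_subspace])
  qed
qed (simp_all add: ext_alg_ops sum_ideal_mult_left sum_ideal_mult_right)

section \<open>Orbit sums and generators for the invariants\<close>

definition orbit_sum :: "nat \<Rightarrow> gen list \<Rightarrow> ext" where
  "orbit_sum n xs = (\<Sum>w | w permutes {1..n}. gprod (map (perm_gen w) xs))"

lemma gprod_move_front:
  "gprod (ys @ x # zs) = ext_scale ((-1) ^ length ys) (gprod (x # ys @ zs))"
proof (induction ys)
  case Nil
  then show ?case by simp
next
  case (Cons y ys)
  have "gprod ((y # ys) @ x # zs) = ext_scale ((-1) ^ length ys) (mul y (mul x (gprod (ys @ zs))))"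
    by (simp add: gprod_Cons Cons.IH mul_linear_simps)
  also have "\<dots> = ext_scale ((-1) ^ length (y # ys)) (gprod (x # (y # ys) @ zs))"
    by (subst mul_anti) (simp add: gprod_Cons)
  finally show ?case .
qed

lemma gprod_dup: "x \<in> set ys \<Longrightarrow> gprod (x # ys) = 0"
  by (auto simp: in_set_conv_decomp gprod_Cons[of x] gprod_move_front mul_linear_simps mul_sq)

lemma orbit_sum_move_front: "orbit_sum n (ys @ x # zs) = ext_scale ((-1) ^ length ys) (orbit_sum n (x # ys @ zs))"
  by (simp add: orbit_sum_def gprod_move_front ext.scale_sum_right)

lemma orbit_sum_dup: "x \<in> set ys \<Longrightarrow> orbit_sum n (x # ys) = 0"
  by (simp add: orbit_sum_def gprod_dup)

lemma orbit_sum_perm: "v permutes {1..n} \<Longrightarrow> orbit_sum n (map (perm_gen v) xs) = orbit_sum n xs"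
proof -
  assume v: "v permutes {1..n}"
  have e: "perm_gen w (perm_gen v x) = perm_gen (w \<circ> v) x" for w x by (cases x) auto
  have "orbit_sum n (map (perm_gen v) xs) = (\<Sum>w | w permutes {1..n}. gprod (map (perm_gen (w \<circ> v)) xs))"
    unfolding orbit_sum_def by (simp only: e map_map comp_def[of "perm_gen _"])
  then show ?thesis
    unfolding orbit_sum_def by (simp only: sum_permutations_compose_right[OF v, of "\<lambda>w. gprod (map (perm_gen w) xs)"])
qed

lemma permutes_sum: "w permutes {1..n::nat} \<Longrightarrow> (\<Sum>i\<in>{1..n}. g (w i)) = (\<Sum>i\<in>{1..n}. (g i :: ext))"
  using sum.permute[of w "{1..n}" g] by (simp add: comp_def)

text \<open>Multiplication by a symmetric sum commutes with symmetrising: for each w the index i may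
  be replaced by \<open>w i\<close>, and then the operator turns the permuted word into the permuted
  longer word.\<close>

lemma sum_orbit_sum:
  assumes "\<And>i. ext_linear (G i)" "\<And>w i. gprod (map (perm_gen w) (c i)) = G (w i) (gprod (map (perm_gen w) ys))"
  shows "(\<Sum>i\<in>{1..n}. G i (orbit_sum n ys)) = (\<Sum>i\<in>{1..n}. orbit_sum n (c i))"
proof -
  have "(\<Sum>i\<in>{1..n}. G i (orbit_sum n ys)) = (\<Sum>w | w permutes {1..n}. \<Sum>i\<in>{1..n}. G i (gprod (map (perm_gen w) ys)))"
    unfolding orbit_sum_def ext_linear_sum[OF assms(1)] by (rule sum.swap)
  also have "\<dots> = (\<Sum>w | w permutes {1..n}. \<Sum>i\<in>{1..n}. G (w i) (gprod (map (perm_gen w) ys)))"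
  proof (rule sum.cong[OF refl])
    fix w assume "w \<in> {w. w permutes {1..n}}"
    then show "(\<Sum>i\<in>{1..n}. G i (gprod (map (perm_gen w) ys))) = (\<Sum>i\<in>{1..n}. G (w i) (gprod (map (perm_gen w) ys)))"
      using permutes_sum[of w n "\<lambda>i. G i (gprod (map (perm_gen w) ys))"] by simp
  qed
  also have "\<dots> = (\<Sum>i\<in>{1..n}. orbit_sum n (c i))"
    unfolding orbit_sum_def assms(2) by (rule sum.swap)
  finally show ?thesis .
qed

lemma mul_orbit_sum:
  "theta_mul n (orbit_sum n ys) = (\<Sum>i\<in>{1..n}. orbit_sum n (Theta i # ys))"
  "xi_mul n (orbit_sum n ys) = (\<Sum>i\<in>{1..n}. orbit_sum n (Xi i # ys))"
  "theta_xi_mul n (orbit_sum n ys) = (\<Sum>i\<in>{1..n}. orbit_sum n (Theta i # Xi i # ys))"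
  unfolding theta_mul_def xi_mul_def theta_xi_mul_def
  by (rule sum_orbit_sum, rule linear_ext_mult, simp add: gprod_Cons)
    (rule sum_orbit_sum, rule linear_ext_mult, simp add: gprod_Cons,
     rule sum_orbit_sum, rule ext_linear_comp, rule linear_ext_mult, rule linear_ext_mult, simp add: gprod_Cons)

lemma ext_space_orbit_sum: "set xs \<subseteq> gens n \<Longrightarrow> orbit_sum n xs \<in> ext_space n"
proof -
  assume xs: "set xs \<subseteq> gens n"
  have "set (map (perm_gen w) xs) \<subseteq> gens n" if w: "w permutes {1..n}" for w
  proof -
    have "perm_gen w x \<in> gens n" if "x \<in> gens n" for x
      using that permutes_in_image[OF w] by (cases x) auto
    then show ?thesis using xs by auto
  qed
  then show ?thesis
    unfolding orbit_sum_def by (intro ext.subspace_sum[OF ext_space_subspace] ext_space_gprod) auto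
qed

lemma orbit_sum_transpose:
  assumes "a \<in> {1..n}" "i \<in> {1..n}" "\<And>x. x \<in> {Theta a, Xi a, Theta i, Xi i} \<Longrightarrow> x \<notin> set ys"
  shows "orbit_sum n (map (perm_gen (transpose a i)) xs @ ys) = orbit_sum n (xs @ ys)"
proof -
  have "perm_gen (transpose a i) y = y" if "y \<in> set ys" for y
    using assms(3)[of y] that by (cases y) (auto simp: transpose_def)
  then have "map (perm_gen (transpose a i)) ys = ys" by (simp add: map_idI)
  moreover have "transpose a i permutes {1..n}"
    using assms by (intro permutes_swap_id) auto
  ultimately show ?thesis using orbit_sum_perm[of "transpose a i" n "xs @ ys"] by simp
qed

text \<open>Modulo \<open>V\<close> the sum is \<open>F a\<close> times the number of indices with
  \<open>F i = F a\<close>, a positive integer and hence invertible.\<close>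

lemma subspace_mean:
  assumes V: "ext.subspace V" and sum: "(\<Sum>i\<in>I. F i) \<in> V" and fin: "finite I" and a: "a \<in> I"
    and F: "\<And>i. i \<in> I \<Longrightarrow> F i = F a \<or> F i \<in> V"
  shows "F a \<in> V"
proof -
  let ?E = "{i \<in> I. F i = F a}"
  have "(\<Sum>i\<in>?E. F i) = (\<Sum>i\<in>I. F i) - (\<Sum>i\<in>I - ?E. F i)"
    using sum.subset_diff[of ?E I F] fin by (simp add: algebra_simps)
  moreover have "(\<Sum>i\<in>I - ?E. F i) \<in> V"
    using F by (intro ext.subspace_sum[OF V]) auto
  ultimately have "(\<Sum>i\<in>?E. F i) \<in> V"
    using ext.subspace_diff[OF V sum] by simp
  moreover have "(\<Sum>i\<in>?E. F i) = ext_scale (of_nat (card ?E)) (F a)"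
    by (auto simp: fun_eq_iff sum_fun_apply ext_scale_def)
  moreover have "card ?E \<noteq> 0" using fin a by auto
  ultimately show ?thesis
    using ext.subspace_scale[OF V, of "ext_scale (of_nat (card ?E)) (F a)" "inverse (of_nat (card ?E))"]
    by auto
qed

text \<open>One letter (or one pair, if all letters come in pairs) is removed and reinserted at
  every index; the total lies in the ideal. Reinsertion at an index whose letter is present repeats
  it and gives 0; at an untouched index a transposition shows that it gives the original orbit sum.
  What is left is a \<open>\<theta>\<close> inserted next to a lone \<open>\<xi>\<close>, and this
  lowers the number of lone \<open>\<theta>\<close>, the induction measure.\<close>

lemma orbit_sum_in_sum_ideal:
  assumes "set xs \<subseteq> gens n" "distinct xs" "xs \<noteq> []"
  shows "orbit_sum n xs \<in> sum_ideal n"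
  using assms
proof (induction "card {i. Theta i \<in> set xs \<and> Xi i \<notin> set xs}" arbitrary: xs rule: less_induct)
  case less
  note sc = ext.subspace_scale[OF sum_ideal_subspace]
  let ?A = "{i. Theta i \<in> set xs \<and> Xi i \<notin> set xs}"
  have finA: "finite ?A"
    by (rule finite_subset[of _ "{1..n}"]) (use less.prems in auto)
  consider a where "a \<in> ?A" | b where "?A = {}" "Xi b \<in> set xs" "Theta b \<notin> set xs"
    | c where "Theta c \<in> set xs" "Xi c \<in> set xs" "\<forall>i. Theta i \<in> set xs \<longleftrightarrow> Xi i \<in> set xs"
  proof -
    obtain x where "x \<in> set xs" using less.prems(3) by (cases xs) auto
    moreover have "(\<exists>i. x = Theta i) \<or> (\<exists>i. x = Xi i)" using gen.exhaust by metis
    ultimately have x: "(\<exists>i. x = Theta i) \<or> (\<exists>i. x = Xi i)" "x \<in> set xs" by auto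
    show ?thesis
    proof (cases "?A = {} \<and> (\<forall>b. Xi b \<in> set xs \<longrightarrow> Theta b \<in> set xs)")
      case True
      then have "\<forall>i. Theta i \<in> set xs \<longleftrightarrow> Xi i \<in> set xs" by blast
      with x that(3) show ?thesis by metis
    next
      case False
      with that(1,2) show ?thesis by blast
    qed
  qed
  then show ?case
  proof cases
    case (1 a)
    then obtain us vs where xs: "xs = us @ Theta a # vs" by (auto dest: split_list)
    let ?ys = "us @ vs"
    have a: "a \<in> {1..n}" and ys: "set ?ys \<subseteq> gens n" "Theta a \<notin> set ?ys" "Xi a \<notin> set ?ys" "distinct ?ys"
      using less.prems 1 unfolding xs by auto
    have "orbit_sum n (Theta a # ?ys) \<in> sum_ideal n"
    proof (rule subspace_mean[OF sum_ideal_subspace, where F = "\<lambda>i. orbit_sum n (Theta i # ?ys)" and I = "{1..n}"])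
      show "(\<Sum>i = 1..n. orbit_sum n (Theta i # ?ys)) \<in> sum_ideal n"
        unfolding mul_orbit_sum[symmetric] by (intro sum_ideal_I ext_space_orbit_sum ys)
      fix i assume i: "i \<in> {1..n}"
      consider "Theta i \<in> set ?ys" | "Theta i \<notin> set ?ys" "Xi i \<notin> set ?ys"
        | "Theta i \<notin> set ?ys" "Xi i \<in> set ?ys" by blast
      then show "orbit_sum n (Theta i # ?ys) = orbit_sum n (Theta a # ?ys) \<or> orbit_sum n (Theta i # ?ys) \<in> sum_ideal n"
      proof cases
        case 1
        then show ?thesis by (simp only: orbit_sum_dup ext.subspace_0[OF sum_ideal_subspace] simp_thms)
      next
        case 2
        then show ?thesis
          using orbit_sum_transpose[OF a i, of ?ys "[Theta a]"] ys by auto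
      next
        case 3
        have "{j. Theta j \<in> set (Theta i # ?ys) \<and> Xi j \<notin> set (Theta i # ?ys)} = ?A - {a}"
          using 3 ys unfolding xs by auto
        then have "card {j. Theta j \<in> set (Theta i # ?ys) \<and> Xi j \<notin> set (Theta i # ?ys)} < card ?A"
          using finA \<open>a \<in> ?A\<close> by (simp only: card_Diff1_less)
        then have "orbit_sum n (Theta i # ?ys) \<in> sum_ideal n"
          using 3 ys i by (intro less.hyps) auto
        then show ?thesis ..
      qed
    qed (use a in auto)
    then show ?thesis unfolding xs orbit_sum_move_front[of n us] by (rule sc)
  next
    case (2 b)
    then obtain us vs where xs: "xs = us @ Xi b # vs" by (auto dest: split_list)
    let ?ys = "us @ vs"
    have b: "b \<in> {1..n}" and ys: "set ?ys \<subseteq> gens n" "Theta b \<notin> set ?ys" "Xi b \<notin> set ?ys" "distinct ?ys"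
      using less.prems 2 unfolding xs by auto
    \<comment> \<open>Lone \<open>\<theta>\<close> were treated before lone \<open>\<xi>\<close> for
      this reason: with none left, an index without \<open>\<xi>\<close> is entirely untouched, and
      only harmless reinsertions remain.\<close>
    have imp: "Xi i \<in> set ?ys" if "Theta i \<in> set ?ys" for i
    proof -
      have "i \<notin> ?A" using 2(1) by blast
      moreover have "i \<noteq> b" using that ys by auto
      ultimately show ?thesis using that unfolding xs by auto
    qed
    have "orbit_sum n (Xi b # ?ys) \<in> sum_ideal n"
    proof (rule subspace_mean[OF sum_ideal_subspace, where F = "\<lambda>i. orbit_sum n (Xi i # ?ys)" and I = "{1..n}"])
      show "(\<Sum>i = 1..n. orbit_sum n (Xi i # ?ys)) \<in> sum_ideal n"
        unfolding mul_orbit_sum[symmetric] by (intro sum_ideal_I ext_space_orbit_sum ys)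
      fix i assume i: "i \<in> {1..n}"
      consider "Xi i \<in> set ?ys" | "Theta i \<notin> set ?ys" "Xi i \<notin> set ?ys" using imp by blast
      then show "orbit_sum n (Xi i # ?ys) = orbit_sum n (Xi b # ?ys) \<or> orbit_sum n (Xi i # ?ys) \<in> sum_ideal n"
      proof cases
        case 1
        then show ?thesis by (simp only: orbit_sum_dup ext.subspace_0[OF sum_ideal_subspace] simp_thms)
      next
        case 2
        then show ?thesis
          using orbit_sum_transpose[OF b i, of ?ys "[Xi b]"] ys by auto
      qed
    qed (use b in auto)
    then show ?thesis unfolding xs orbit_sum_move_front[of n us] by (rule sc)
  next
    case (3 c)
    from 3(1) obtain us vs where xs: "xs = us @ Theta c # vs" by (auto dest: split_list)
    from 3(2) xs have "Xi c \<in> set (us @ vs)" by auto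
    then obtain us' vs' where xs': "us @ vs = us' @ Xi c # vs'" using split_list by metis
    let ?ys = "us' @ vs'"
    have st: "set xs = insert (Theta c) (set (us @ vs))" "distinct (Theta c # us @ vs)"
      using less.prems xs by auto
    have c: "c \<in> {1..n}" and ys: "set ?ys \<subseteq> gens n" "Theta c \<notin> set ?ys" "Xi c \<notin> set ?ys"
      using less.prems st unfolding xs' by auto
    have iff: "Theta i \<in> set ?ys \<longleftrightarrow> Xi i \<in> set ?ys" for i
      using 3(3)[rule_format, of i] st ys unfolding xs' by (cases "i = c") auto
    have "orbit_sum n (Theta c # Xi c # ?ys) \<in> sum_ideal n"
    proof (rule subspace_mean[OF sum_ideal_subspace, where F = "\<lambda>i. orbit_sum n (Theta i # Xi i # ?ys)" and I = "{1..n}"])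
      show "(\<Sum>i = 1..n. orbit_sum n (Theta i # Xi i # ?ys)) \<in> sum_ideal n"
        unfolding mul_orbit_sum[symmetric] by (intro sum_ideal_I ext_space_orbit_sum ys)
      fix i assume i: "i \<in> {1..n}"
      show "orbit_sum n (Theta i # Xi i # ?ys) = orbit_sum n (Theta c # Xi c # ?ys) \<or> orbit_sum n (Theta i # Xi i # ?ys) \<in> sum_ideal n"
      proof (cases "Theta i \<in> set ?ys")
        case True
        then have "Theta i \<in> set (Xi i # ?ys)" by simp
        then show ?thesis by (simp only: orbit_sum_dup ext.subspace_0[OF sum_ideal_subspace] simp_thms)
      next
        case False
        then show ?thesis
          using orbit_sum_transpose[OF c i, of ?ys "[Theta c, Xi c]"] ys iff by auto
      qed
    qed (use c in auto)
    moreover have "orbit_sum n xs = ext_scale ((-1) ^ length us * (-1) ^ length us') (orbit_sum n (Theta c # Xi c # ?ys))"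
    proof -
      have "orbit_sum n xs = ext_scale ((-1) ^ length us) (orbit_sum n ((Theta c # us') @ Xi c # vs'))"
        unfolding xs orbit_sum_move_front[of n us] xs' by simp
      also have "\<dots> = ext_scale ((-1) ^ length us) (ext_scale ((-1) ^ Suc (length us')) (orbit_sum n ([Xi c] @ Theta c # ?ys)))"
        unfolding orbit_sum_move_front[of n "Theta c # us'"] by simp
      also have "\<dots> = ext_scale ((-1) ^ length us * (-1) ^ length us') (orbit_sum n (Theta c # Xi c # ?ys))"
        unfolding orbit_sum_move_front[of n "[Xi c]"] by simp
      finally show ?thesis .
    qed
    ultimately show ?thesis by (simp only: sc)
  qed
qed

lemma perm_act_eq:
  assumes "f \<in> ext_space n"
  shows "perm_act w f = (\<Sum>S\<in>Pow (gens n). ext_scale (f S) (gprod (map (perm_gen w) (sorted_list_of_set S))))"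
proof
  fix T
  show "perm_act w f T = (\<Sum>S\<in>Pow (gens n). ext_scale (f S) (gprod (map (perm_gen w) (sorted_list_of_set S)))) T"
    unfolding perm_act_def sum_fun_apply ext_scale_def
    by (rule sum.mono_neutral_left) (use assms in \<open>auto simp: finite_gens ext_space_iff\<close>)
qed

text \<open>Averaging: the sum of \<open>perm_act w f\<close> over the group is a positive multiple
  of f and also the combination of the orbit sums of its monomials. The vanishing constant term
  removes the empty word, to which \<open>orbit_sum_in_sum_ideal\<close> does not apply.\<close>

lemma invariant_in_sum_ideal:
  assumes "f \<in> invariants n" "f {} = 0"
  shows "f \<in> sum_ideal n"
proof -
  let ?P = "{w. w permutes {1..n}}"
  have f: "f \<in> ext_space n" "\<And>w. w permutes {1..n} \<Longrightarrow> perm_act w f = f"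
    using assms by (auto simp: invariants_def)
  have "ext_scale (of_nat (card ?P)) f = (\<Sum>w\<in>?P. perm_act w f)"
    using f(2) by (auto simp: fun_eq_iff ext_scale_def sum_fun_apply)
  also have "\<dots> = (\<Sum>S\<in>Pow (gens n). ext_scale (f S) (orbit_sum n (sorted_list_of_set S)))"
    unfolding orbit_sum_def perm_act_eq[OF f(1)] ext.scale_sum_right by (rule sum.swap)
  also have "\<dots> \<in> sum_ideal n"
  proof (rule ext.subspace_sum[OF sum_ideal_subspace])
    fix S assume S: "S \<in> Pow (gens n)"
    have fin: "finite S" using S finite_subset[OF _ finite_gens] by auto
    show "ext_scale (f S) (orbit_sum n (sorted_list_of_set S)) \<in> sum_ideal n"
    proof (cases "S = {}")
      case True
      then show ?thesis using assms(2) ext.subspace_0[OF sum_ideal_subspace] by simp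
    next
      case False
      then show ?thesis using S fin
        by (intro ext.subspace_scale[OF sum_ideal_subspace] orbit_sum_in_sum_ideal) auto
    qed
  qed
  finally have "ext_scale (of_nat (card ?P)) f \<in> sum_ideal n" .
  moreover have "card ?P \<noteq> 0" using card_permutations[of "{1..n}" n] by auto
  ultimately show ?thesis
    using ext.subspace_scale[OF sum_ideal_subspace, of "ext_scale (of_nat (card ?P)) f" n "inverse (of_nat (card ?P))"]
    by auto
qed

lemma FDR_ideal_subset_sum_ideal: "FDR_ideal n \<subseteq> sum_ideal n"
  unfolding FDR_ideal_def
  by (rule ring.genideal_minimal[OF ring_ext_alg ideal_sum_ideal]) (auto intro: invariant_in_sum_ideal)

lemma perm_act_lin_sum:
  assumes "finite I" "\<And>i. i \<in> I \<Longrightarrow> F i \<in> ext_space n"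
  shows "perm_act w (\<Sum>i\<in>I. F i) = (\<Sum>i\<in>I. perm_act w (F i))"
proof -
  have "(\<Sum>i\<in>I. F i) \<in> ext_space n" using assms by (intro ext.subspace_sum[OF ext_space_subspace])
  then have "perm_act w (\<Sum>i\<in>I. F i) = (\<Sum>S\<in>Pow (gens n). \<Sum>i\<in>I. ext_scale (F i S) (gprod (map (perm_gen w) (sorted_list_of_set S))))"
    by (simp add: perm_act_eq sum_fun_apply ext.scale_sum_left)
  also have "\<dots> = (\<Sum>i\<in>I. perm_act w (F i))"
    by (subst sum.swap, intro sum.cong refl) (metis perm_act_eq assms(2))
  finally show ?thesis .
qed

lemma perm_act_monom:
  "perm_act w (ext_monom S) = gprod (map (perm_gen w) (sorted_list_of_set S))"
proof -
  have "{T. ext_monom S T \<noteq> 0} = {S}" by (auto simp: ext_monom_def)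
  then show ?thesis by (simp add: perm_act_def fun_eq_iff) (simp add: ext_monom_def)
qed

lemma gprod_monom: "finite S \<Longrightarrow> sorted_list_of_set S = xs \<Longrightarrow> gprod xs = ext_monom S"
  using gprod_sorted_list_of_set by auto

lemma sorted_pair: "sorted_list_of_set {Theta i, Xi j} = [Theta i, Xi j]"
  by (rule sorted_list_of_set_unique[THEN iffD1]) (auto simp: less_gen_def less_eq_gen_def)

lemma orbit_of_monoms_in_ideal:
  assumes S: "\<And>i. i \<in> {1..n} \<Longrightarrow> S i \<subseteq> gens n \<and> S i \<noteq> {}"
    and w: "\<And>i w. i \<in> {1..n} \<Longrightarrow> perm_act w (ext_monom (S i)) = ext_monom (S (w i))"
  shows "(\<Sum>i\<in>{1..n}. ext_monom (S i)) \<in> FDR_ideal n"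
proof -
  let ?f = "\<Sum>i\<in>{1..n}. ext_monom (S i)"
  have ext_space: "?f \<in> ext_space n" using S by (intro ext.subspace_sum[OF ext_space_subspace] ext_space_monom) auto
  have "perm_act w ?f = ?f" if "w permutes {1..n}" for w
  proof -
    have "perm_act w ?f = (\<Sum>i\<in>{1..n}. perm_act w (ext_monom (S i)))"
      using S by (intro perm_act_lin_sum[of _ _ n] ext_space_monom) auto
    also have "\<dots> = (\<Sum>i\<in>{1..n}. ext_monom (S (w i)))"
      using w by (intro sum.cong refl)
    also have "\<dots> = ?f" by (rule permutes_sum[OF that])
    finally show ?thesis .
  qed
  then have "?f \<in> invariants n" using ext_space by (simp add: invariants_def)
  moreover have "?f {} = 0"
    unfolding sum_fun_apply by (rule sum.neutral) (use S in \<open>force simp: ext_monom_def\<close>)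
  ultimately show ?thesis
    unfolding FDR_ideal_def
    using ring.genideal_self[OF ring_ext_alg, of "{f \<in> invariants n. f {} = 0}" n] invariants_def by auto
qed

lemma sum_ideal_subset_FDR_ideal: "sum_ideal n \<subseteq> FDR_ideal n"
proof
  fix x assume "x \<in> sum_ideal n"
  then obtain a b c where
    *: "a \<in> ext_space n" "b \<in> ext_space n" "c \<in> ext_space n" "x = theta_mul n a + xi_mul n b + theta_xi_mul n c"
    by (rule sum_ideal_E)
  interpret ideal "FDR_ideal n" "ext_alg n" by (rule ideal_FDR_ideal)
  have one: "mul \<omega> (ext_monom {}) = ext_monom {\<omega>}" for \<omega>
    using gprod_sorted_list_of_set[of "{\<omega>}"] by (simp add: gprod_def)
  have th: "(\<Sum>i\<in>{1..n}. ext_monom {Theta i}) \<in> FDR_ideal n"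
    by (rule orbit_of_monoms_in_ideal) (auto simp: perm_act_monom intro!: gprod_monom)
  have xi: "(\<Sum>i\<in>{1..n}. ext_monom {Xi i}) \<in> FDR_ideal n"
    by (rule orbit_of_monoms_in_ideal) (auto simp: perm_act_monom intro!: gprod_monom)
  have q: "(\<Sum>i\<in>{1..n}. ext_monom {Theta i, Xi i}) \<in> FDR_ideal n"
    by (rule orbit_of_monoms_in_ideal) (auto simp: perm_act_monom sorted_pair intro!: gprod_monom)
  have pair: "ext_monom {Theta i, Xi i} = ext_mult (ext_monom {Theta i}) (ext_monom {Xi i})" for i
    using gprod_sorted_list_of_set[of "{Theta i, Xi i}"] one[of "Xi i"]
    by (simp add: sorted_pair gprod_def)
  have "theta_mul n a = ext_mult (\<Sum>i\<in>{1..n}. ext_monom {Theta i}) a"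
    "xi_mul n b = ext_mult (\<Sum>i\<in>{1..n}. ext_monom {Xi i}) b"
    "theta_xi_mul n c = ext_mult (\<Sum>i\<in>{1..n}. ext_monom {Theta i, Xi i}) c"
    by (simp_all add: theta_mul_def xi_mul_def theta_xi_mul_def ext_linear_sum[OF linear_ext_mult(2)] pair ext_mult_assoc)
  then have "theta_mul n a \<in> FDR_ideal n" "xi_mul n b \<in> FDR_ideal n" "theta_xi_mul n c \<in> FDR_ideal n"
    using I_r_closed[OF th *(1)] I_r_closed[OF xi *(2)] I_r_closed[OF q *(3)]
    by (simp_all add: ext_alg_ops)
  then have "(theta_mul n a \<oplus>\<^bsub>ext_alg n\<^esub> xi_mul n b) \<oplus>\<^bsub>ext_alg n\<^esub> theta_xi_mul n c \<in> FDR_ideal n"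
    using a_closed by blast
  then show "x \<in> FDR_ideal n" by (simp add: * ext_alg_ops)
qed

lemma FDR_ideal_eq_sum_ideal: "FDR_ideal n = sum_ideal n"
  using FDR_ideal_subset_sum_ideal sum_ideal_subset_FDR_ideal by blast

section \<open>Coefficients of products of block operators\<close>

text \<open>The set of admissible index pairs is a parameter, so that \<open>F\<^sub>\<pi>\<close>
  (with \<open>offdiag\<close>) and \<open>G\<^sub>\<pi>\<close> (with \<open>square\<close>) share
  one fold, one commutation proof and one computation of coefficients.\<close>

definition pair_sum_op :: "(nat set \<Rightarrow> (nat \<times> nat) set) \<Rightarrow> nat set \<Rightarrow> ext \<Rightarrow> ext" where
  "pair_sum_op R B f = (\<Sum>(i, j)\<in>R B. hook i j f)"

definition block_prod :: "(nat set \<Rightarrow> (nat \<times> nat) set) \<Rightarrow> nat \<Rightarrow> nat set set \<Rightarrow> ext" where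
  "block_prod R n \<pi> = Finite_Set.fold (pair_sum_op R) (ext_monom (Theta ` {1..n})) \<pi>"

definition offdiag :: "nat set \<Rightarrow> (nat \<times> nat) set" where
  "offdiag B = {(i, j). i \<in> B \<and> j \<in> B \<and> (card B = 1 \<or> i \<noteq> j)}"

definition square :: "nat set \<Rightarrow> (nat \<times> nat) set" where
  "square B = B \<times> B"

lemma block_op_eq_pair_sum_op: "block_op = pair_sum_op offdiag"
proof (intro ext)
  fix B f T
  show "block_op B f T = pair_sum_op offdiag B f T"
  proof (cases "card B = 1")
    case True
    then obtain x where "B = {x}" by (auto simp: card_1_singleton_iff)
    moreover have "offdiag {x} = {(x, x)}" by (auto simp: offdiag_def)
    ultimately show ?thesis by (simp add: block_op_def pair_sum_op_def hook_def)
  next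
    case False
    then have "offdiag B = {(i, j). i \<in> B \<and> j \<in> B \<and> i \<noteq> j}" by (auto simp: offdiag_def)
    with False show ?thesis
      by (simp add: block_op_def pair_sum_op_def hook_def sum_fun_apply split_def)
  qed
qed

lemma linear_hook: "ext_linear (hook i j)"
  unfolding hook_def[abs_def] by (rule ext_linear_comp, rule linear_ext_mult, rule linear_contract)

lemma comp_fun_commute_pair_sum_op: "comp_fun_commute (pair_sum_op R)"
proof
  fix A B
  have "pair_sum_op R A (pair_sum_op R B f) = pair_sum_op R B (pair_sum_op R A f)" for f
  proof -
    have "pair_sum_op R A (pair_sum_op R B f) = (\<Sum>p\<in>R A. \<Sum>q\<in>R B. hook (fst p) (snd p) (hook (fst q) (snd q) f))"
      by (simp add: pair_sum_op_def split_def ext_linear_sum[OF linear_hook])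
    also have "\<dots> = (\<Sum>q\<in>R B. \<Sum>p\<in>R A. hook (fst q) (snd q) (hook (fst p) (snd p) f))"
      by (subst sum.swap) (simp add: hook_commute)
    also have "\<dots> = pair_sum_op R B (pair_sum_op R A f)"
      by (simp add: pair_sum_op_def split_def ext_linear_sum[OF linear_hook])
    finally show ?thesis .
  qed
  then show "pair_sum_op R B \<circ> pair_sum_op R A = pair_sum_op R A \<circ> pair_sum_op R B" by (simp add: fun_eq_iff)
qed

lemma block_prod_insert:
  "finite \<pi> \<Longrightarrow> B \<notin> \<pi> \<Longrightarrow> block_prod R n (insert B \<pi>) = pair_sum_op R B (block_prod R n \<pi>)"
proof -
  interpret comp_fun_commute "pair_sum_op R" by (rule comp_fun_commute_pair_sum_op)
  assume "finite \<pi>" "B \<notin> \<pi>"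
  then show ?thesis unfolding block_prod_def by simp
qed

lemma block_prod_remove:
  "finite \<pi> \<Longrightarrow> B \<in> \<pi> \<Longrightarrow> block_prod R n \<pi> = pair_sum_op R B (block_prod R n (\<pi> - {B}))"
  using block_prod_insert[of "\<pi> - {B}" B R n] by (simp add: insert_absorb)

lemma gprod_Thetas: "gprod (map Theta [1..<Suc n]) = ext_monom (Theta ` {1..n})"
proof (rule gprod_monom)
  have "sorted_wrt (<) (map Theta [1..<Suc n])"
    unfolding sorted_wrt_map by (rule sorted_wrt_mono_rel[OF _ sorted_wrt_upt])
      (auto simp: less_gen_def less_eq_gen_def)
  moreover have "set (map Theta [1..<Suc n]) = Theta ` {1..n}" by auto
  moreover have "length (map Theta [1..<Suc n]) = card (Theta ` {1..n})"
    by (subst card_image) (auto simp: inj_on_def)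
  ultimately show "sorted_list_of_set (Theta ` {1..n}) = map Theta [1..<Suc n]"
    using sorted_list_of_set_unique[of "Theta ` {1..n}" "map Theta [1..<Suc n]"] by blast
qed auto

lemma F_part_eq: "F_part n \<pi> = block_prod offdiag n \<pi>"
  unfolding F_part_def block_prod_def block_op_eq_pair_sum_op gprod_Thetas ..

text \<open>A hook adds one \<open>\<xi>\<close> and deletes one \<open>\<theta>\<close>, starting
  from the product of all \<open>\<theta>\<close>. A monomial is therefore recorded by the indices
  of its added \<open>\<xi>\<close> and of its deleted \<open>\<theta>\<close>; in a product over
  blocks both sets meet each block once, which is the condition \<open>nice\<close> below.\<close>

definition Xs :: "gen set \<Rightarrow> nat set" where "Xs U = {i. Xi i \<in> U}"
definition Ys :: "nat \<Rightarrow> gen set \<Rightarrow> nat set" where "Ys n U = {j \<in> {1..n}. Theta j \<notin> U}"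

definition transversal :: "nat set set \<Rightarrow> nat set \<Rightarrow> bool" where
  "transversal \<pi> Z \<longleftrightarrow> Z \<subseteq> \<Union>\<pi> \<and> (\<forall>B\<in>\<pi>. \<exists>x. Z \<inter> B = {x})"

definition nice :: "nat \<Rightarrow> nat set set \<Rightarrow> gen set \<Rightarrow> bool" where
  "nice n \<pi> U \<longleftrightarrow> U \<subseteq> gens n \<and> transversal \<pi> (Xs U) \<and> transversal \<pi> (Ys n U)"

lemma below_cases: "below \<omega> T = 1 \<or> below \<omega> T = -1"
  unfolding below_def by (metis neg_one_even_power neg_one_odd_power)

lemma hook_apply:
  assumes "finite U" "Xi i \<in> U" "Theta j \<notin> U"
  obtains s where "s = 1 \<or> s = - 1" "\<And>f. hook i j f U = s * f (insert (Theta j) (U - {Xi i}))"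
proof (rule that[of "below (Xi i) U * below (Theta j) (U - {Xi i})"])
  show "below (Xi i) U * below (Theta j) (U - {Xi i}) = 1 \<or> below (Xi i) U * below (Theta j) (U - {Xi i}) = - 1"
    using below_cases[of "Xi i" U] below_cases[of "Theta j" "U - {Xi i}"] by auto
qed (use assms in \<open>simp add: hook_def ext_mult_gen contract_alt\<close>)

lemma hook_nonzero:
  assumes "hook i j f U \<noteq> 0"
  shows "finite U" "Xi i \<in> U" "Theta j \<notin> U" "f (insert (Theta j) (U - {Xi i})) \<noteq> 0"
  using assms by (auto simp: hook_def ext_mult_gen contract_alt split: if_splits)

lemma transversal_insert:
  assumes disj: "\<And>B'. B' \<in> \<pi> \<Longrightarrow> B \<inter> B' = {}" and "x \<in> B" "x \<in> Z" "transversal \<pi> (Z - {x})"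
  shows "transversal (insert B \<pi>) Z"
proof -
  have "Z - {x} \<subseteq> \<Union>\<pi>" using assms by (simp add: transversal_def)
  then have "Z \<inter> B = {x}" "Z \<subseteq> \<Union>(insert B \<pi>)" using assms(1-3) by blast+
  moreover have "Z \<inter> B' = (Z - {x}) \<inter> B'" if "B' \<in> \<pi>" for B' using disj[OF that] assms(2) by auto
  ultimately show ?thesis using assms(4) by (simp add: transversal_def)
qed

lemma transversal_remove:
  assumes disj: "\<And>B'. B' \<in> \<pi> \<Longrightarrow> B \<inter> B' = {}" and "Z \<inter> B = {x}" "transversal (insert B \<pi>) Z"
  shows "transversal \<pi> (Z - {x})"
proof -
  have "Z \<inter> B' = (Z - {x}) \<inter> B'" if "B' \<in> \<pi>" for B' using disj[OF that] assms(2) by auto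
  moreover have "Z - {x} \<subseteq> \<Union>\<pi>" using assms by (auto simp: transversal_def)
  ultimately show ?thesis using assms(3) by (simp add: transversal_def)
qed

text \<open>No cancellation can occur: the pair contributed by a block is visible in the monomial as
  the unique elements of \<open>Xs U\<close> and \<open>Ys n U\<close> in that block. Each
  coefficient is thus a single signed term, and passing from \<open>square\<close> to a smaller
  \<open>R\<close> keeps or deletes this term without changing its sign.\<close>

lemma block_prod_coeff:
  assumes "finite \<pi>" "\<Union>\<pi> \<subseteq> {1..n}" "disjoint \<pi>"
  shows "(block_prod square n \<pi> U \<noteq> 0 \<longleftrightarrow> nice n \<pi> U) \<and> block_prod square n \<pi> U \<in> {-1, 0, 1} \<and>
    (\<forall>R. (\<forall>B\<in>\<pi>. R B \<subseteq> square B) \<longrightarrow> block_prod R n \<pi> U =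
       (if \<forall>B\<in>\<pi>. \<forall>x\<in>Xs U \<inter> B. \<forall>y\<in>Ys n U \<inter> B. (x, y) \<in> R B then block_prod square n \<pi> U else 0))"
  using assms
proof (induction \<pi> arbitrary: U rule: finite_induct)
  case empty
  have "nice n {} U \<longleftrightarrow> U = Theta ` {1..n}"
  proof
    assume "nice n {} U"
    then have U: "U \<subseteq> gens n" "\<And>i. Xi i \<notin> U" "\<And>j. j \<in> {1..n} \<Longrightarrow> Theta j \<in> U"
      by (auto simp: nice_def transversal_def Xs_def Ys_def)
    then show "U = Theta ` {1..n}" by (auto simp: gens_def)
  qed (auto simp: nice_def transversal_def Xs_def Ys_def gens_def)
  then show ?case by (auto simp: block_prod_def ext_monom_def)
next
  case (insert B \<pi>)
  have disj: "B \<inter> B' = {}" if "B' \<in> \<pi>" for B'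
    using insert.prems insert.hyps that by (auto simp: disjoint_def)
  have B: "B \<subseteq> {1..n}" "finite B" using insert.prems finite_subset[of B "{1..n}"] by auto
  have "disjoint \<pi>" "\<Union>\<pi> \<subseteq> {1..n}"
    using insert.prems by (auto simp: disjoint_def)
  note IH = insert.IH[OF this(2,1)]
  let ?V = "\<lambda>i j. insert (Theta j) (U - {Xi i})"
  have XV: "Xs (?V i j) = Xs U - {i}" for i j by (auto simp: Xs_def)
  have YV: "Ys n (?V i j) = Ys n U - {j}" for i j by (auto simp: Ys_def)
  show ?case
  proof (cases "nice n (insert B \<pi>) U")
    case True
    then obtain x y where x: "Xs U \<inter> B = {x}" and y: "Ys n U \<inter> B = {y}"
      by (auto simp: nice_def transversal_def)
    have U: "finite U" using True finite_subset[OF _ finite_gens] by (auto simp: nice_def)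
    have xy: "Xi x \<in> U" "Theta y \<notin> U" "x \<in> B" "y \<in> B" using x y by (auto simp: Xs_def Ys_def)
    obtain s where s: "s = 1 \<or> s = - 1" "\<And>f. hook x y f U = s * f (?V x y)"
      using hook_apply[OF U xy(1,2)] by blast
    have "nice n \<pi> (?V x y)"
      unfolding nice_def XV YV
      using True xy B transversal_remove[OF disj x] transversal_remove[OF disj y]
      by (auto simp: nice_def)
    note V = IH[of "?V x y"] this
    \<comment> \<open>All other hooks of the block vanish at U, whatever f is: a nonzero one needs
      its \<open>\<xi>\<close> present and its \<open>\<theta>\<close> absent, and x and y are the
      only such indices in B.\<close>
    have eq: "pair_sum_op R B f U = (if (x, y) \<in> R B then s * f (?V x y) else 0)" if "R B \<subseteq> square B" for R f
    proof -
      have fin: "finite (R B)" using that B(2) finite_subset by (auto simp: square_def)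
      have "hook i j f U = 0" if "(i, j) \<in> R B - {(x, y)}" for i j
      proof (rule ccontr)
        assume "hook i j f U \<noteq> 0"
        from hook_nonzero[OF this] have "i \<in> Xs U \<inter> B" "j \<in> Ys n U \<inter> B"
          using that \<open>R B \<subseteq> square B\<close> B(1) by (auto simp: Xs_def Ys_def square_def)
        then show False using x y that by auto
      qed
      then have "(\<Sum>p\<in>R B. hook (fst p) (snd p) f U) = (\<Sum>p\<in>R B \<inter> {(x, y)}. hook (fst p) (snd p) f U)"
        using fin by (intro sum.mono_neutral_right) force+
      then show ?thesis by (auto simp: pair_sum_op_def sum_fun_apply split_def s(2) Int_insert_right)
    qed
    have sqB: "(x, y) \<in> square B" using xy by (simp add: square_def)
    have G: "block_prod square n (insert B \<pi>) U = s * block_prod square n \<pi> (?V x y)"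
      using insert.hyps eq[of square] sqB by (simp add: block_prod_insert)
    have F: "block_prod R n (insert B \<pi>) U =
       (if \<forall>B\<in>insert B \<pi>. \<forall>x\<in>Xs U \<inter> B. \<forall>y\<in>Ys n U \<inter> B. (x, y) \<in> R B then block_prod square n (insert B \<pi>) U else 0)"
      if R: "\<forall>B\<in>insert B \<pi>. R B \<subseteq> square B" for R
    proof -
      define C where "C \<longleftrightarrow> (\<forall>B\<in>\<pi>. \<forall>x\<in>Xs U \<inter> B. \<forall>y\<in>Ys n U \<inter> B. (x, y) \<in> R B)"
      have "Xs (?V x y) \<inter> B' = Xs U \<inter> B'" "Ys n (?V x y) \<inter> B' = Ys n U \<inter> B'" if "B' \<in> \<pi>" for B'
        using disj[OF that] xy unfolding XV YV by auto
      then have 1: "block_prod R n \<pi> (?V x y) = (if C then block_prod square n \<pi> (?V x y) else 0)"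
        unfolding C_def using V(1) R by (simp cong: ball_cong_simp)
      have 2: "(\<forall>B\<in>insert B \<pi>. \<forall>x\<in>Xs U \<inter> B. \<forall>y\<in>Ys n U \<inter> B. (x, y) \<in> R B) \<longleftrightarrow> (x, y) \<in> R B \<and> C"
        unfolding C_def ball_simps x y by blast
      have "R B \<subseteq> square B" using R by blast
      then have 3: "block_prod R n (insert B \<pi>) U = (if (x, y) \<in> R B then s * block_prod R n \<pi> (?V x y) else 0)"
        unfolding block_prod_insert[OF insert.hyps(1,2)] by (rule eq)
      show ?thesis
        unfolding 2 3 G 1 by (cases "(x, y) \<in> R B"; cases C) simp_all
    qed
    have "block_prod square n \<pi> (?V x y) \<noteq> 0" "block_prod square n \<pi> (?V x y) \<in> {-1, 0, 1}"
      using V by blast+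
    then have "block_prod square n (insert B \<pi>) U \<noteq> 0" "block_prod square n (insert B \<pi>) U \<in> {-1, 0, 1}"
      unfolding G using s(1) by auto
    then show ?thesis using True F by blast
  next
    case False
    \<comment> \<open>A surviving hook would lead from U to a nice monomial of the remaining blocks,
      and restoring its two indices would make U nice.\<close>
    have "hook i j f U = 0" if "(i, j) \<in> square B" "\<And>V. f V \<noteq> 0 \<Longrightarrow> nice n \<pi> V" for i j f
    proof (rule ccontr)
      assume "hook i j f U \<noteq> 0"
      note * = hook_nonzero[OF this]
      have ij: "i \<in> B" "j \<in> B" "i \<in> Xs U" "j \<in> Ys n U" "j \<in> {1..n}" "i \<in> {1..n}"
        using * that(1) B(1) by (auto simp: square_def Xs_def Ys_def)
      have n: "nice n \<pi> (?V i j)" using that(2) * by blast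
      then have "U \<subseteq> gens n" using ij by (auto simp: nice_def)
      moreover have "transversal (insert B \<pi>) (Xs U)" "transversal (insert B \<pi>) (Ys n U)"
        using n transversal_insert[OF disj ij(1,3)] transversal_insert[OF disj ij(2,4)]
        by (auto simp: nice_def XV YV)
      ultimately show False using False by (simp add: nice_def)
    qed
    then have "block_prod R n (insert B \<pi>) U = 0" if R: "\<forall>B\<in>insert B \<pi>. R B \<subseteq> square B" for R
    proof -
      have "nice n \<pi> V" if "block_prod R n \<pi> V \<noteq> 0" for V
        using IH[of V] R that by (auto split: if_splits)
      then show ?thesis
        using R insert.hyps \<open>\<And>i j f. (i, j) \<in> square B \<Longrightarrow> (\<And>V. f V \<noteq> 0 \<Longrightarrow> nice n \<pi> V) \<Longrightarrow> hook i j f U = 0\<close>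
        by (auto simp: block_prod_insert pair_sum_op_def sum_fun_apply split_def intro!: sum.neutral)
    qed
    then show ?thesis using False by auto
  qed
qed

section \<open>Test vectors orthogonal to the ideal\<close>

lemma antisym_sum:
  assumes "\<And>i j. i \<in> A \<Longrightarrow> j \<in> A \<Longrightarrow> a i j = - a j i"
  shows "(\<Sum>i\<in>A. \<Sum>j\<in>A. a i j) = (0 :: ext)"
proof -
  have "(\<Sum>i\<in>A. \<Sum>j\<in>A. a i j) = (\<Sum>i\<in>A. \<Sum>j\<in>A. - a j i)"
    using assms by (intro sum.cong refl)
  also have "\<dots> = - (\<Sum>j\<in>A. \<Sum>i\<in>A. a j i)"
    by (subst sum.swap) (simp add: sum_negf)
  finally have "\<forall>U. (\<Sum>i\<in>A. \<Sum>j\<in>A. a i j) U = - (\<Sum>i\<in>A. \<Sum>j\<in>A. a i j) U"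
    by (metis fun_Compl_def)
  then show ?thesis by (simp add: fun_eq_iff)
qed

definition xi_block :: "nat set \<Rightarrow> ext \<Rightarrow> ext" where "xi_block C f = (\<Sum>i\<in>C. mul (Xi i) f)"
definition theta_block :: "nat set \<Rightarrow> ext \<Rightarrow> ext" where "theta_block C f = (\<Sum>j\<in>C. contract (Theta j) f)"

lemma pair_sum_op_square: "pair_sum_op square C f = xi_block C (theta_block C f)"
  by (simp add: pair_sum_op_def square_def xi_block_def theta_block_def hook_def mul_linear_simps sum.cartesian_product)

lemma ext_space_theta_block: "f \<in> ext_space n \<Longrightarrow> theta_block C f \<in> ext_space n"
  unfolding theta_block_def by (intro ext.subspace_sum[OF ext_space_subspace] ext_space_contract)

lemma xi_block_sq: "xi_block C (xi_block C f) = 0"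
  unfolding xi_block_def mul_linear_simps by (rule antisym_sum) (rule mul_anti)

lemma theta_block_sq: "f \<in> ext_space n \<Longrightarrow> theta_block C (theta_block C f) = 0"
  unfolding theta_block_def contract_linear_simps by (rule antisym_sum) (rule contract_anti)

lemma contract_Theta_xi_block: "f \<in> ext_space n \<Longrightarrow> contract (Theta j) (xi_block C f) = - xi_block C (contract (Theta j) f)"
  unfolding xi_block_def contract_linear_simps by (simp add: contract_mul[of f n] sum_negf)

lemma linear_xi_block: "ext_linear (xi_block C)"
  unfolding xi_block_def[abs_def] by (intro ext_linear_sum_op linear_ext_mult)

lemma theta_block_xi_block: "f \<in> ext_space n \<Longrightarrow> theta_block C (xi_block C f) = - xi_block C (theta_block C f)"
  unfolding theta_block_def ext_linear_sum[OF linear_xi_block] sum_negf[symmetric]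
  by (intro sum.cong refl contract_Theta_xi_block)

lemma contract_theta_block: "f \<in> ext_space n \<Longrightarrow> contract \<omega> (theta_block C f) = - theta_block C (contract \<omega> f)"
  unfolding theta_block_def contract_linear_simps by (simp add: contract_anti[of f n \<omega>] sum_negf)

lemma contract_Xi_xi_block:
  "f \<in> ext_space n \<Longrightarrow> finite C \<Longrightarrow> contract (Xi i) (xi_block C f) = (if i \<in> C then f else 0) - xi_block C (contract (Xi i) f)"
  unfolding xi_block_def contract_linear_simps by (simp add: contract_mul[of f n] sum_subtractf)

lemma sum_blocks:
  assumes "partition_on {1..n::nat} \<sigma>"
  shows "(\<Sum>i\<in>{1..n}. f i) = (\<Sum>C\<in>\<sigma>. \<Sum>i\<in>C. f i)"
proof -
  have "\<Union>\<sigma> = {1..n}" using assms by (simp add: partition_on_def)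
  moreover have "\<forall>A\<in>\<sigma>. finite A" using calculation by (metis Sup_upper finite_atLeastAtMost finite_subset)
  moreover have "\<forall>A\<in>\<sigma>. \<forall>B\<in>\<sigma>. A \<noteq> B \<longrightarrow> A \<inter> B = {}"
    using assms by (auto simp: partition_on_def disjoint_def)
  ultimately show ?thesis using sum.Union_disjoint[of \<sigma> f] by simp
qed

abbreviation "square_prod \<equiv> block_prod square"

context
  fixes n :: nat and \<sigma> :: "nat set set"
  assumes part: "partition_on {1..n} \<sigma>"
begin

lemma part_facts: "finite \<sigma>" "\<Union>\<sigma> \<subseteq> {1..n}" "disjoint \<sigma>"
  using part finite_elements[OF _ part] by (auto simp: partition_on_def)

lemma block_prod_coeffs:
  "square_prod n \<sigma> U \<noteq> 0 \<longleftrightarrow> nice n \<sigma> U" "square_prod n \<sigma> U \<in> {-1, 0, 1}"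
  "block_prod offdiag n \<sigma> U =
     (if \<forall>B\<in>\<sigma>. \<forall>x\<in>Xs U \<inter> B. \<forall>y\<in>Ys n U \<inter> B. (x, y) \<in> offdiag B then square_prod n \<sigma> U else 0)"
proof -
  note * = block_prod_coeff[OF part_facts, of U]
  show "square_prod n \<sigma> U \<noteq> 0 \<longleftrightarrow> nice n \<sigma> U" "square_prod n \<sigma> U \<in> {-1, 0, 1}" using * by blast+
  have "\<forall>B\<in>\<sigma>. offdiag B \<subseteq> square B" by (auto simp: square_def offdiag_def)
  then show "block_prod offdiag n \<sigma> U =
     (if \<forall>B\<in>\<sigma>. \<forall>x\<in>Xs U \<inter> B. \<forall>y\<in>Ys n U \<inter> B. (x, y) \<in> offdiag B then square_prod n \<sigma> U else 0)"
    using * by blast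
qed

lemma ext_space_square_prod: "square_prod n \<sigma> \<in> ext_space n"
  unfolding ext_space_iff block_prod_coeffs by (simp add: nice_def)

lemma ext_space_F: "block_prod offdiag n \<sigma> \<in> ext_space n"
  unfolding ext_space_iff using ext_space_square_prod by (auto simp: block_prod_coeffs(3) ext_space_iff split: if_splits)

text \<open>\<open>g\<close> is the product over the remaining blocks. It contains no
  \<open>\<xi>\<close> with index in C, so contraction by such a \<open>\<xi>\<close> acts on the
  factor of C alone; \<open>contract_pairs_square_prod\<close> depends on this.\<close>

lemma block_decomp:
  assumes "C \<in> \<sigma>"
  obtains g where "g \<in> ext_space n" "square_prod n \<sigma> = xi_block C (theta_block C g)" "\<forall>i\<in>C. contract (Xi i) g = 0"
    "C \<subseteq> {1..n}" "finite C"
proof (rule that)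
  let ?g = "square_prod n (\<sigma> - {C})"
  have "finite (\<sigma> - {C})" "\<Union>(\<sigma> - {C}) \<subseteq> {1..n}" "disjoint (\<sigma> - {C})"
    using part_facts by (auto simp: disjoint_def)
  note co = block_prod_coeff[OF this]
  have nz: "nice n (\<sigma> - {C}) U" if "?g U \<noteq> 0" for U using co[of U] that by blast
  show "?g \<in> ext_space n" unfolding ext_space_iff using nz by (auto simp: nice_def)
  show "square_prod n \<sigma> = xi_block C (theta_block C ?g)"
    using block_prod_remove[OF part_facts(1) assms] by (simp add: pair_sum_op_square)
  show "\<forall>i\<in>C. contract (Xi i) ?g = 0"
  proof (intro ballI ext)
    fix i T assume i: "i \<in> C"
    have "?g (insert (Xi i) T) = 0"
    proof (rule ccontr)
      assume "?g (insert (Xi i) T) \<noteq> 0"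
      from nz[OF this] have "i \<in> \<Union>(\<sigma> - {C})"
        by (auto simp: nice_def transversal_def Xs_def)
      then show False using i assms part_facts(3) by (auto simp: disjoint_def)
    qed
    then show "contract (Xi i) ?g T = 0 T" by (simp add: contract_alt)
  qed
next
  show "C \<subseteq> {1..n}" using part_facts(2) assms by auto
  then show "finite C" using finite_subset by blast
qed

lemma xi_mul_square_prod: "xi_mul n (square_prod n \<sigma>) = 0"
proof -
  have "xi_block C (square_prod n \<sigma>) = 0" if C: "C \<in> \<sigma>" for C
  proof -
    obtain g where g: "g \<in> ext_space n" "square_prod n \<sigma> = xi_block C (theta_block C g)" "\<forall>i\<in>C. contract (Xi i) g = 0"
      "C \<subseteq> {1..n}" "finite C" by (rule block_decomp[OF C])
    show ?thesis unfolding g(2) by (rule xi_block_sq)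
  qed
  then show ?thesis unfolding xi_mul_def sum_blocks[OF part] xi_block_def by (rule sum.neutral[OF ballI])
qed

lemma contract_Thetas_square_prod: "(\<Sum>j\<in>{1..n}. contract (Theta j) (square_prod n \<sigma>)) = 0"
proof -
  have "theta_block C (square_prod n \<sigma>) = 0" if C: "C \<in> \<sigma>" for C
  proof -
    obtain g where g: "g \<in> ext_space n" "square_prod n \<sigma> = xi_block C (theta_block C g)" "\<forall>i\<in>C. contract (Xi i) g = 0"
      "C \<subseteq> {1..n}" "finite C" by (rule block_decomp[OF C])
    have "theta_block C (square_prod n \<sigma>) = - xi_block C (theta_block C (theta_block C g))"
      unfolding g(2) by (rule theta_block_xi_block[OF ext_space_theta_block[OF g(1)]])
    then show ?thesis unfolding theta_block_sq[OF g(1)] by (simp add: ext_linear_zero[OF linear_xi_block])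
  qed
  then show ?thesis unfolding sum_blocks[OF part] theta_block_def by (rule sum.neutral[OF ballI])
qed

text \<open>Within a block, contraction by \<open>\<xi>\<^sub>i\<close> cancels the factor
  \<open>xi_block C\<close>, up to a term that vanishes because \<open>g\<close> has no
  \<open>\<xi>\<^sub>i\<close>, and leaves a contraction by \<open>\<theta>\<^sub>i\<close>. Summed
  over the block this is \<open>theta_block C\<close> applied twice, hence 0.\<close>

lemma contract_pairs_square_prod: "(\<Sum>i\<in>{1..n}. contract (Xi i) (contract (Theta i) (square_prod n \<sigma>))) = 0"
proof -
  have "(\<Sum>i\<in>C. contract (Xi i) (contract (Theta i) (square_prod n \<sigma>))) = 0" if C: "C \<in> \<sigma>" for C
  proof -
    obtain g where g: "g \<in> ext_space n" "square_prod n \<sigma> = xi_block C (theta_block C g)" "\<forall>i\<in>C. contract (Xi i) g = 0"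
      "C \<subseteq> {1..n}" "finite C" by (rule block_decomp[OF C])
    have "contract (Xi i) (contract (Theta i) (square_prod n \<sigma>)) = - contract (Theta i) (theta_block C g)" if "i \<in> C" for i
    proof -
      have "contract (Xi i) (contract (Theta i) (theta_block C g)) = - contract (Theta i) (- theta_block C (contract (Xi i) g))"
        by (subst contract_anti[OF ext_space_theta_block[OF g(1)]]) (simp only: contract_theta_block[OF g(1)])
      also have "\<dots> = 0" using g(3) that by (simp add: theta_block_def contract_linear_simps)
      finally show ?thesis
        unfolding g(2) contract_Theta_xi_block[OF ext_space_theta_block[OF g(1)]] contract_linear_simps
          contract_Xi_xi_block[OF ext_space_contract[OF ext_space_theta_block[OF g(1)]] g(5)]
        using that by (simp add: xi_block_def mul_linear_simps)
    qed
    then have "(\<Sum>i\<in>C. contract (Xi i) (contract (Theta i) (square_prod n \<sigma>))) = - theta_block C (theta_block C g)"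
      by (simp add: theta_block_def[of C "theta_block C g"] sum_negf)
    then show ?thesis by (simp add: theta_block_sq[OF g(1)])
  qed
  then show ?thesis unfolding sum_blocks[OF part] by (rule sum.neutral[OF ballI])
qed

definition test_vector :: ext where
  "test_vector = (\<Sum>i\<in>{1..n}. contract (Xi i) (square_prod n \<sigma>))"

text \<open>Adjointness turns the three kinds of ideal elements into three sums of contractions of
  the test vector. In the first and the third the contraction by all \<open>\<xi>\<close> is moved
  outwards, which exposes a vanishing sum for \<open>square_prod\<close>; the second is an
  antisymmetric double sum.\<close>

lemma pairing_sum_ideal_test_vector:
  assumes "x \<in> sum_ideal n"
  shows "pairing n x test_vector = 0"
proof -
  obtain a b c where *: "x = theta_mul n a + xi_mul n b + theta_xi_mul n c"
    using assms by (rule sum_ideal_E)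
  let ?G = "square_prod n \<sigma>" and ?D = "\<lambda>j. contract (Theta j)" and ?X = "\<lambda>j. contract (Xi j)"
  have "(\<Sum>i\<in>{1..n}. ?D i test_vector) = (\<Sum>i\<in>{1..n}. \<Sum>j\<in>{1..n}. - ?X j (?D i ?G))"
    unfolding test_vector_def contract_linear_simps
    by (intro sum.cong refl contract_anti[OF ext_space_square_prod])
  also have "\<dots> = - (\<Sum>j\<in>{1..n}. ?X j (\<Sum>i\<in>{1..n}. ?D i ?G))"
    by (subst sum.swap) (simp only: contract_linear_simps sum_negf)
  finally have 1: "(\<Sum>i\<in>{1..n}. ?D i test_vector) = 0"
    unfolding contract_Thetas_square_prod by (simp add: contract_linear_simps)
  have 2: "(\<Sum>i\<in>{1..n}. ?X i test_vector) = 0"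
    unfolding test_vector_def contract_linear_simps by (rule antisym_sum) (rule contract_anti[OF ext_space_square_prod])
  have "?X i (?D i (?X j ?G)) = ?X j (?X i (?D i ?G))" for i j
  proof -
    have "?X i (?D i (?X j ?G)) = - ?X i (?X j (?D i ?G))"
      by (subst contract_anti[OF ext_space_square_prod, of "Theta i" "Xi j"]) (simp only: contract_linear_simps)
    also have "\<dots> = ?X j (?X i (?D i ?G))"
      by (subst contract_anti[OF ext_space_contract[OF ext_space_square_prod], of "Xi i" "Xi j"]) simp
    finally show ?thesis .
  qed
  then have "(\<Sum>i\<in>{1..n}. ?X i (?D i test_vector)) = (\<Sum>j\<in>{1..n}. ?X j (\<Sum>i\<in>{1..n}. ?X i (?D i ?G)))"
    unfolding test_vector_def contract_linear_simps by (subst sum.swap) simp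
  then have 3: "(\<Sum>i\<in>{1..n}. ?X i (?D i test_vector)) = 0"
    unfolding contract_pairs_square_prod by (simp add: contract_linear_simps)
  have "pairing n (theta_mul n a) test_vector = pairing n a (\<Sum>i\<in>{1..n}. ?D i test_vector)"
    unfolding theta_mul_def pairing_sum pairing_sum_right by (intro sum.cong refl pairing_adjoint) simp
  moreover have "pairing n (xi_mul n b) test_vector = pairing n b (\<Sum>i\<in>{1..n}. ?X i test_vector)"
    unfolding xi_mul_def pairing_sum pairing_sum_right by (intro sum.cong refl pairing_adjoint) simp
  moreover have "pairing n (theta_xi_mul n c) test_vector = pairing n c (\<Sum>i\<in>{1..n}. ?X i (?D i test_vector))"
    unfolding theta_xi_mul_def pairing_sum pairing_sum_right by (intro sum.cong refl) (simp add: pairing_adjoint)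
  ultimately show ?thesis unfolding * pairing_add 1 2 3 by (simp add: pairing_zero_right)
qed

text \<open>Multiplication by the sum of all \<open>\<xi>\<close> and contraction by it have
  anticommutator n, and the former annihilates \<open>square_prod n \<sigma>\<close>. This is the
  origin of the factor n in the pairing.\<close>

lemma xi_mul_test_vector: "xi_mul n test_vector = ext_scale (of_nat n) (square_prod n \<sigma>)"
proof -
  let ?G = "square_prod n \<sigma>"
  have "mul (Xi i) (contract (Xi j) ?G) = (if j = i then ?G else 0) - contract (Xi j) (mul (Xi i) ?G)" for i j
    by (simp add: contract_mul[OF ext_space_square_prod])
  then have "xi_mul n test_vector = (\<Sum>j\<in>{1..n}. \<Sum>i\<in>{1..n}. (if j = i then ?G else 0) - contract (Xi j) (mul (Xi i) ?G))"
    unfolding xi_mul_def test_vector_def mul_linear_simps by (subst sum.swap) simp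
  also have "\<dots> = (\<Sum>j\<in>{1..n}. ?G - contract (Xi j) (xi_mul n ?G))"
    unfolding sum_subtractf xi_mul_def contract_linear_simps by simp
  also have "\<dots> = ext_scale (of_nat n) ?G"
    unfolding xi_mul_square_prod contract_linear_simps by (simp add: fun_eq_iff sum_fun_apply ext_scale_def)
  finally show ?thesis .
qed

lemma pairing_contract_test_vector: "pairing n (\<Sum>i\<in>{1..n}. contract (Xi i) F) test_vector = of_nat n * pairing n F (square_prod n \<sigma>)"
proof -
  have "pairing n (\<Sum>i\<in>{1..n}. contract (Xi i) F) test_vector = (\<Sum>i\<in>{1..n}. pairing n (mul (Xi i) test_vector) F)"
    unfolding pairing_sum by (intro sum.cong refl, subst pairing_sym, subst pairing_adjoint) auto
  also have "\<dots> = pairing n (xi_mul n test_vector) F" unfolding xi_mul_def pairing_sum ..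
  finally show ?thesis unfolding xi_mul_test_vector pairing_scale by (simp add: pairing_sym)
qed

end

lemma f_part_eq: "f_part n \<pi> = (\<Sum>i\<in>{1..n}. contract (Xi i) (block_prod offdiag n \<pi>))"
  by (simp add: f_part_def F_part_eq fun_eq_iff sum_fun_apply)

section \<open>Linear independence\<close>

definition same_block :: "nat set set \<Rightarrow> nat \<Rightarrow> nat \<Rightarrow> bool" where
  "same_block \<pi> x y \<longleftrightarrow> (\<exists>B\<in>\<pi>. x \<in> B \<and> y \<in> B)"

lemma NC_partition: "\<pi> \<in> NC n \<Longrightarrow> partition_on {1..n} \<pi>"
  by (simp add: NC_def)

lemma partition_same_block:
  assumes "partition_on A \<pi>" "B \<in> \<pi>" "x \<in> B"
  shows "same_block \<pi> x y \<longleftrightarrow> y \<in> B"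
  using assms unfolding same_block_def partition_on_def disjoint_def by blast

lemma partition_block_ex: "partition_on A \<pi> \<Longrightarrow> x \<in> A \<Longrightarrow> \<exists>B\<in>\<pi>. x \<in> B"
  unfolding partition_on_def by blast

lemma disjoint_block_unique: "disjoint \<pi> \<Longrightarrow> B \<in> \<pi> \<Longrightarrow> C \<in> \<pi> \<Longrightarrow> x \<in> B \<Longrightarrow> x \<in> C \<Longrightarrow> B = C"
  unfolding disjoint_def by blast

lemma same_block_sym: "same_block \<pi> x y \<longleftrightarrow> same_block \<pi> y x"
  by (auto simp: same_block_def)

lemma same_block_trans:
  "partition_on A \<pi> \<Longrightarrow> same_block \<pi> x y \<Longrightarrow> same_block \<pi> y z \<Longrightarrow> same_block \<pi> x z"
  unfolding same_block_def partition_on_def disjoint_def by blast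

lemma partition_eqI:
  assumes "partition_on A \<pi>" "partition_on A \<sigma>"
    and "\<And>x y. x \<in> A \<Longrightarrow> y \<in> A \<Longrightarrow> same_block \<pi> x y = same_block \<sigma> x y"
  shows "\<pi> \<subseteq> \<sigma>"
proof
  fix B assume B: "B \<in> \<pi>"
  then obtain b where b: "b \<in> B" "b \<in> A" using assms(1) unfolding partition_on_def by (metis UnionI ex_in_conv)
  then obtain C where C: "C \<in> \<sigma>" "b \<in> C" using partition_block_ex[OF assms(2)] by blast
  have "y \<in> B \<longleftrightarrow> y \<in> C" for y
  proof (cases "y \<in> A")
    case True
    then show ?thesis
      using partition_same_block[OF assms(1) B b(1), of y] partition_same_block[OF assms(2) C, of y] assms(3)[OF b(2) True]
      by simp
  next
    case False
    then show ?thesis using B C(1) assms(1,2) by (auto simp: partition_on_def)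
  qed
  then show "B \<in> \<sigma>" using C by (metis subsetI subset_antisym)
qed

lemma NC_crossing:
  assumes "\<pi> \<in> NC n" "a < b" "b < c" "c < d" "same_block \<pi> a c" "same_block \<pi> b d"
  shows "same_block \<pi> a b"
proof -
  have "\<exists>B\<in>\<pi>. {a, b, c, d} \<subseteq> B"
    using assms unfolding NC_def same_block_def by blast
  then show ?thesis by (auto simp: same_block_def)
qed

lemma Min_props:
  assumes "partition_on {1..n::nat} \<pi>" "x \<in> {1..n}"
  shows "x \<notin> Min ` \<pi> \<longleftrightarrow> (\<exists>y<x. same_block \<pi> y x)"
    "x \<notin> Max ` \<pi> \<longleftrightarrow> (\<exists>y>x. same_block \<pi> y x)"
proof -
  obtain B where B: "B \<in> \<pi>" "x \<in> B" using partition_block_ex[OF assms] by blast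
  have fin: "finite C" "C \<noteq> {}" if "C \<in> \<pi>" for C
    using assms(1) that finite_subset[of C "{1..n}"] by (auto simp: partition_on_def)
  have uniq: "C = B" if "C \<in> \<pi>" "x \<in> C" for C
    using assms(1) that B by (auto simp: partition_on_def disjoint_def)
  have 1: "x \<in> Min ` \<pi> \<longleftrightarrow> x = Min B"
  proof
    assume "x \<in> Min ` \<pi>"
    then obtain C where C: "C \<in> \<pi>" "x = Min C" by blast
    then have "C = B" using fin[of C] by (intro uniq) auto
    then show "x = Min B" using C by simp
  qed (use B in blast)
  have 2: "x \<in> Max ` \<pi> \<longleftrightarrow> x = Max B"
  proof
    assume "x \<in> Max ` \<pi>"
    then obtain C where C: "C \<in> \<pi>" "x = Max C" by blast
    then have "C = B" using fin[of C] by (intro uniq) auto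
    then show "x = Max B" using C by simp
  qed (use B in blast)
  have s: "same_block \<pi> y x \<longleftrightarrow> y \<in> B" for y
    using partition_same_block[OF assms(1) B, of y] same_block_sym[of \<pi> x y] by simp
  show "x \<notin> Min ` \<pi> \<longleftrightarrow> (\<exists>y<x. same_block \<pi> y x)"
    unfolding 1 s using fin[OF B(1)] B(2)
    by (metis Min_in Min_le linorder_neqE_nat not_le)
  show "x \<notin> Max ` \<pi> \<longleftrightarrow> (\<exists>y>x. same_block \<pi> y x)"
    unfolding 2 s using fin[OF B(1)] B(2)
    by (metis Max_in Max_ge linorder_neqE_nat not_le)
qed

text \<open>\<open>p\<close> and \<open>q\<close> are the predecessors of \<open>c\<close> in its
  blocks. If \<open>p < q\<close>, then \<open>q\<close>, which is no block maximum of \<sigma>, is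
  none of \<pi> either and has a later block-mate \<open>d\<close> in \<pi>. If
  \<open>d < c\<close>, agreement below \<open>c\<close> makes \<open>d\<close> a later predecessor
  than \<open>q\<close> in \<sigma>; if \<open>d = c\<close>, then \<open>q\<close> beats
  \<open>p\<close> in \<pi>; if \<open>d > c\<close>, the pairs p, c and q, d cross.\<close>

lemma NC_pred_le:
  assumes \<pi>: "\<pi> \<in> NC n" and \<sigma>: "\<sigma> \<in> NC n" and mx: "Max ` \<pi> = Max ` \<sigma>"
    and IH: "\<And>x y. x < y \<Longrightarrow> y < c \<Longrightarrow> same_block \<pi> x y = same_block \<sigma> x y"
    and p: "p < c" "same_block \<pi> p c" "\<And>x. x < c \<Longrightarrow> same_block \<pi> x c \<Longrightarrow> x \<le> p"
    and q: "q < c" "same_block \<sigma> q c" "\<And>x. x < c \<Longrightarrow> same_block \<sigma> x c \<Longrightarrow> x \<le> q"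
  shows "q \<le> p"
proof (rule ccontr)
  assume "\<not> q \<le> p"
  then have "p < q" by simp
  note part = NC_partition[OF \<pi>] NC_partition[OF \<sigma>]
  have "q \<in> {1..n}" using q(2) part(2) by (auto simp: same_block_def partition_on_def)
  then have "q \<notin> Max ` \<pi>" using Min_props(2)[OF part(2)] q(1,2) same_block_sym mx by metis
  then obtain d where d: "d > q" "same_block \<pi> d q"
    using Min_props(2)[OF part(1) \<open>q \<in> {1..n}\<close>] by auto
  have ncq: "\<not> same_block \<pi> q c" using p(3) q(1) \<open>p < q\<close> by force
  consider "d < c" | "d = c" | "d > c" by linarith
  then show False
  proof cases
    case 1
    then have "same_block \<sigma> d q" using IH[of q d] d same_block_sym by blast
    then have "same_block \<sigma> d c" using q(2) same_block_trans[OF part(2)] by blast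
    then show False using q(3)[of d] 1 d by auto
  next
    case 2
    then show False using d ncq same_block_sym by blast
  next
    case 3
    then have "same_block \<pi> p q"
      using NC_crossing[OF \<pi> \<open>p < q\<close> q(1) 3 p(2)] d same_block_sym by blast
    then show False using ncq p(2) same_block_trans[OF part(1)] same_block_sym by blast
  qed
qed

text \<open>Strong induction on the larger element: the minima decide whether \<open>c\<close> has a
  predecessor, \<open>NC_pred_le\<close> in both directions shows that the predecessors agree, and
  below the common predecessor the induction hypothesis takes over.\<close>

lemma NC_same_block_eq:
  assumes \<pi>: "\<pi> \<in> NC n" and \<sigma>: "\<sigma> \<in> NC n"
    and mn: "Min ` \<pi> = Min ` \<sigma>" and mx: "Max ` \<pi> = Max ` \<sigma>"
  shows "x < c \<Longrightarrow> same_block \<pi> x c = same_block \<sigma> x c"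
proof (induction c arbitrary: x rule: less_induct)
  case (less c)
  note part = NC_partition[OF \<pi>] NC_partition[OF \<sigma>]
  have dom: "c \<in> {1..n}" if "same_block \<tau> y c" "partition_on {1..n} \<tau>" for \<tau> y
    using that by (auto simp: same_block_def partition_on_def)
  let ?P = "\<lambda>\<tau> y. y < c \<and> same_block \<tau> y c"
  show ?case
  proof (cases "c \<in> {1..n} \<and> c \<notin> Min ` \<pi>")
    case False
    then show ?thesis
      using dom part less.prems Min_props(1) mn by metis
  next
    case True
    then have ex: "\<exists>y. ?P \<pi> y" "\<exists>y. ?P \<sigma> y" using Min_props(1) part mn by metis+
    have bound: "\<And>y. ?P \<pi> y \<Longrightarrow> y \<le> c" "\<And>y. ?P \<sigma> y \<Longrightarrow> y \<le> c" by auto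
    define p where "p = Greatest (?P \<pi>)"
    define q where "q = Greatest (?P \<sigma>)"
    have p: "p < c" "same_block \<pi> p c" "\<And>x. x < c \<Longrightarrow> same_block \<pi> x c \<Longrightarrow> x \<le> p"
      using GreatestI_ex_nat[OF ex(1) bound(1)] Greatest_le_nat[of "?P \<pi>" _ c] unfolding p_def by auto
    have q: "q < c" "same_block \<sigma> q c" "\<And>x. x < c \<Longrightarrow> same_block \<sigma> x c \<Longrightarrow> x \<le> q"
      using GreatestI_ex_nat[OF ex(2) bound(2)] Greatest_le_nat[of "?P \<sigma>" _ c] unfolding q_def by auto
    have "q \<le> p" by (rule NC_pred_le[OF \<pi> \<sigma> mx _ p q]) (rule less.IH)
    moreover have "p \<le> q"
      by (rule NC_pred_le[OF \<sigma> \<pi> mx[symmetric] _ q p]) (rule less.IH[symmetric])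
    ultimately have "p = q" by simp
    have "same_block \<pi> x c \<longleftrightarrow> x \<le> p \<and> same_block \<pi> x p" if "x < c" for x
      using p that same_block_trans[OF part(1)] same_block_sym by blast
    moreover have "same_block \<sigma> x c \<longleftrightarrow> x \<le> p \<and> same_block \<sigma> x p" if "x < c" for x
      using q that same_block_trans[OF part(2)] same_block_sym unfolding \<open>p = q\<close> by blast
    moreover have "x < p \<Longrightarrow> same_block \<pi> x p = same_block \<sigma> x p" using less.IH p(1) by blast
    moreover have "same_block \<pi> p p = same_block \<sigma> p p"
      using p(2) q(2) unfolding \<open>p = q\<close> same_block_def by blast
    ultimately show ?thesis using less.prems by (metis le_neq_implies_less)
  qed
qed

lemma NC_eqI:
  assumes \<pi>: "\<pi> \<in> NC n" and \<sigma>: "\<sigma> \<in> NC n"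
    and mn: "Min ` \<pi> = Min ` \<sigma>" and mx: "Max ` \<pi> = Max ` \<sigma>"
  shows "\<pi> = \<sigma>"
proof -
  note part = NC_partition[OF \<pi>] NC_partition[OF \<sigma>]
  have "same_block \<pi> x y = same_block \<sigma> x y" if "x \<in> {1..n}" "y \<in> {1..n}" for x y
  proof (cases x y rule: linorder_cases)
    case equal
    have "same_block \<tau> x x" if "partition_on {1..n} \<tau>" for \<tau>
      using that \<open>x \<in> {1..n}\<close> by (auto simp: same_block_def partition_on_def)
    then show ?thesis using part equal by blast
  qed (use NC_same_block_eq[OF assms] same_block_sym in blast)+
  then show ?thesis using partition_eqI[OF part] partition_eqI[OF part(2,1)] by blast
qed

lemma finite_NC: "finite (NC n)"
proof (rule finite_subset)
  show "NC n \<subseteq> Pow (Pow {1..n})" by (auto simp: NC_def partition_on_def)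
qed auto

text \<open>An arbitrary injective weight, maximised on each block by \<open>u\<close>, serves the
  minima (weight \<open>n - z\<close>) and the maxima (weight z) alike. Injectivity turns equality
  of the sums into equality of the chosen elements.\<close>

lemma transversal_sum:
  fixes f :: "nat \<Rightarrow> nat"
  assumes tr: "transversal \<pi> Z" and fin: "finite \<pi>" "finite (\<Union>\<pi>)" and disj: "disjoint \<pi>"
    and u: "\<And>B. B \<in> \<pi> \<Longrightarrow> u B \<in> B" and f: "\<And>B z. B \<in> \<pi> \<Longrightarrow> z \<in> B \<Longrightarrow> f z \<le> f (u B)"
    and inj: "inj_on f (\<Union>\<pi>)"
  shows "(\<Sum>z\<in>Z. f z) \<le> (\<Sum>B\<in>\<pi>. f (u B))"
    "(\<Sum>z\<in>Z. f z) = (\<Sum>B\<in>\<pi>. f (u B)) \<Longrightarrow> Z = u ` \<pi>"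
proof -
  obtain z where z: "\<And>B. B \<in> \<pi> \<Longrightarrow> Z \<inter> B = {z B}" using tr unfolding transversal_def by metis
  have Z: "Z = z ` \<pi>" using tr z unfolding transversal_def by blast
  have zB: "z B \<in> B" if "B \<in> \<pi>" for B using z[OF that] by blast
  have "inj_on z \<pi>" using zB disj unfolding inj_on_def disjoint_def by (metis disjoint_iff)
  then have sum: "(\<Sum>z\<in>Z. f z) = (\<Sum>B\<in>\<pi>. f (z B))" unfolding Z by (simp add: sum.reindex)
  show "(\<Sum>z\<in>Z. f z) \<le> (\<Sum>B\<in>\<pi>. f (u B))"
    unfolding sum using f zB by (intro sum_mono) auto
  assume eq: "(\<Sum>z\<in>Z. f z) = (\<Sum>B\<in>\<pi>. f (u B))"
  have "f (z B) = f (u B)" if "B \<in> \<pi>" for B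
  proof (rule ccontr)
    assume "f (z B) \<noteq> f (u B)"
    then have "f (z B) < f (u B)" using f zB that by (simp add: le_neq_implies_less)
    then have "(\<Sum>B\<in>\<pi>. f (z B)) < (\<Sum>B\<in>\<pi>. f (u B))"
      using f zB that fin by (intro sum_strict_mono_ex1) auto
    then show False using eq sum by simp
  qed
  then have "z B = u B" if "B \<in> \<pi>" for B
    using inj_onD[OF inj] zB u that by blast
  then show "Z = u ` \<pi>" unfolding Z by simp
qed

text \<open>This is the order behind the leading coefficients: it grows as minima move left and
  maxima move right. Using \<open>n - Min B\<close> keeps it within the natural numbers.\<close>

definition spread :: "nat \<Rightarrow> nat set set \<Rightarrow> nat" where
  "spread n \<pi> = (\<Sum>B\<in>\<pi>. n - Min B) + (\<Sum>B\<in>\<pi>. Max B)"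

lemma partition_blocks:
  assumes "partition_on {1..n::nat} \<pi>"
  shows "finite \<pi>" "\<Union>\<pi> = {1..n}" "disjoint \<pi>" "\<And>B. B \<in> \<pi> \<Longrightarrow> finite B \<and> B \<noteq> {}"
    "inj_on Min \<pi>" "inj_on Max \<pi>"
proof -
  show "finite \<pi>" using finite_elements[OF _ assms] by auto
  show *: "\<Union>\<pi> = {1..n}" "disjoint \<pi>" using assms by (auto simp: partition_on_def)
  have "finite B" if "B \<in> \<pi>" for B using *(1) that finite_subset[of B "{1..n}"] by auto
  then show fin: "\<And>B. B \<in> \<pi> \<Longrightarrow> finite B \<and> B \<noteq> {}"
    using assms by (auto simp: partition_on_def)
  show "inj_on Min \<pi>" "inj_on Max \<pi>"
    using fin Min_in Max_in *(2) unfolding inj_on_def disjoint_def by (metis disjoint_iff)+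
qed

text \<open>If the extremal monomial of \<sigma> occurs in \<open>F\<^sub>\<pi>\<close>, the minima
  and the maxima of \<sigma> are transversals of \<pi>, and no transversal can beat the minima or
  maxima of \<pi> itself. For noncrossing partitions the extremal coefficients are thus triangular
  with respect to \<open>spread\<close>.\<close>

lemma spread_le:
  assumes "partition_on {1..n} \<pi>" "partition_on {1..n} \<sigma>"
    and tr: "transversal \<pi> (Min ` \<sigma>)" "transversal \<pi> (Max ` \<sigma>)"
  shows "spread n \<sigma> \<le> spread n \<pi>" "spread n \<sigma> = spread n \<pi> \<Longrightarrow> Min ` \<sigma> = Min ` \<pi> \<and> Max ` \<sigma> = Max ` \<pi>"
proof -
  note P = partition_blocks[OF assms(1)] and S = partition_blocks[OF assms(2)]
  have bl: "B \<subseteq> {1..n}" if "B \<in> \<pi>" for B using P(2) that by auto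
  have s: "(\<Sum>B\<in>\<sigma>. n - Min B) = (\<Sum>z\<in>Min ` \<sigma>. n - z)" "(\<Sum>B\<in>\<sigma>. Max B) = (\<Sum>z\<in>Max ` \<sigma>. z)"
    using S by (simp_all add: sum.reindex)
  have injm: "inj_on (\<lambda>z. n - z) (\<Union>\<pi>)" unfolding P(2) by (auto simp: inj_on_def)
  have finU: "finite (\<Union>\<pi>)" unfolding P(2) by simp
  have Min: "Min B \<in> B" "z \<in> B \<Longrightarrow> n - z \<le> n - Min B" if "B \<in> \<pi>" for B z
    using P(4)[OF that] by (auto intro!: diff_le_mono2 Min_in)
  have Max: "Max B \<in> B" "z \<in> B \<Longrightarrow> z \<le> Max B" if "B \<in> \<pi>" for B z
    using P(4)[OF that] by auto
  note A = transversal_sum[OF tr(1) P(1) finU P(3), of Min "\<lambda>z. n - z", OF Min injm]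
  note B = transversal_sum[OF tr(2) P(1) finU P(3), of Max "\<lambda>z. z", OF Max inj_on_id2]
  show "spread n \<sigma> \<le> spread n \<pi>" unfolding spread_def s using A(1) B(1) by linarith
  show "Min ` \<sigma> = Min ` \<pi> \<and> Max ` \<sigma> = Max ` \<pi>" if "spread n \<sigma> = spread n \<pi>"
    using that A B unfolding spread_def s by linarith
qed

definition extremal :: "nat \<Rightarrow> nat set set \<Rightarrow> gen set" where
  "extremal n \<sigma> = Theta ` ({1..n} - Max ` \<sigma>) \<union> Xi ` (Min ` \<sigma>)"

lemma extremal_sets:
  assumes "partition_on {1..n} \<sigma>"
  shows "Xs (extremal n \<sigma>) = Min ` \<sigma>" "Ys n (extremal n \<sigma>) = Max ` \<sigma>" "extremal n \<sigma> \<subseteq> gens n"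
proof -
  note P = partition_blocks[OF assms]
  have incl: "Min ` \<sigma> \<subseteq> {1..n}" "Max ` \<sigma> \<subseteq> {1..n}"
    using P(4) Min_in Max_in unfolding P(2)[symmetric] by blast+
  show "Xs (extremal n \<sigma>) = Min ` \<sigma>" by (auto simp: Xs_def extremal_def)
  show "Ys n (extremal n \<sigma>) = Max ` \<sigma>" using incl by (auto simp: Ys_def extremal_def)
  show "extremal n \<sigma> \<subseteq> gens n" using incl by (auto simp: extremal_def gens_def)
qed

lemma transversal_selection:
  assumes "partition_on {1..n::nat} \<sigma>" "\<And>B. B \<in> \<sigma> \<Longrightarrow> u B \<in> B"
  shows "transversal \<sigma> (u ` \<sigma>)" "B \<in> \<sigma> \<Longrightarrow> u ` \<sigma> \<inter> B = {u B}"
proof -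
  note P = partition_blocks[OF assms(1)]
  show *: "u ` \<sigma> \<inter> B = {u B}" if "B \<in> \<sigma>" for B
  proof -
    have "C = B" if "C \<in> \<sigma>" "u C \<in> B" for C
      using disjoint_block_unique[OF P(3) that(1) \<open>B \<in> \<sigma>\<close>] assms(2) that by blast
    then show ?thesis using assms(2) that by blast
  qed
  show "transversal \<sigma> (u ` \<sigma>)" unfolding transversal_def using * assms(2) by auto
qed

lemma F_extremal:
  assumes "partition_on {1..n} \<sigma>"
  shows "block_prod offdiag n \<sigma> (extremal n \<sigma>) \<noteq> 0"
proof -
  note P = partition_blocks[OF assms] and E = extremal_sets[OF assms] and co = block_prod_coeffs[OF assms]
  have m: "\<And>B. B \<in> \<sigma> \<Longrightarrow> Min B \<in> B" "\<And>B. B \<in> \<sigma> \<Longrightarrow> Max B \<in> B" using P(4) by auto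
  have "nice n \<sigma> (extremal n \<sigma>)"
    unfolding nice_def E(1,2) using E(3) transversal_selection(1)[OF assms] m by blast
  \<comment> \<open>Minimum and maximum coincide only in a singleton, where the diagonal pair is the
    admissible one.\<close>
  moreover have "(Min B, Max B) \<in> offdiag B" if "B \<in> \<sigma>" for B
  proof -
    have "card B = 1" if "Min B = Max B"
    proof -
      have "B = {Min B}" using that P(4)[OF \<open>B \<in> \<sigma>\<close>] 
        by (metis Max_ge Min_le antisym Min_in insertI1 singletonD subsetI subset_antisym empty_subsetI insert_subset)
      then show ?thesis by (metis is_singletonI is_singleton_altdef)
    qed
    then show ?thesis using m that by (auto simp: offdiag_def)
  qed
  ultimately show ?thesis
    using co(1)[of "extremal n \<sigma>"] transversal_selection(2)[OF assms, of Min] transversal_selection(2)[OF assms, of Max] m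
    unfolding co(3) E(1,2) by simp
qed

section \<open>Pairings controlled by singleton blocks\<close>

definition sings :: "nat set set \<Rightarrow> nat set" where "sings \<pi> = {x. {x} \<in> \<pi>}"

text \<open>An index both added and deleted uses a diagonal pair of its block, which
  \<open>offdiag\<close> admits for singletons only.\<close>

lemma F_repeated_index:
  assumes "partition_on {1..n} \<pi>" "block_prod offdiag n \<pi> U \<noteq> 0" "x \<in> Xs U" "x \<in> Ys n U"
  shows "x \<in> sings \<pi>"
proof -
  note co = block_prod_coeffs[OF assms(1)]
  have "x \<in> {1..n}" using assms(4) by (simp add: Ys_def)
  then obtain B where B: "B \<in> \<pi>" "x \<in> B" using partition_block_ex[OF assms(1)] by blast
  have "(x, x) \<in> offdiag B" using assms(2,3,4) B unfolding co(3) by (auto split: if_splits)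
  then have "B = {x}" using B by (auto simp: offdiag_def card_1_singleton_iff)
  then show ?thesis using B by (simp add: sings_def)
qed

text \<open>In a common monomial a singleton of \<sigma> forces its element into both transversals,
  so it is a repeated index for \<pi>.\<close>

lemma pairing_F_nonzero:
  assumes "partition_on {1..n} \<pi>" "partition_on {1..n} \<sigma>" "pairing n (block_prod offdiag n \<pi>) (square_prod n \<sigma>) \<noteq> 0"
  shows "sings \<sigma> \<subseteq> sings \<pi>"
proof
  fix x assume x: "x \<in> sings \<sigma>"
  obtain U where "block_prod offdiag n \<pi> U * square_prod n \<sigma> U \<noteq> 0"
    using sum.not_neutral_contains_not_neutral[OF assms(3)[unfolded pairing_def]] by blast
  then have U: "block_prod offdiag n \<pi> U \<noteq> 0" "square_prod n \<sigma> U \<noteq> 0" by auto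
  have "nice n \<sigma> U" using U(2) block_prod_coeffs(1)[OF assms(2), of U] by blast
  then have "transversal \<sigma> (Xs U)" "transversal \<sigma> (Ys n U)" by (simp_all add: nice_def)
  moreover have "x \<in> Z" if "transversal \<sigma> Z" for Z
  proof -
    have "{x} \<in> \<sigma>" "\<forall>B\<in>\<sigma>. \<exists>y. Z \<inter> B = {y}" using that x unfolding sings_def transversal_def by simp_all
    then obtain y where "Z \<inter> {x} = {y}" by blast
    then have "y \<in> Z \<inter> {x}" by simp
    then show ?thesis by auto
  qed
  ultimately have "x \<in> Xs U" "x \<in> Ys n U" by simp_all
  then show "x \<in> sings \<pi>" using F_repeated_index[OF assms(1) U(1)] by blast
qed

text \<open>On the support of \<open>F\<^sub>\<pi>\<close> every repeated index is a singleton of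
  \<pi>, hence of \<sigma>. The diagonal pairs of larger blocks of \<sigma>, where
  \<open>G\<^sub>\<sigma>\<close> and \<open>F\<^sub>\<sigma>\<close> differ, are never met.\<close>

lemma pairing_F_eq:
  assumes "partition_on {1..n} \<pi>" "partition_on {1..n} \<sigma>" "sings \<sigma> = sings \<pi>"
  shows "pairing n (block_prod offdiag n \<pi>) (square_prod n \<sigma>) = pairing n (block_prod offdiag n \<pi>) (block_prod offdiag n \<sigma>)"
  unfolding pairing_def
proof (intro sum.cong refl)
  fix U
  show "block_prod offdiag n \<pi> U * square_prod n \<sigma> U = block_prod offdiag n \<pi> U * block_prod offdiag n \<sigma> U"
  proof (cases "block_prod offdiag n \<pi> U = 0")
    case False
    have "(x, y) \<in> offdiag C" if "C \<in> \<sigma>" "x \<in> Xs U \<inter> C" "y \<in> Ys n U \<inter> C" for C x y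
    proof (cases "x = y")
      case True
      then have "{x} \<in> \<sigma>" using F_repeated_index[OF assms(1) False] that assms(3) by (auto simp: sings_def)
      then have "C = {x}" using that disjoint_block_unique[OF partition_blocks(3)[OF assms(2)]] by blast
      then show ?thesis using that by (auto simp: offdiag_def)
    qed (use that in \<open>auto simp: offdiag_def\<close>)
    then have "block_prod offdiag n \<sigma> U = square_prod n \<sigma> U" unfolding block_prod_coeffs(3)[OF assms(2)] by auto
    then show ?thesis by simp
  qed simp
qed

lemma F_real: "partition_on {1..n} \<pi> \<Longrightarrow> cnj (block_prod offdiag n \<pi> U) = block_prod offdiag n \<pi> U"
  using block_prod_coeffs(2)[of n \<pi> U] by (auto simp: block_prod_coeffs(3))

lemma F_independent:
  assumes "P \<subseteq> NC n" "\<And>U. U \<subseteq> gens n \<Longrightarrow> (\<Sum>\<pi>\<in>P. c \<pi> * block_prod offdiag n \<pi> U) = 0" "\<pi>0 \<in> P"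
  shows "c \<pi>0 = 0"
proof (rule ccontr)
  assume "c \<pi>0 \<noteq> 0"
  let ?Q = "{\<pi> \<in> P. c \<pi> \<noteq> 0}"
  have fin: "finite P" using assms(1) finite_NC finite_subset by blast
  have "\<pi>0 \<in> ?Q" using assms(3) \<open>c \<pi>0 \<noteq> 0\<close> by simp
  then obtain \<sigma> where \<sigma>: "\<sigma> \<in> ?Q" "\<And>\<pi>. \<pi> \<in> ?Q \<Longrightarrow> spread n \<pi> \<le> spread n \<sigma>"
    using fin Max_in[of "spread n ` ?Q"] Max_ge[of "spread n ` ?Q"]
    by (smt (verit, best) empty_iff finite_imageI finite_subset image_iff imageI mem_Collect_eq subsetI)
  \<comment> \<open>With \<open>\<sigma>\<close> of largest spread among the partitions with nonzero
    coefficient, \<open>\<sigma>\<close> alone contributes at its extremal monomial.\<close>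
  let ?U = "extremal n \<sigma>"
  have NC: "\<sigma> \<in> NC n" using \<sigma>(1) assms(1) by auto
  note part = NC_partition[OF NC]
  have z: "c \<pi> * block_prod offdiag n \<pi> ?U = 0" if "\<pi> \<in> P - {\<sigma>}" for \<pi>
  proof (rule ccontr)
    assume "c \<pi> * block_prod offdiag n \<pi> ?U \<noteq> 0"
    then have \<pi>: "\<pi> \<in> ?Q" "block_prod offdiag n \<pi> ?U \<noteq> 0" using that by auto
    have NC': "\<pi> \<in> NC n" using that assms(1) by auto
    note part' = NC_partition[OF NC']
    have "square_prod n \<pi> ?U \<noteq> 0" using \<pi>(2) unfolding block_prod_coeffs(3)[OF part'] by (auto split: if_splits)
    then have "transversal \<pi> (Min ` \<sigma>)" "transversal \<pi> (Max ` \<sigma>)"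
      unfolding block_prod_coeffs(1)[OF part'] nice_def extremal_sets[OF part] by auto
    note sp = spread_le[OF part' part this]
    have "Min ` \<sigma> = Min ` \<pi> \<and> Max ` \<sigma> = Max ` \<pi>" using sp(1) \<sigma>(2)[OF \<pi>(1)] by (intro sp(2)) simp
    then have "\<sigma> = \<pi>" using NC_eqI[OF NC NC'] by auto
    then show False using that by auto
  qed
  have "(\<Sum>\<pi>\<in>P. c \<pi> * block_prod offdiag n \<pi> ?U) = c \<sigma> * block_prod offdiag n \<sigma> ?U"
    using sum.neutral[of "P - {\<sigma>}", OF ballI, OF z] \<sigma>(1) fin by (subst sum.remove[of P \<sigma>]) auto
  then show False using assms(2)[OF extremal_sets(3)[OF part]] F_extremal[OF part] \<sigma>(1) by auto
qed

theorem f_part_independent: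
  assumes "n \<ge> 1" "(\<Sum>\<pi>\<in>NC n. ext_scale (c \<pi>) (f_part n \<pi>)) \<in> sum_ideal n" "\<pi>0 \<in> NC n"
  shows "c \<pi>0 = 0"
proof (rule ccontr)
  assume "c \<pi>0 \<noteq> 0"
  let ?F = "block_prod offdiag n" and ?Q = "{\<pi> \<in> NC n. c \<pi> \<noteq> 0}"
  have part: "partition_on {1..n} \<pi>" if "\<pi> \<in> NC n" for \<pi> using NC_partition that by blast
  have finQ: "finite ?Q" using finite_NC by simp
  have fins: "finite (sings \<pi>)" if "\<pi> \<in> NC n" for \<pi>
    by (rule finite_subset[of _ "{1..n}"]) (use part[OF that] in \<open>auto simp: sings_def partition_on_def\<close>)
  have "\<pi>0 \<in> ?Q" using assms(3) \<open>c \<pi>0 \<noteq> 0\<close> by simp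
  then obtain \<tau> where \<tau>: "\<tau> \<in> ?Q" "\<And>\<pi>. \<pi> \<in> ?Q \<Longrightarrow> card (sings \<pi>) \<le> card (sings \<tau>)"
    using finQ Max_in[of "(\<lambda>\<pi>. card (sings \<pi>)) ` ?Q"] Max_ge[of "(\<lambda>\<pi>. card (sings \<pi>)) ` ?Q"]
    by (smt (verit, best) empty_iff finite_imageI image_iff imageI mem_Collect_eq)
  \<comment> \<open>This is the diagonal block of \<tau>. A nonzero pairing with a member of
    \<open>?S\<close> requires at least its singletons, and the maximality of \<tau> excludes any
    more, so only \<open>?S\<close> itself contributes.\<close>
  let ?S = "{\<pi> \<in> ?Q. sings \<pi> = sings \<tau>}"
  have pair: "(\<Sum>\<pi>\<in>NC n. c \<pi> * pairing n (?F \<pi>) (square_prod n \<sigma>)) = 0" if "\<sigma> \<in> NC n" for \<sigma>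
  proof -
    have "0 = pairing n (\<Sum>\<pi>\<in>NC n. ext_scale (c \<pi>) (f_part n \<pi>)) (test_vector n \<sigma>)"
      using pairing_sum_ideal_test_vector[OF part[OF that] assms(2)] by simp
    also have "\<dots> = (\<Sum>\<pi>\<in>NC n. c \<pi> * pairing n (f_part n \<pi>) (test_vector n \<sigma>))"
      by (simp only: pairing_sum pairing_scale)
    also have "\<dots> = of_nat n * (\<Sum>\<pi>\<in>NC n. c \<pi> * pairing n (?F \<pi>) (square_prod n \<sigma>))"
      unfolding f_part_eq pairing_contract_test_vector[OF part[OF that]]
      by (simp add: sum_distrib_left mult_ac)
    finally show ?thesis using assms(1) by simp
  qed
  let ?\<Phi> = "\<lambda>U. \<Sum>\<pi>\<in>?S. c \<pi> * ?F \<pi> U"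
  have orth: "(\<Sum>U\<in>Pow (gens n). ?\<Phi> U * ?F \<sigma> U) = 0" if \<sigma>: "\<sigma> \<in> ?S" for \<sigma>
  proof -
    have "c \<pi> * pairing n (?F \<pi>) (square_prod n \<sigma>) = 0" if \<pi>: "\<pi> \<in> NC n - ?S" for \<pi>
    proof (rule ccontr)
      assume "\<not> ?thesis"
      then have nz: "c \<pi> \<noteq> 0" "pairing n (?F \<pi>) (square_prod n \<sigma>) \<noteq> 0" by auto
      then have "sings \<tau> \<subseteq> sings \<pi>" using pairing_F_nonzero[of n \<pi> \<sigma>] part \<pi> \<sigma> by auto
      moreover have "card (sings \<pi>) \<le> card (sings \<tau>)" using \<tau>(2) nz \<pi> by auto
      ultimately have "sings \<tau> = sings \<pi>" using card_seteq[of "sings \<pi>" "sings \<tau>"] fins \<pi> by auto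
      then show False using nz \<pi> by auto
    qed
    then have "(\<Sum>\<pi>\<in>?S. c \<pi> * pairing n (?F \<pi>) (square_prod n \<sigma>)) = (\<Sum>\<pi>\<in>NC n. c \<pi> * pairing n (?F \<pi>) (square_prod n \<sigma>))"
      by (intro sum.mono_neutral_left) (auto simp: finite_NC)
    also have "\<dots> = 0" using pair \<sigma> by auto
    finally have "(\<Sum>\<pi>\<in>?S. c \<pi> * pairing n (?F \<pi>) (square_prod n \<sigma>)) = 0" .
    moreover have "pairing n (?F \<pi>) (square_prod n \<sigma>) = pairing n (?F \<pi>) (?F \<sigma>)" if "\<pi> \<in> ?S" for \<pi>
      using that \<sigma> by (intro pairing_F_eq part) auto
    ultimately have "(\<Sum>\<pi>\<in>?S. c \<pi> * pairing n (?F \<pi>) (?F \<sigma>)) = 0"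
      by simp
    then show ?thesis
      unfolding pairing_def sum_distrib_left sum_distrib_right by (subst sum.swap) (simp add: mult_ac)
  qed
  \<comment> \<open>The \<open>?F \<sigma>\<close> are real, so the conjugate of
    \<open>?\<Phi>\<close> is again a combination of them, and \<open>orth\<close> makes the squared
    norm of \<open>?\<Phi>\<close> vanish. Then \<open>F_independent\<close> applies.\<close>
  have "(\<Sum>U\<in>Pow (gens n). ?\<Phi> U * cnj (?\<Phi> U)) = (\<Sum>\<sigma>\<in>?S. cnj (c \<sigma>) * (\<Sum>U\<in>Pow (gens n). ?\<Phi> U * ?F \<sigma> U))"
  proof -
    have "cnj (?\<Phi> U) = (\<Sum>\<sigma>\<in>?S. cnj (c \<sigma>) * ?F \<sigma> U)" for U
      unfolding cnj_sum complex_cnj_mult by (intro sum.cong refl) (simp add: F_real[OF part])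
    then show ?thesis
      by (simp only: sum_distrib_left, subst sum.swap) (simp only: mult_ac)
  qed
  also have "\<dots> = 0" using orth by (intro sum.neutral ballI) (simp only: mult_zero_right)
  finally have "of_real (\<Sum>U\<in>Pow (gens n). (cmod (?\<Phi> U))\<^sup>2) = (0 :: complex)"
    by (simp only: complex_norm_square[symmetric] of_real_sum)
  then have "(\<Sum>U\<in>Pow (gens n). (cmod (?\<Phi> U))\<^sup>2) = 0" by (simp only: of_real_eq_0_iff)
  then have "\<forall>U\<in>Pow (gens n). (cmod (?\<Phi> U))\<^sup>2 = 0"
    by (subst (asm) sum_nonneg_eq_0_iff) (auto simp: finite_gens)
  then have "?\<Phi> U = 0" if "U \<subseteq> gens n" for U using that by simp
  then have "c \<tau> = 0" using F_independent[of ?S n c \<tau>] \<tau>(1) by auto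
  then show False using \<tau>(1) by auto
qed

section \<open>Noncrossing partitions with prescribed minima and maxima\<close>

text \<open>A crossing that uses \<open>p\<close> is either present already with \<open>c\<close> in
  place of \<open>p\<close>, or it involves a point strictly between \<open>p\<close> and
  \<open>c\<close> and a second point of the same block. A second point further right contradicts
  \<open>between\<close>, one left of \<open>p\<close> contradicts \<open>below\<close>.\<close>

lemma NC_merge:
  assumes NC: "\<pi> \<in> NC n" and o: "{p} \<in> \<pi>" and C: "C \<in> \<pi>" "Min C = c" "p < c"
    and between: "\<And>b. p < b \<Longrightarrow> b < c \<Longrightarrow> b \<in> Max ` \<pi>"
    and below: "\<And>b. b < c \<Longrightarrow> b \<in> {1..n} \<Longrightarrow> b \<in> Min ` \<pi>"
  defines "\<pi>' \<equiv> insert (insert p C) (\<pi> - {{p}, C})"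
  shows "\<pi>' \<in> NC n" "Min ` \<pi>' = Min ` \<pi> - {c}" "Max ` \<pi>' = Max ` \<pi> - {p}"
proof -
  note part = NC_partition[OF NC]
  note P = partition_blocks[OF part]
  note uniq = disjoint_block_unique[OF P(3)]
  have cC: "c \<in> C" "\<And>x. x \<in> C \<Longrightarrow> c \<le> x" using P(4)[OF C(1)] Min_in[of C] C(2) by auto
  have pC: "p \<notin> C" "{p} \<noteq> C" using cC C(3) by (auto dest: cC(2))
  have old: "B \<in> \<pi>" "p \<notin> B" "\<And>x. x \<in> B \<Longrightarrow> x \<notin> C" if "B \<in> \<pi> - {{p}, C}" for B
    using that uniq[of B "{p}" p] uniq[of B C] o C by auto
  have part': "partition_on {1..n} \<pi>'"
  proof -
    have "\<Union>\<pi>' = \<Union>\<pi>" using o C(1) unfolding \<pi>'_def by auto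
    moreover have "disjoint \<pi>'"
    proof (rule disjointI)
      fix A B assume "A \<in> \<pi>'" "B \<in> \<pi>'" "A \<noteq> B"
      then show "A \<inter> B = {}"
        using old uniq unfolding \<pi>'_def by blast
    qed
    moreover have "{} \<notin> \<pi>'" using P(4) unfolding \<pi>'_def by auto
    ultimately show ?thesis using P(2) by (simp add: partition_on_def)
  qed
  have cross: False if "x < y" "y < z" "z < w" "B1 \<in> \<pi>" "B2 \<in> \<pi>" "B1 \<noteq> B2" "x \<in> B1" "z \<in> B1" "y \<in> B2" "w \<in> B2"
    for x y z w B1 B2
  proof -
    have "same_block \<pi> x y"
      by (rule NC_crossing[OF NC that(1-3)]) (use that in \<open>auto simp: same_block_def\<close>)
    then show False using that uniq unfolding same_block_def by blast
  qed
  have bl: "B \<subseteq> {1..n}" if "B \<in> \<pi>" for B using that P(2) by blast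
  have main: "B1 = B2"
    if q: "x < y" "y < z" "z < w" "B1 \<in> \<pi>'" "B2 \<in> \<pi>'" "x \<in> B1" "z \<in> B1" "y \<in> B2" "w \<in> B2"
    for x y z w B1 B2
  proof (rule ccontr)
    assume ne: "B1 \<noteq> B2"
    consider "B1 \<in> \<pi> - {{p}, C}" "B2 \<in> \<pi> - {{p}, C}" | "B1 = insert p C" "B2 \<in> \<pi> - {{p}, C}"
      | "B1 \<in> \<pi> - {{p}, C}" "B2 = insert p C"
      using q(4,5) ne unfolding \<pi>'_def by blast
    then show False
    proof cases
      case 1
      then show False using cross[OF q(1-3) _ _ ne q(6-9)] by blast
    next
      case 2
      have z: "z \<in> C" using q(1,2,6,7) cC(2)[of x] C(3) unfolding 2 by auto
      have B2: "B2 \<in> \<pi>" "C \<noteq> B2" using 2 by auto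
      show False
      proof (cases "x = p")
        case False
        then show False using cross[OF q(1-3) C(1) B2 _ z q(8,9)] q(6) 2 by auto
      next
        case True
        have "y \<noteq> c" using old(3)[OF 2(2) q(8)] cC by auto
        moreover have "\<not> y < c"
        proof
          assume "y < c"
          then have "y \<in> Max ` \<pi>" using between q(1) True by simp
          then have "\<not> same_block \<pi> w y"
            using Min_props(2)[OF part, of y] bl[OF B2(1)] q(2,3,8) by auto
          then show False using B2(1) q(8,9) by (auto simp: same_block_def)
        qed
        ultimately have "c < y" by simp
        then show False using cross[OF _ q(2,3) C(1) B2 cC(1) z q(8,9)] by simp
      qed
    next
      case 3
      have B1: "B1 \<in> \<pi>" "B1 \<noteq> C" using 3 by auto
      have w: "w \<in> C" using q(2,3,8,9) cC(2)[of y] C(3) unfolding 3 by auto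
      show False
      proof (cases "y = p")
        case False
        then show False using cross[OF q(1-3) B1(1) C(1) B1(2) q(6,7) _ w] q(8) 3 by auto
      next
        case True
        have "z \<noteq> c" using old(3)[OF 3(1) q(7)] cC by auto
        moreover have "\<not> z < c"
        proof
          assume "z < c"
          then have "z \<in> Min ` \<pi>" using below bl[OF B1(1)] q(7) by auto
          then have "\<not> same_block \<pi> x z"
            using Min_props(1)[OF part, of z] bl[OF B1(1)] q(1,2,7) by auto
          then show False using B1(1) q(6,7) by (auto simp: same_block_def)
        qed
        ultimately have "c < z" by simp
        moreover have "x < c" using q(1) True C(3) by simp
        ultimately show False using cross[OF _ _ q(3) B1(1) C(1) B1(2) q(6,7) cC(1) w] by simp
      qed
    qed
  qed
  show "\<pi>' \<in> NC n"
    unfolding NC_def mem_Collect_eq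
  proof (intro conjI allI impI part')
    fix a b d e
    assume *: "a < b \<and> b < d \<and> d < e \<and> (\<exists>B\<in>\<pi>'. a \<in> B \<and> d \<in> B) \<and> (\<exists>B\<in>\<pi>'. b \<in> B \<and> e \<in> B)"
    then obtain B1 B2 where B: "B1 \<in> \<pi>'" "a \<in> B1" "d \<in> B1" "B2 \<in> \<pi>'" "b \<in> B2" "e \<in> B2" by blast
    then have "B1 = B2" using main[of a b d e] * by blast
    then show "\<exists>B\<in>\<pi>'. {a, b, d, e} \<subseteq> B" using B by blast
  qed
  have fC: "finite C" "C \<noteq> {}" using P(4)[OF C(1)] by auto
  have "Min (insert p C) = p" using fC C(2,3) by simp
  moreover have "Min ` (\<pi> - {{p}, C}) = Min ` \<pi> - {p, c}"
    using inj_on_image_set_diff[OF P(5), of \<pi> "{{p}, C}"] o C by simp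
  moreover have "p \<in> Min ` \<pi>" using o by (metis Min_singleton image_eqI)
  ultimately show "Min ` \<pi>' = Min ` \<pi> - {c}" using C(3) unfolding \<pi>'_def by auto
  have "p < Max C" using C(2,3) fC by (metis Min_le_iff Max_in less_le_trans cC(2))
  then have "Max (insert p C) = Max C" using fC by simp
  moreover have "Max ` (\<pi> - {{p}, C}) = Max ` \<pi> - {p, Max C}"
    using inj_on_image_set_diff[OF P(6), of \<pi> "{{p}, C}"] o C by simp
  ultimately show "Max ` \<pi>' = Max ` \<pi> - {p}" using \<open>p < Max C\<close> C(1) unfolding \<pi>'_def by auto
qed

text \<open>Sending a non-minimum to its predecessor in the block is a strictly decreasing bijection
  onto the non-maxima; this explains the counting condition. For the converse the least non-minimum
  \<open>c\<close> is matched with the nearest non-maximum \<open>p\<close> before it. With both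
  removed, the induction hypothesis gives a partition in which \<open>p\<close> is a singleton and
  \<open>c\<close> opens a block, and \<open>NC_merge\<close> joins them.\<close>

lemma NC_exists:
  assumes "N \<subseteq> {1..n}" "X \<subseteq> {1..n}" "card N = card X"
    and "\<And>c. card {x \<in> N. x \<le> c} \<le> card {x \<in> X. x < c}"
  shows "\<exists>\<pi>\<in>NC n. Min ` \<pi> = {1..n} - N \<and> Max ` \<pi> = {1..n} - X"
  using assms
proof (induction "card N" arbitrary: N X)
  case 0
  then have e: "N = {}" "X = {}" using finite_subset[of N "{1..n}"] finite_subset[of X "{1..n}"] by auto
  let ?\<pi> = "(\<lambda>x. {x}) ` {1..n}"
  have "partition_on {1..n} ?\<pi>" by (auto simp: partition_on_def disjoint_def)
  then have "?\<pi> \<in> NC n" by (auto simp: NC_def)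
  moreover have "Min ` ?\<pi> = {1..n}" "Max ` ?\<pi> = {1..n}" by (simp_all add: image_image)
  ultimately show ?case using e by blast
next
  case (Suc m)
  have fin: "finite N" "finite X" using Suc.prems finite_subset[of _ "{1..n}"] by auto
  have "N \<noteq> {}" using Suc.hyps(2) by auto
  define c where "c = Min N"
  have c: "c \<in> N" "\<And>x. x \<in> N \<Longrightarrow> c \<le> x" using fin \<open>N \<noteq> {}\<close> by (auto simp: c_def)
  have "card {x \<in> N. x \<le> c} \<noteq> 0" using c(1) fin by auto
  then have "card {x \<in> X. x < c} \<noteq> 0" using Suc.prems(4)[of c] by linarith
  then have ne: "{x \<in> X. x < c} \<noteq> {}" by (metis card.empty)
  define p where "p = Max {x \<in> X. x < c}"
  have p: "p \<in> X" "p < c" using Max_in[OF _ ne] fin unfolding p_def by auto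
  have pmax: "x \<le> p" if "x \<in> X" "x < c" for x using that fin unfolding p_def by simp
  have "\<exists>\<pi>\<in>NC n. Min ` \<pi> = {1..n} - (N - {c}) \<and> Max ` \<pi> = {1..n} - (X - {p})"
  proof (rule Suc.hyps(1))
    show "m = card (N - {c})" "card (N - {c}) = card (X - {p})"
      using Suc.hyps(2) Suc.prems(3) c(1) p(1) fin by simp_all
    show "N - {c} \<subseteq> {1..n}" "X - {p} \<subseteq> {1..n}" using Suc.prems by auto
    fix e
    show "card {x \<in> N - {c}. x \<le> e} \<le> card {x \<in> X - {p}. x < e}"
    \<comment> \<open>Left of \<open>c\<close> there is nothing to count in \<open>N\<close>; from
      \<open>c\<close> on, both counts drop by exactly one.\<close>
    proof (cases "e < c")
      case True
      then have "{x \<in> N - {c}. x \<le> e} = {}" using c(2) by force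
      then show ?thesis by (metis card.empty le0)
    next
      case False
      have "{x \<in> N - {c}. x \<le> e} = {x \<in> N. x \<le> e} - {c}" "{x \<in> X - {p}. x < e} = {x \<in> X. x < e} - {p}" by auto
      moreover have "c \<in> {x \<in> N. x \<le> e}" "p \<in> {x \<in> X. x < e}" using c p False by auto
      ultimately show ?thesis using Suc.prems(4)[of e] fin by simp
    qed
  qed
  then obtain \<pi> where \<pi>: "\<pi> \<in> NC n" "Min ` \<pi> = {1..n} - (N - {c})" "Max ` \<pi> = {1..n} - (X - {p})" by blast
  note part = NC_partition[OF \<pi>(1)]
  note P = partition_blocks[OF part]
  have rng: "p \<in> {1..n}" "c \<in> {1..n}" using p c Suc.prems by auto
  have "p \<notin> N" using c(2) p(2) by force
  then have "p \<in> Min ` \<pi>" "p \<in> Max ` \<pi>" unfolding \<pi>(2,3) using rng by auto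
  then obtain A B where AB: "A \<in> \<pi>" "p = Min A" "B \<in> \<pi>" "p = Max B" by blast
  have "p \<in> A" "p \<in> B" using Min_in[of A] Max_in[of B] P(4)[OF AB(1)] P(4)[OF AB(3)] unfolding AB(2,4)[symmetric] by blast+
  then have "A = B" using disjoint_block_unique[OF P(3)] AB by blast
  have "A = {p}"
  proof
    show "A \<subseteq> {p}"
    proof
      fix x assume "x \<in> A"
      have "Min A \<le> x" "x \<le> Max A" using \<open>x \<in> A\<close> P(4)[OF AB(1)] by simp_all
      then have "p \<le> x" "x \<le> p" using AB(2,4) \<open>A = B\<close> by simp_all
      then show "x \<in> {p}" by simp
    qed
  qed (use \<open>p \<in> A\<close> in auto)
  have "c \<in> Min ` \<pi>" unfolding \<pi>(2) using rng by auto
  then obtain C where C: "C \<in> \<pi>" "Min C = c" by blast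
  note merge = NC_merge[OF \<pi>(1) _ C p(2)]
  let ?\<pi> = "insert (insert p C) (\<pi> - {{p}, C})"
  have pp: "{p} \<in> \<pi>" using AB(1) \<open>A = {p}\<close> by simp
  have btw: "b \<in> Max ` \<pi>" if "p < b" "b < c" for b
    unfolding \<pi>(3) using that pmax[of b] rng by auto
  have bel: "b \<in> Min ` \<pi>" if "b < c" "b \<in> {1..n}" for b
    unfolding \<pi>(2) using that c(2)[of b] by auto
  have "?\<pi> \<in> NC n" "Min ` ?\<pi> = Min ` \<pi> - {c}" "Max ` ?\<pi> = Max ` \<pi> - {p}"
    by (rule merge[OF pp btw bel]; assumption)+
  moreover have "{1..n} - (N - {c}) - {c} = {1..n} - N" "{1..n} - (X - {p}) - {p} = {1..n} - X"
    using c(1) p(1) by auto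
  ultimately show ?case unfolding \<pi>(2,3) by metis
qed

section \<open>Straightening\<close>

text \<open>Adding up the relations for all \<open>P \<union> K\<close> with P of size r - 1 counts
  each r-set once for every choice of its inserted element, that is r times; then r is divided
  out.\<close>

lemma sum_subsets_in:
  assumes V: "ext.subspace V" and fin: "finite \<Omega>"
    and rel: "\<And>P. P \<subseteq> \<Omega> \<Longrightarrow> (\<Sum>i\<in>\<Omega> - P. M (insert i P)) \<in> V"
    and K: "K \<subseteq> \<Omega>" and r: "r > 0"
  shows "(\<Sum>P | P \<subseteq> \<Omega> - K \<and> card P = r. M (P \<union> K)) \<in> V"
proof -
  let ?A = "\<lambda>r. {P. P \<subseteq> \<Omega> - K \<and> card P = r}"
  have finA: "finite (?A s)" for s by (rule finite_subset[of _ "Pow \<Omega>"]) (use fin in auto)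
  have finP: "finite P" if "P \<subseteq> \<Omega> - K" for P using that fin finite_subset by blast
  have "(\<Sum>P\<in>?A (r - 1). \<Sum>i\<in>\<Omega> - (P \<union> K). M (insert i (P \<union> K))) \<in> V"
    by (intro ext.subspace_sum[OF V] rel) (use K in auto)
  also have "(\<Sum>P\<in>?A (r - 1). \<Sum>i\<in>\<Omega> - (P \<union> K). M (insert i (P \<union> K)))
      = (\<Sum>(P, i)\<in>(SIGMA P:?A (r - 1). \<Omega> - (P \<union> K)). M (insert i (P \<union> K)))"
    by (rule sum.Sigma) (use finA fin in auto)
  also have "\<dots> = (\<Sum>(P, i)\<in>(SIGMA P:?A r. P). M (P \<union> K))"
  proof (rule sum.reindex_bij_witness[where i = "\<lambda>(P, i). (P - {i}, i)" and j = "\<lambda>(P, i). (insert i P, i)"], goal_cases)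
    case (2 a)
    then show ?case using r finP by (auto simp: card_insert_if)
  next
    case (4 a)
    then show ?case using r finP by (auto simp: card_Diff_singleton)
  qed (auto simp: insert_absorb)
  also have "\<dots> = (\<Sum>P\<in>?A r. \<Sum>i\<in>P. M (P \<union> K))"
    by (rule sum.Sigma[symmetric]) (use finA finP in auto)
  also have "\<dots> = (\<Sum>P\<in>?A r. ext_scale (of_nat r) (M (P \<union> K)))"
    by (intro sum.cong refl) (auto simp: fun_eq_iff sum_fun_apply ext_scale_def)
  also have "\<dots> = ext_scale (of_nat r) (\<Sum>P\<in>?A r. M (P \<union> K))"
    by (rule ext.scale_sum_right[symmetric])
  finally have "ext_scale (inverse (of_nat r)) (ext_scale (of_nat r) (\<Sum>P\<in>?A r. M (P \<union> K))) \<in> V"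
    by (rule ext.subspace_scale[OF V])
  then show ?thesis using r by simp
qed

text \<open>Induction on \<open>D\<close>: the sets that avoid d are all sets minus those that
  contain d, and for the latter d moves into \<open>K\<close> while r drops by one. The bound
  \<open>card D < r\<close> survives in both terms and ends as the positivity of r in
  \<open>sum_subsets_in\<close>.\<close>

lemma sum_subsets_avoiding_in:
  assumes V: "ext.subspace V" and fin: "finite \<Omega>"
    and rel: "\<And>P. P \<subseteq> \<Omega> \<Longrightarrow> (\<Sum>i\<in>\<Omega> - P. M (insert i P)) \<in> V"
    and "finite D" "D \<subseteq> \<Omega>" "K \<subseteq> \<Omega>" "D \<inter> K = {}" "card D < r"
  shows "(\<Sum>P | P \<subseteq> \<Omega> - D - K \<and> card P = r. M (P \<union> K)) \<in> V"
  using assms(4-)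
proof (induction D arbitrary: K r rule: finite_induct)
  case empty
  then show ?case using sum_subsets_in[OF V fin rel, of K r] by simp
next
  case (insert d D)
  let ?A = "\<lambda>D K r. {P. P \<subseteq> \<Omega> - D - K \<and> card P = r}"
  have finA: "finite (?A D K s)" for D K s by (rule finite_subset[of _ "Pow \<Omega>"]) (use fin in auto)
  have d: "d \<in> \<Omega> - D - K" "0 < r" using insert by auto
  have finP: "finite P" if "P \<subseteq> \<Omega> - D - K" for P D K using that fin finite_subset by blast
  have split: "?A D K r = ?A (insert d D) K r \<union> insert d ` ?A D (insert d K) (r - 1)"
  proof (intro equalityI subsetI)
    fix P assume P: "P \<in> ?A D K r"
    show "P \<in> ?A (insert d D) K r \<union> insert d ` ?A D (insert d K) (r - 1)"
    proof (cases "d \<in> P")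
      case True
      then have "P = insert d (P - {d})" by auto
      moreover have "P - {d} \<in> ?A D (insert d K) (r - 1)" using P True finP[of P D K] by auto
      ultimately show ?thesis by blast
    qed (use P in auto)
  next
    fix P assume "P \<in> ?A (insert d D) K r \<union> insert d ` ?A D (insert d K) (r - 1)"
    then show "P \<in> ?A D K r"
    proof
      assume "P \<in> insert d ` ?A D (insert d K) (r - 1)"
      then obtain Q where Q: "P = insert d Q" "Q \<subseteq> \<Omega> - D - insert d K" "card Q = r - 1" by auto
      then have "d \<notin> Q" "finite Q" using finP by auto
      then show ?thesis using Q d by auto
    qed auto
  qed
  have inj: "inj_on (insert d) (?A D (insert d K) (r - 1))"
  proof (rule inj_onI)
    fix Q Q' assume "Q \<in> ?A D (insert d K) (r - 1)" "Q' \<in> ?A D (insert d K) (r - 1)" "insert d Q = insert d Q'"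
    moreover from this have "d \<notin> Q" "d \<notin> Q'" by blast+
    ultimately show "Q = Q'" using insert_ident[of d Q Q'] by blast
  qed
  have "(\<Sum>P\<in>?A D K r. M (P \<union> K)) = (\<Sum>P\<in>?A (insert d D) K r. M (P \<union> K))
      + (\<Sum>P\<in>?A D (insert d K) (r - 1). M (P \<union> insert d K))"
  proof -
    have "(\<Sum>P\<in>insert d ` ?A D (insert d K) (r - 1). M (P \<union> K)) = (\<Sum>P\<in>?A D (insert d K) (r - 1). M (P \<union> insert d K))"
      by (subst sum.reindex[OF inj]) simp
    moreover have "(\<Sum>P\<in>?A D K r. M (P \<union> K)) = (\<Sum>P\<in>?A (insert d D) K r. M (P \<union> K))
      + (\<Sum>P\<in>insert d ` ?A D (insert d K) (r - 1). M (P \<union> K))"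
      unfolding split by (rule sum.union_disjoint) (use finA in auto)
    ultimately show ?thesis by simp
  qed
  then have eq: "(\<Sum>P\<in>?A (insert d D) K r. M (P \<union> K)) = (\<Sum>P\<in>?A D K r. M (P \<union> K))
      - (\<Sum>P\<in>?A D (insert d K) (r - 1). M (P \<union> insert d K))" by simp
  have "(\<Sum>P\<in>?A D K r. M (P \<union> K)) \<in> V"
    using insert.prems insert.hyps by (intro insert.IH) auto
  moreover have "(\<Sum>P\<in>?A D (insert d K) (r - 1). M (P \<union> insert d K)) \<in> V"
    using insert.prems insert.hyps by (intro insert.IH) auto
  ultimately show ?case unfolding eq by (rule ext.subspace_diff[OF V])
qed

definition balanced :: "nat set \<Rightarrow> nat set \<Rightarrow> bool" where
  "balanced \<Omega> P \<longleftrightarrow> (\<forall>j. card {i \<in> P. i \<le> j} \<le> card {i \<in> \<Omega> - P. i \<le> j})"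

text \<open>If an initial segment contains more points of \<open>P\<close> than of its complement \<open>D\<close>, the relation
  that avoids \<open>D\<close> rewrites \<open>M P\<close> in terms of sets whose points lie further to the right.\<close>

lemma straightening:
  assumes V: "ext.subspace V" and fin: "finite \<Omega>"
    and rel: "\<And>P. P \<subseteq> \<Omega> \<Longrightarrow> (\<Sum>i\<in>\<Omega> - P. M (insert i P)) \<in> V"
    and bal: "\<And>P. P \<subseteq> \<Omega> \<Longrightarrow> card P = k \<Longrightarrow> balanced \<Omega> P \<Longrightarrow> M P \<in> V"
    and P: "P \<subseteq> \<Omega>" "card P = k"
  shows "M P \<in> V"
  using P
\<comment> \<open>The sum of the positions increases with every rewriting and cannot exceed
  \<open>\<Sum>\<Omega>\<close>.\<close>
proof (induction "\<Sum>\<Omega> - \<Sum>P" arbitrary: P rule: less_induct)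
  case less
  note finP = finite_subset[OF less.prems(1) fin]
  show ?case
  proof (cases "balanced \<Omega> P")
    case True
    then show ?thesis using bal less.prems by blast
  next
    case False
    then obtain j where j: "card {i \<in> \<Omega> - P. i \<le> j} < card {i \<in> P. i \<le> j}"
      by (auto simp: balanced_def not_le)
    define D where "D = {i \<in> \<Omega> - P. i \<le> j}"
    define P0 where "P0 = {i \<in> P. i \<le> j}"
    define K where "K = P - P0"
    let ?A = "{Q. Q \<subseteq> \<Omega> - D - K \<and> card Q = card P0}"
    have finA: "finite ?A" by (rule finite_subset[of _ "Pow \<Omega>"]) (use fin in auto)
    have "(\<Sum>Q\<in>?A. M (Q \<union> K)) \<in> V"
      by (rule sum_subsets_avoiding_in[OF V fin rel])
        (use fin less.prems(1) j in \<open>auto simp: D_def K_def P0_def\<close>)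
    moreover have P0: "P0 \<in> ?A" "P0 \<union> K = P" using less.prems(1) by (auto simp: P0_def D_def K_def)
    moreover have "M (Q \<union> K) \<in> V" if Q: "Q \<in> ?A - {P0}" for Q
    proof (rule less.hyps)
      have finQ: "finite Q" "finite P0" using Q finite_subset[OF _ fin] finP by (auto simp: P0_def)
      have disj: "Q \<inter> K = {}" "P0 \<inter> K = {}" using Q by (auto simp: K_def)
      have finK: "finite K" using finP by (simp add: K_def)
      show incl: "Q \<union> K \<subseteq> \<Omega>" using Q less.prems(1) by (auto simp: K_def)
      show "card (Q \<union> K) = k"
      proof -
        have "card (Q \<union> K) = card P0 + card K" using card_Un_disjoint[OF finQ(1) finK disj(1)] Q by simp
        also have "\<dots> = card P" using card_Un_disjoint[OF finQ(2) finK disj(2)] P0(2) by simp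
        finally show ?thesis using less.prems(2) by simp
      qed
      have "card (Q - P0) = card (P0 - Q)"
        using Q finQ by (simp add: card_Diff_subset_Int Int_commute)
      moreover have "Q - P0 \<noteq> {}"
        using Q card_subset_eq[OF finQ(2), of Q] by auto
      \<comment> \<open>Up to j every point of \<open>\<Omega>\<close> lies in \<open>D\<close> or
        in \<open>P0\<close>, so whatever Q has outside \<open>P0\<close> lies to the right of what
        it replaces.\<close>
      moreover have "i > j" if "i \<in> Q - P0" for i
        using that Q by (auto simp: D_def K_def P0_def)
      then have "\<Sum>(Q - P0) \<ge> card (Q - P0) * Suc j"
        using sum_bounded_below[of "Q - P0" "Suc j" "\<lambda>i. i"] by (simp add: Suc_le_eq)
      moreover have "\<Sum>(P0 - Q) \<le> card (P0 - Q) * j"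
        using sum_bounded_above[of "P0 - Q" "\<lambda>i. i" j] by (simp add: P0_def)
      moreover have "card (Q - P0) \<noteq> 0" using calculation(2) finQ by simp
      ultimately have "\<Sum>(P0 - Q) < \<Sum>(Q - P0)" by (simp add: algebra_simps)
      moreover have "\<Sum>Q = \<Sum>(Q - P0) + \<Sum>(Q \<inter> P0)" "\<Sum>P0 = \<Sum>(P0 - Q) + \<Sum>(P0 \<inter> Q)"
        using finQ by (metis add.commute sum.Int_Diff)+
      ultimately have "\<Sum>P0 < \<Sum>Q" by (simp add: Int_commute)
      then have "\<Sum>(P0 \<union> K) < \<Sum>(Q \<union> K)"
        using disj finQ finK by (simp add: sum.union_disjoint)
      moreover have "\<Sum>(Q \<union> K) \<le> \<Sum>\<Omega>" using incl fin by (intro sum_mono2) auto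
      ultimately show "\<Sum>\<Omega> - \<Sum>(Q \<union> K) < \<Sum>\<Omega> - \<Sum>P" unfolding P0(2) by linarith
    qed
    then have "(\<Sum>Q\<in>?A - {P0}. M (Q \<union> K)) \<in> V" by (rule ext.subspace_sum[OF V])
    moreover
    have "(\<Sum>Q\<in>?A. M (Q \<union> K)) = M P + (\<Sum>Q\<in>?A - {P0}. M (Q \<union> K))"
      using sum.remove[OF finA P0(1), of "\<lambda>Q. M (Q \<union> K)"] P0(2) by simp
    then have "M P = (\<Sum>Q\<in>?A. M (Q \<union> K)) - (\<Sum>Q\<in>?A - {P0}. M (Q \<union> K))" by simp
    ultimately show ?thesis using ext.subspace_diff[OF V] by simp
  qed
qed

text \<open>The constructors of \<open>gen\<close> double as names for \<open>a\<^sub>i\<close> and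
  \<open>b\<^sub>i\<close>, so that subsets of \<open>gens (n - 1)\<close>, their order and their
  bidegree serve unchanged for monomials in the new generators.\<close>

primrec new_mul :: "gen \<Rightarrow> ext \<Rightarrow> ext" where
  "new_mul (Theta i) f = (\<Sum>j\<in>{1..i}. mul (Theta j) f)"
| "new_mul (Xi i) f = mul (Xi i) f - mul (Xi (Suc i)) f"

lemma linear_new_mul: "ext_linear (new_mul x)"
proof (cases x)
  case (Theta i)
  then have "new_mul x = (\<lambda>f. \<Sum>j\<in>{1..i}. mul (Theta j) f)" by (intro ext) simp
  then show ?thesis by (simp only: ext_linear_sum_op linear_ext_mult)
next
  case (Xi i)
  then have "new_mul x = (\<lambda>f. mul (Xi i) f - mul (Xi (Suc i)) f)" by (intro ext) simp
  then show ?thesis by (simp only: ext_linear_diff_op linear_ext_mult)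
qed

lemma mul_new_mul: "mul \<omega> (new_mul x f) = - new_mul x (mul \<omega> f)"
proof (cases x)
  case (Theta i)
  then show ?thesis by (simp only: new_mul.simps mul_linear_simps mul_anti[of \<omega>] sum_negf)
next
  case (Xi i)
  then show ?thesis by (simp only: new_mul.simps mul_linear_simps mul_anti[of \<omega>] minus_diff_minus)
qed

lemma new_mul_anti: "new_mul x (new_mul y f) = - new_mul y (new_mul x f)"
proof (cases y)
  case (Theta i)
  then show ?thesis by (simp only: new_mul.simps ext_linear_sum[OF linear_new_mul] mul_new_mul sum_negf minus_minus)
next
  case (Xi i)
  then show ?thesis by (simp only: new_mul.simps ext_linear_diff[OF linear_new_mul] mul_new_mul minus_diff_minus minus_minus)
qed

lemma ext_eq_neg: "(f :: ext) = - f \<Longrightarrow> f = 0"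
  by (auto simp: fun_eq_iff)

lemma new_mul_sq: "new_mul x (new_mul x f) = 0"
  by (rule ext_eq_neg) (rule new_mul_anti)

lemma ext_space_new_mul:
  assumes "x \<in> gens (n - 1)" "f \<in> ext_space n"
  shows "new_mul x f \<in> ext_space n"
  using assms
  by (cases x) (auto intro!: ext.subspace_sum[OF ext_space_subspace] ext.subspace_diff[OF ext_space_subspace] ext_space_mul)

definition new_word :: "gen list \<Rightarrow> ext" where
  "new_word xs = foldr new_mul xs (ext_monom {})"

definition new_monom :: "gen set \<Rightarrow> ext" where
  "new_monom S = new_word (sorted_list_of_set S)"

lemma new_word_Cons: "new_word (x # xs) = new_mul x (new_word xs)" by (simp add: new_word_def)

lemma new_word_move_front: "new_word (us @ x # vs) = ext_scale ((-1) ^ length us) (new_word (x # us @ vs))"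
proof (induction us)
  case (Cons y us)
  have "new_word ((y # us) @ x # vs) = ext_scale ((-1) ^ length us) (new_mul y (new_mul x (new_word (us @ vs))))"
    by (simp add: new_word_Cons Cons.IH ext_linear_scale[OF linear_new_mul])
  also have "\<dots> = ext_scale ((-1) ^ length (y # us)) (new_word (x # (y # us) @ vs))"
    by (subst new_mul_anti) (simp add: new_word_Cons)
  finally show ?case .
qed simp

lemma insort_split: "\<exists>us vs. xs = us @ vs \<and> insort x xs = us @ x # vs"
proof (induction xs)
  case (Cons y xs)
  then obtain us vs where "xs = us @ vs" "insort x xs = us @ x # vs" by blast
  then show ?case
    by (cases "x \<le> y") (force intro: exI[of _ "[]"] exI[of _ "y # us"])+
qed simp

lemma new_mul_monom_in:
  assumes "finite S" "x \<in> S"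
  shows "new_mul x (new_monom S) = 0"
proof -
  obtain us vs where "sorted_list_of_set S = us @ x # vs"
    using assms split_list[of x "sorted_list_of_set S"] by auto
  then show ?thesis by (simp add: new_monom_def new_word_move_front new_word_Cons ext_linear_scale[OF linear_new_mul] new_mul_sq)
qed

text \<open>The sign stays anonymous: \<open>s * s = 1\<close> allows it to be moved to the other
  side, which is enough for membership in a subspace.\<close>

lemma new_mul_monom:
  assumes "finite S" "x \<notin> S"
  obtains s where "s * s = 1" "new_mul x (new_monom S) = ext_scale s (new_monom (insert x S))"
proof -
  obtain us vs where *: "sorted_list_of_set S = us @ vs" "insort x (sorted_list_of_set S) = us @ x # vs"
    using insort_split by metis
  have "new_monom (insert x S) = ext_scale ((-1) ^ length us) (new_mul x (new_monom S))"
    using assms * by (simp add: new_monom_def new_word_move_front new_word_Cons)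
  then have "new_mul x (new_monom S) = ext_scale ((-1) ^ length us) (new_monom (insert x S))"
    by (simp add: power_mult_distrib[symmetric])
  then show ?thesis by (intro that[of "(-1) ^ length us"]) (simp_all add: power_mult_distrib[symmetric])
qed

lemma ext_space_new_monom: "S \<subseteq> gens (n - 1) \<Longrightarrow> new_monom S \<in> ext_space n"
proof -
  assume S: "S \<subseteq> gens (n - 1)"
  have "new_word xs \<in> ext_space n" if "set xs \<subseteq> gens (n - 1)" for xs
    using that by (induction xs) (simp_all add: new_word_Cons ext_space_new_mul, simp add: new_word_def ext_space_monom)
  then show ?thesis using S finite_subset[OF S finite_gens] by (simp add: new_monom_def)
qed

section \<open>The quadratic relation between the new generators\<close>

definition pair_op :: "nat \<Rightarrow> ext \<Rightarrow> ext" where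
  "pair_op i f = new_mul (Theta i) (new_mul (Xi i) f)"

text \<open>The boundary term of the summation by parts carries the sum of all
  \<open>\<theta>\<close>. It lies in the ideal, which leaves only the pairs with index up to
  m.\<close>

lemma pair_op_sum: "theta_xi_mul (Suc m) f = (\<Sum>i\<in>{1..m}. pair_op i f) + theta_mul (Suc m) (mul (Xi (Suc m)) f)"
proof (induction m)
  case 0
  show ?case by (simp add: theta_xi_mul_def theta_mul_def)
next
  case (Suc m)
  have "theta_xi_mul (Suc (Suc m)) f = theta_xi_mul (Suc m) f + mul (Theta (Suc (Suc m))) (mul (Xi (Suc (Suc m))) f)"
    by (simp add: theta_xi_mul_def)
  moreover have "pair_op (Suc m) f = theta_mul (Suc m) (mul (Xi (Suc m)) f) - theta_mul (Suc m) (mul (Xi (Suc (Suc m))) f)"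
    by (simp add: pair_op_def theta_mul_def mul_linear_simps sum_subtractf)
  moreover have "theta_mul (Suc (Suc m)) (mul (Xi (Suc (Suc m))) f) = theta_mul (Suc m) (mul (Xi (Suc (Suc m))) f)
      + mul (Theta (Suc (Suc m))) (mul (Xi (Suc (Suc m))) f)"
    by (simp add: theta_mul_def)
  ultimately show ?case using Suc.IH by (simp add: fun_eq_iff)
qed

declare new_mul.simps [simp del]

lemma pair_op_sum_in_sum_ideal:
  assumes "n \<ge> 1" "f \<in> ext_space n"
  shows "(\<Sum>i\<in>{1..n - 1}. pair_op i f) \<in> sum_ideal n"
proof -
  have "(\<Sum>i\<in>{1..n - 1}. pair_op i f) = theta_xi_mul n f - theta_mul n (mul (Xi n) f)"
    using pair_op_sum[of "n - 1" f] assms(1) by simp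
  then show ?thesis using assms by (auto intro!: ext.subspace_diff[OF sum_ideal_subspace] sum_ideal_I ext_space_mul)
qed

lemma pair_op_new_mul: "pair_op i (new_mul x f) = new_mul x (pair_op i f)"
  unfolding pair_op_def by (subst new_mul_anti, subst (2) new_mul_anti) (simp add: ext_linear_neg[OF linear_new_mul])

lemma pair_op_commute: "pair_op i (pair_op j f) = pair_op j (pair_op i f)"
  by (simp only: pair_op_def[of j] pair_op_new_mul)

lemma pair_op_sq: "pair_op i (pair_op i f) = 0"
proof -
  have "new_mul (Xi i) (pair_op i f) = 0"
    unfolding pair_op_new_mul[symmetric] by (simp add: pair_op_def new_mul_sq ext_linear_zero[OF linear_new_mul])
  then show ?thesis by (simp add: pair_op_def[of i "pair_op i f"] ext_linear_zero[OF linear_new_mul])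
qed

lemma comp_fun_commute_pair_op: "comp_fun_commute pair_op"
  by unfold_locales (simp only: fun_eq_iff comp_apply pair_op_commute, simp)

lemma linear_pair_op: "ext_linear (pair_op i)"
  unfolding pair_op_def[abs_def] by (rule ext_linear_comp[OF linear_new_mul linear_new_mul])

lemma ext_space_pair_op: "i \<in> {1..n - 1} \<Longrightarrow> f \<in> ext_space n \<Longrightarrow> pair_op i f \<in> ext_space n"
  unfolding pair_op_def by (intro ext_space_new_mul) auto

definition pairs :: "gen set \<Rightarrow> nat set" where
  "pairs S = {i. Theta i \<in> S \<and> Xi i \<in> S}"

definition free_points :: "nat \<Rightarrow> gen set \<Rightarrow> nat set" where
  "free_points m S = {i \<in> {1..m}. Theta i \<in> S \<longleftrightarrow> Xi i \<in> S}"

definition with_pairs :: "gen set \<Rightarrow> nat set \<Rightarrow> gen set" where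
  "with_pairs H P = H \<union> Theta ` P \<union> Xi ` P"

text \<open>Pair operators commute, so a set of pair positions on top of a fixed part
  \<open>H\<close> defines a vector without a choice of order. In contrast to
  \<open>new_monom (with_pairs H P)\<close>, these vectors satisfy the relations with all
  coefficients equal to 1, as \<open>straightening\<close> requires.\<close>

definition fold_pairs :: "gen set \<Rightarrow> nat set \<Rightarrow> ext" where
  "fold_pairs H P = Finite_Set.fold pair_op (new_monom H) P"

lemma fold_pairs_insert:
  "finite P \<Longrightarrow> i \<notin> P \<Longrightarrow> fold_pairs H (insert i P) = pair_op i (fold_pairs H P)"
proof -
  interpret comp_fun_commute pair_op by (rule comp_fun_commute_pair_op)
  assume "finite P" "i \<notin> P"
  then show ?thesis unfolding fold_pairs_def by simp
qed

lemma fold_pairs_monom: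
  assumes "finite H" "finite P" "P \<inter> {i. Theta i \<in> H \<or> Xi i \<in> H} = {}"
  shows "\<exists>s. s * s = 1 \<and> fold_pairs H P = ext_scale s (new_monom (with_pairs H P))"
  using assms(2,3)
proof (induction P rule: finite_induct)
  case empty
  then show ?case by (intro exI[of _ 1]) (simp add: fold_pairs_def with_pairs_def)
next
  case (insert i P)
  then obtain s where s: "s * s = 1" "fold_pairs H P = ext_scale s (new_monom (with_pairs H P))" by auto
  let ?S = "with_pairs H P"
  have fin: "finite ?S" using assms(1) insert.hyps by (simp add: with_pairs_def)
  have "Xi i \<notin> ?S" "Theta i \<notin> insert (Xi i) ?S" using insert by (auto simp: with_pairs_def)
  then obtain t u where t: "t * t = 1" "new_mul (Xi i) (new_monom ?S) = ext_scale t (new_monom (insert (Xi i) ?S))"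
    and u: "u * u = 1" "new_mul (Theta i) (new_monom (insert (Xi i) ?S)) = ext_scale u (new_monom (insert (Theta i) (insert (Xi i) ?S)))"
    using new_mul_monom[OF fin, of "Xi i"] new_mul_monom[of "insert (Xi i) ?S" "Theta i"] fin by (metis finite_insert)
  have "fold_pairs H (insert i P) = ext_scale (s * t * u) (new_monom (insert (Theta i) (insert (Xi i) ?S)))"
    using insert.hyps by (simp add: fold_pairs_insert s(2) pair_op_def ext_linear_scale[OF linear_new_mul] t(2) u(2))
  moreover have "insert (Theta i) (insert (Xi i) ?S) = with_pairs H (insert i P)"
    by (auto simp: with_pairs_def)
  moreover have "(s * t * u) * (s * t * u) = 1"
  proof -
    have "(s * t * u) * (s * t * u) = (s * s) * (t * t) * (u * u)" by (simp only: mult_ac)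
    then show ?thesis using s(1) t(1) u(1) by simp
  qed
  ultimately show ?case by metis
qed

lemma pair_op_monom_zero:
  assumes "finite H" "Theta i \<in> H \<or> Xi i \<in> H"
  shows "pair_op i (new_monom H) = 0"
  using assms(2)
proof
  assume "Theta i \<in> H"
  then have "pair_op i (new_monom H) = - new_mul (Xi i) (new_mul (Theta i) (new_monom H))" unfolding pair_op_def by (subst new_mul_anti) simp
  then show ?thesis using \<open>Theta i \<in> H\<close> assms(1) by (simp add: new_mul_monom_in ext_linear_zero[OF linear_new_mul])
qed (simp add: pair_op_def new_mul_monom_in assms(1) ext_linear_zero[OF linear_new_mul])

lemma pair_op_fold_zero:
  assumes "finite H" "finite P" "i \<in> P \<or> Theta i \<in> H \<or> Xi i \<in> H"
  shows "pair_op i (fold_pairs H P) = 0"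
  using assms(2,3)
proof (induction P rule: finite_induct)
  case empty
  then show ?case using pair_op_monom_zero assms(1) by (simp add: fold_pairs_def)
next
  case (insert j P)
  show ?case
  proof (cases "i = j")
    case True
    then show ?thesis using insert.hyps by (simp add: fold_pairs_insert pair_op_sq)
  next
    case False
    then have "pair_op i (fold_pairs H P) = 0" using insert by auto
    then show ?thesis
      using insert.hyps by (simp add: fold_pairs_insert pair_op_commute[of i] ext_linear_zero[OF linear_pair_op])
  qed
qed

text \<open>The quadratic relation is applied to \<open>fold_pairs H P\<close>. Terms with an index
  in \<open>P\<close> or touched by \<open>H\<close> vanish by a repeated generator; each of the
  others inserts one new pair.\<close>

lemma fold_pairs_relation:
  assumes n: "n \<ge> 1" and H: "H \<subseteq> gens (n - 1)" "pairs H = {}" and P: "P \<subseteq> free_points (n - 1) H"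
  shows "(\<Sum>i\<in>free_points (n - 1) H - P. fold_pairs H (insert i P)) \<in> sum_ideal n"
proof -
  let ?\<Omega> = "free_points (n - 1) H"
  have fin: "finite H" "finite P" "finite ?\<Omega>"
    using finite_subset[OF H(1) finite_gens] finite_subset[OF P] by (auto simp: free_points_def)
  have nH: "Theta i \<notin> H \<and> Xi i \<notin> H \<longleftrightarrow> i \<in> ?\<Omega>" if "i \<in> {1..n - 1}" for i
    using that H(2) by (auto simp: free_points_def pairs_def)
  have incl: "P \<subseteq> {1..n - 1}" using P by (auto simp: free_points_def)
  have ext_space: "fold_pairs H P \<in> ext_space n"
    using fin(2) incl
  proof (induction P rule: finite_induct)
    case empty
    show ?case using ext_space_new_monom[OF H(1)] by (simp add: fold_pairs_def)
  next
    case (insert i P)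
    then show ?case by (simp add: fold_pairs_insert ext_space_pair_op)
  qed
  have "(\<Sum>i\<in>?\<Omega> - P. fold_pairs H (insert i P)) = (\<Sum>i\<in>?\<Omega> - P. pair_op i (fold_pairs H P))"
    using fin by (intro sum.cong refl fold_pairs_insert) auto
  also have "\<dots> = (\<Sum>i\<in>{1..n - 1}. pair_op i (fold_pairs H P))"
  proof (rule sum.mono_neutral_left)
    show "\<forall>i\<in>{1..n - 1} - (?\<Omega> - P). pair_op i (fold_pairs H P) = 0"
      using pair_op_fold_zero[OF fin(1,2)] nH by blast
  qed (auto simp: free_points_def)
  also have "\<dots> \<in> sum_ideal n" by (rule pair_op_sum_in_sum_ideal[OF n ext_space])
  finally show ?thesis .
qed

text \<open>At the point \<open>i\<close> a pair \<open>\<theta>\<^sub>i, \<xi>\<^sub>i \<in> S\<close> is a down step and a missing pair an up step of a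
  Motzkin path; all other points are level steps.\<close>

definition ballot :: "nat \<Rightarrow> gen set \<Rightarrow> bool" where
  "ballot m S \<longleftrightarrow> balanced (free_points m S) (pairs S)"

definition bidegree :: "gen set \<Rightarrow> nat \<times> nat" where
  "bidegree S = (card (S \<inter> range Theta), card (S \<inter> range Xi))"

text \<open>Only the pairs move. The letters \<open>H\<close> at half-filled points stay fixed, and
  the bidegree depends on \<open>H\<close> and the number of pairs alone, so the rewriting never
  leaves a bidegree.\<close>

lemma new_monom_straighten:
  assumes n: "n \<ge> 1" and S: "S \<subseteq> gens (n - 1)" and V: "ext.subspace V" "sum_ideal n \<subseteq> V"
    and bal: "\<And>T. T \<subseteq> gens (n - 1) \<Longrightarrow> ballot (n - 1) T \<Longrightarrow> bidegree T = bidegree S \<Longrightarrow> new_monom T \<in> V"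
  shows "new_monom S \<in> V"
proof -
  define H where "H = S - Theta ` pairs S - Xi ` pairs S"
  let ?\<Omega> = "free_points (n - 1) H"
  have H: "H \<subseteq> gens (n - 1)" "pairs H = {}" using S by (auto simp: H_def pairs_def)
  have \<Omega>: "?\<Omega> = {i \<in> {1..n - 1}. Theta i \<notin> H \<and> Xi i \<notin> H}"
    using H(2) by (auto simp: free_points_def pairs_def)
  have finH: "finite H" using finite_subset[OF H(1) finite_gens] .
  have fin: "finite ?\<Omega>" by (simp add: free_points_def)
  have P: "pairs S \<subseteq> ?\<Omega>" using S unfolding \<Omega> by (auto simp: pairs_def H_def)
  have bideg: "bidegree (with_pairs H Q) = (card (H \<inter> range Theta) + card Q, card (H \<inter> range Xi) + card Q)"
    and wp: "with_pairs H Q \<subseteq> gens (n - 1)" "pairs (with_pairs H Q) = Q" "free_points (n - 1) (with_pairs H Q) = ?\<Omega>"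
    if Q: "Q \<subseteq> ?\<Omega>" for Q
  proof -
    have finQ: "finite Q" using Q fin finite_subset by blast
    have QH: "Theta i \<notin> H" "Xi i \<notin> H" "i \<in> {1..n - 1}" if "i \<in> Q" for i
      using Q that unfolding \<Omega> by blast+
    have "with_pairs H Q \<inter> range Theta = (H \<inter> range Theta) \<union> Theta ` Q"
      "with_pairs H Q \<inter> range Xi = (H \<inter> range Xi) \<union> Xi ` Q" by (auto simp: with_pairs_def)
    moreover have "card (Theta ` Q) = card Q" "card (Xi ` Q) = card Q"
      by (simp_all add: card_image inj_on_def)
    moreover have "card ((H \<inter> range Theta) \<union> Theta ` Q) = card (H \<inter> range Theta) + card (Theta ` Q)"
      by (rule card_Un_disjoint) (use QH finH finQ in auto)
    moreover have "card ((H \<inter> range Xi) \<union> Xi ` Q) = card (H \<inter> range Xi) + card (Xi ` Q)"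
      by (rule card_Un_disjoint) (use QH finH finQ in auto)
    ultimately show "bidegree (with_pairs H Q) = (card (H \<inter> range Theta) + card Q, card (H \<inter> range Xi) + card Q)"
      by (simp add: bidegree_def)
    show "with_pairs H Q \<subseteq> gens (n - 1)" using QH(3) H(1) by (auto simp: with_pairs_def)
    show "pairs (with_pairs H Q) = Q" using QH H(2) by (auto simp: with_pairs_def pairs_def)
    show "free_points (n - 1) (with_pairs H Q) = ?\<Omega>"
      using Q by (auto simp: with_pairs_def free_points_def)
  qed
  have SP: "with_pairs H (pairs S) = S" by (auto simp: with_pairs_def H_def pairs_def)
  have sgn: "\<exists>s. s * s = 1 \<and> fold_pairs H Q = ext_scale s (new_monom (with_pairs H Q))" if "Q \<subseteq> ?\<Omega>" for Q
    by (rule fold_pairs_monom[OF finH finite_subset[OF that fin]]) (use that in \<open>unfold \<Omega>, blast\<close>)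
  have "fold_pairs H (pairs S) \<in> V"
  proof (rule straightening[OF V(1) fin _ _ P refl])
    fix Q assume "Q \<subseteq> ?\<Omega>"
    then show "(\<Sum>i\<in>?\<Omega> - Q. fold_pairs H (insert i Q)) \<in> V"
      using fold_pairs_relation[OF n H] V(2) by blast
  next
    fix Q assume Q: "Q \<subseteq> ?\<Omega>" "card Q = card (pairs S)" "balanced ?\<Omega> Q"
    have "new_monom (with_pairs H Q) \<in> V"
    proof (rule bal)
      show "ballot (n - 1) (with_pairs H Q)" unfolding ballot_def wp(2,3)[OF Q(1)] by (rule Q(3))
      show "bidegree (with_pairs H Q) = bidegree S"
        using bideg[OF Q(1)] bideg[OF P] Q(2) SP by simp
    qed (rule wp[OF Q(1)])
    then show "fold_pairs H Q \<in> V" using sgn[OF Q(1)] ext.subspace_scale[OF V(1)] by metis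
  qed
  moreover obtain s where "s * s = 1" "fold_pairs H (pairs S) = ext_scale s (new_monom S)" using sgn[OF P] SP by metis
  ultimately show ?thesis using ext.subspace_scale[OF V(1), of "ext_scale s (new_monom S)" s] by simp
qed

section \<open>Spanning sets\<close>

lemma bidegree_insert:
  assumes "finite S" "x \<notin> S"
  shows "bidegree (insert x S) = (case x of
      Theta i \<Rightarrow> (Suc (fst (bidegree S)), snd (bidegree S))
    | Xi i \<Rightarrow> (fst (bidegree S), Suc (snd (bidegree S))))"
proof (cases x)
  case (Theta i)
  then have "insert x S \<inter> range Theta = insert x (S \<inter> range Theta)" "insert x S \<inter> range Xi = S \<inter> range Xi"
    by auto
  then show ?thesis using assms Theta by (simp add: bidegree_def)
next
  case (Xi i)
  then have "insert x S \<inter> range Xi = insert x (S \<inter> range Xi)" "insert x S \<inter> range Theta = S \<inter> range Theta"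
    by auto
  then show ?thesis using assms Xi by (simp add: bidegree_def)
qed

text \<open>The whole ideal is included rather than its part of bidegree d, so the space describes a
  component of the quotient independently of how the ideal is graded.\<close>

definition bidegree_span :: "nat \<Rightarrow> nat \<times> nat \<Rightarrow> ext set" where
  "bidegree_span n d = ext.span ({new_monom S | S. S \<subseteq> gens (n - 1) \<and> bidegree S = d} \<union> sum_ideal n)"

lemma bidegree_span_subspace: "ext.subspace (bidegree_span n d)"
  unfolding bidegree_span_def by (rule ext.subspace_span)

lemma sum_ideal_bidegree_span: "sum_ideal n \<subseteq> bidegree_span n d"
  unfolding bidegree_span_def using ext.span_superset by blast

lemma new_monom_bidegree_span: "S \<subseteq> gens (n - 1) \<Longrightarrow> new_monom S \<in> bidegree_span n (bidegree S)"
  unfolding bidegree_span_def by (rule ext.span_base) blast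

lemma bidegree_span_subset: "bidegree_span n d \<subseteq> ext_space n"
  unfolding bidegree_span_def using ext_space_new_monom sum_ideal_subset by (intro ext.span_minimal ext_space_subspace) auto

lemma ext_linear_preimage: "ext_linear L \<Longrightarrow> ext.subspace V \<Longrightarrow> ext.subspace {f. L f \<in> V}"
  by (rule ext.subspaceI)
    (auto simp: ext_linear_zero[of L] ext_linear_add[of L] ext_linear_scale[of L] ext.subspace_0 ext.subspace_add ext.subspace_scale)

lemma new_mul_sum_ideal:
  assumes "x \<in> gens (n - 1)" "f \<in> sum_ideal n"
  shows "new_mul x f \<in> sum_ideal n"
  using assms by (cases x)
    (auto simp: new_mul.simps intro!: ext.subspace_sum[OF sum_ideal_subspace] ext.subspace_diff[OF sum_ideal_subspace] sum_ideal_mul)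

definition shift :: "gen \<Rightarrow> nat \<times> nat \<Rightarrow> nat \<times> nat" where
  "shift x d = (case x of Theta i \<Rightarrow> (Suc (fst d), snd d) | Xi i \<Rightarrow> (fst d, Suc (snd d)))"

lemma new_mul_bidegree_span:
  assumes x: "x \<in> gens (n - 1)" and f: "f \<in> bidegree_span n d"
  shows "new_mul x f \<in> bidegree_span n (shift x d)"
proof -
  have "{new_monom S | S. S \<subseteq> gens (n - 1) \<and> bidegree S = d} \<union> sum_ideal n \<subseteq> {f. new_mul x f \<in> bidegree_span n (shift x d)}"
  proof
    fix g assume "g \<in> {new_monom S | S. S \<subseteq> gens (n - 1) \<and> bidegree S = d} \<union> sum_ideal n"
    then show "g \<in> {f. new_mul x f \<in> bidegree_span n (shift x d)}"
    proof
      assume "g \<in> {new_monom S | S. S \<subseteq> gens (n - 1) \<and> bidegree S = d}"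
      then obtain S where S: "g = new_monom S" "S \<subseteq> gens (n - 1)" "bidegree S = d" by blast
      have fin: "finite S" using finite_subset[OF S(2) finite_gens] .
      show ?thesis
      proof (cases "x \<in> S")
        case True
        then show ?thesis using S fin ext.subspace_0[OF bidegree_span_subspace] by (simp add: new_mul_monom_in)
      next
        case False
        obtain s where s: "new_mul x (new_monom S) = ext_scale s (new_monom (insert x S))" using new_mul_monom[OF fin False] by metis
        have "bidegree (insert x S) = shift x d" unfolding bidegree_insert[OF fin False] S(3) shift_def ..
        then have "new_monom (insert x S) \<in> bidegree_span n (shift x d)" using new_monom_bidegree_span[of "insert x S" n] x S(2) by simp
        then show ?thesis using s S(1) ext.subspace_scale[OF bidegree_span_subspace] by simp
      qed
    next
      assume "g \<in> sum_ideal n"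
      then show ?thesis using new_mul_sum_ideal[OF x] sum_ideal_bidegree_span by blast
    qed
  qed
  then have "bidegree_span n d \<subseteq> {f. new_mul x f \<in> bidegree_span n (shift x d)}"
    unfolding bidegree_span_def[of n d] by (intro ext.span_minimal ext_linear_preimage linear_new_mul bidegree_span_subspace)
  then show ?thesis using f by blast
qed

text \<open>Modulo the ideal every original generator is a combination of new ones, so
  \<open>new_mul_bidegree_span\<close> carries over to multiplication by original
  generators.\<close>

lemma mul_bidegree_span:
  assumes x: "x \<in> gens n" and f: "f \<in> bidegree_span n d"
  shows "mul x f \<in> bidegree_span n (shift x d)"
proof (cases x)
  case (Theta i)
  then have i: "i \<in> {1..n}" using x by simp
  let ?V = "bidegree_span n (shift x d)"
  \<comment> \<open>\<open>\<theta>\<^sub>i\<close> is a difference of consecutive partial sums. The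
    two that are not new generators are harmless: the empty one is 0 and the n-th lies in the
    ideal.\<close>
  define T where "T i = (\<Sum>j\<in>{1..i}. mul (Theta j) f)" for i
  have T: "T j \<in> ?V" if "j \<le> n" for j
  proof -
    have "j = 0 \<or> j \<in> {1..n - 1} \<or> j = n" using that by auto
    then consider "j = 0" | "j \<in> {1..n - 1}" | "j = n" by blast
    then show ?thesis
    proof cases
      case 1
      then show ?thesis by (simp add: T_def ext.subspace_0[OF bidegree_span_subspace])
    next
      case 2
      then have "new_mul (Theta j) f \<in> bidegree_span n (shift (Theta j) d)" using f by (intro new_mul_bidegree_span) auto
      then show ?thesis by (simp add: T_def new_mul.simps Theta shift_def)
    next
      case 3
      have "theta_mul n f \<in> ?V" using sum_ideal_I(1)[of f n] f bidegree_span_subset sum_ideal_bidegree_span by blast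
      then show ?thesis unfolding T_def theta_mul_def 3 .
    qed
  qed
  obtain k where k: "i = Suc k" using i by (cases i) auto
  have "T i = T k + mul x f" unfolding T_def k Theta by simp
  then have "mul x f = T i - T k" by simp
  then show ?thesis using T[of i] T[of k] i k ext.subspace_diff[OF bidegree_span_subspace] by simp
next
  case (Xi i)
  then have i: "i \<in> {1..n}" using x by simp
  let ?V = "bidegree_span n (shift x d)"
  let ?v = "\<lambda>i. mul (Xi i) f"
  have step: "?v j - ?v (Suc j) \<in> ?V" if "j \<in> {1..n - 1}" for j
    using new_mul_bidegree_span[OF _ f, of "Xi j"] that by (simp add: new_mul.simps shift_def Xi)
  have diff: "?v 1 - ?v j \<in> ?V" if "1 \<le> j" "j \<le> n" for j
    using that
  proof (induction j rule: dec_induct)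
    case base
    show ?case unfolding diff_self by (rule ext.subspace_0[OF bidegree_span_subspace])
  next
    case (step k)
    then have "?v k - ?v (Suc k) \<in> ?V" by (intro \<open>\<And>j. j \<in> {1..n - 1} \<Longrightarrow> ?v j - ?v (Suc j) \<in> ?V\<close>) auto
    moreover have "?v 1 - ?v k \<in> ?V" by (rule step.IH) (use step.prems step.hyps in linarith)+
    ultimately have "(?v 1 - ?v k) + (?v k - ?v (Suc k)) \<in> ?V" by (intro ext.subspace_add[OF bidegree_span_subspace])
    moreover have "(?v 1 - ?v k) + (?v k - ?v (Suc k)) = ?v 1 - ?v (Suc k)" by (simp add: fun_eq_iff)
    ultimately show ?case by (simp only:)
  qed
  \<comment> \<open>Differences of \<open>\<xi>\<close> are sums of new generators. Adding all
    \<open>\<xi>\<^sub>1 - \<xi>\<^sub>j\<close> to the full sum of \<open>\<xi>\<close> isolates n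
    times \<open>\<xi>\<^sub>1\<close>.\<close>
  have "(\<Sum>j\<in>{1..n}. ?v 1 - ?v j) \<in> ?V" by (intro ext.subspace_sum[OF bidegree_span_subspace] diff) auto
  moreover have "xi_mul n f \<in> ?V" using sum_ideal_I(2)[of f n] f bidegree_span_subset sum_ideal_bidegree_span by blast
  ultimately have "(\<Sum>j\<in>{1..n}. ?v 1 - ?v j) + xi_mul n f \<in> ?V" by (rule ext.subspace_add[OF bidegree_span_subspace])
  moreover have "(\<Sum>j\<in>{1..n}. ?v 1 - ?v j) + xi_mul n f = ext_scale (of_nat n) (?v 1)"
    unfolding xi_mul_def sum_subtractf by (simp add: fun_eq_iff sum_fun_apply ext_scale_def)
  ultimately have "ext_scale (of_nat n) (?v 1) \<in> ?V" by (simp only:)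
  then have "ext_scale (inverse (of_nat n)) (ext_scale (of_nat n) (?v 1)) \<in> ?V"
    by (rule ext.subspace_scale[OF bidegree_span_subspace])
  then have "?v 1 \<in> ?V" using i by simp
  moreover have "?v 1 - ?v i \<in> ?V" by (rule diff) (use i in auto)
  ultimately have "?v 1 - (?v 1 - ?v i) \<in> ?V" by (rule ext.subspace_diff[OF bidegree_span_subspace])
  moreover have "?v 1 - (?v 1 - ?v i) = mul x f" by (simp add: Xi fun_eq_iff)
  ultimately show ?thesis by (simp only:)
qed

lemma gprod_bidegree_span:
  "set xs \<subseteq> gens n \<Longrightarrow> distinct xs \<Longrightarrow> gprod xs \<in> bidegree_span n (bidegree (set xs))"
proof (induction xs)
  case Nil
  then show ?case using new_monom_bidegree_span[of "{}" n] by (simp add: new_monom_def new_word_def gprod_def)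
next
  case (Cons x xs)
  then have "mul x (gprod xs) \<in> bidegree_span n (shift x (bidegree (set xs)))" by (intro mul_bidegree_span) auto
  moreover have "shift x (bidegree (set xs)) = bidegree (set (x # xs))"
    using Cons.prems by (simp add: bidegree_insert shift_def)
  ultimately show ?case by (simp add: gprod_Cons)
qed

section \<open>Bihomogeneous elements and ballot monomials\<close>

lemma bihomogeneous_iff:
  "f \<in> bihomogeneous n a b \<longleftrightarrow> f \<in> ext_space n \<and> (\<forall>S. f S \<noteq> 0 \<longrightarrow> bidegree S = (a, b))"
  by (simp add: bihomogeneous_def bidegree_def)

lemma bihomogeneous_subspace: "ext.subspace (bihomogeneous n a b)"
proof (rule ext.subspaceI)
  show "0 \<in> bihomogeneous n a b" by (simp add: bihomogeneous_iff ext_space_zero)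
next
  fix f g assume fg: "f \<in> bihomogeneous n a b" "g \<in> bihomogeneous n a b"
  have "f S \<noteq> 0 \<or> g S \<noteq> 0" if "(f + g) S \<noteq> 0" for S using that by auto
  with fg show "f + g \<in> bihomogeneous n a b"
    unfolding bihomogeneous_iff using ext.subspace_add[OF ext_space_subspace] by blast
next
  fix c f assume f: "f \<in> bihomogeneous n a b"
  have "f S \<noteq> 0" if "ext_scale c f S \<noteq> 0" for S using that by (auto simp: ext_scale_def)
  with f show "ext_scale c f \<in> bihomogeneous n a b"
    unfolding bihomogeneous_iff using ext.subspace_scale[OF ext_space_subspace] by blast
qed

lemma bihomogeneous_bidegree_span: "bihomogeneous n a b \<subseteq> bidegree_span n (a, b)"
proof
  fix f assume "f \<in> bihomogeneous n a b"
  then have f: "f \<in> ext_space n" "\<And>S. f S \<noteq> 0 \<Longrightarrow> bidegree S = (a, b)" by (auto simp: bihomogeneous_iff)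
  have "ext_scale (f S) (ext_monom S) \<in> bidegree_span n (a, b)" if "S \<in> Pow (gens n)" for S
  proof (cases "f S = 0")
    case True
    then show ?thesis using ext.subspace_0[OF bidegree_span_subspace] by simp
  next
    case False
    have fin: "finite S" using that finite_subset[OF _ finite_gens] by auto
    have "ext_monom S \<in> bidegree_span n (a, b)"
      using gprod_bidegree_span[of "sorted_list_of_set S" n] that fin f(2)[OF False]
      by (simp add: gprod_sorted_list_of_set)
    then show ?thesis by (rule ext.subspace_scale[OF bidegree_span_subspace])
  qed
  then have "(\<Sum>S\<in>Pow (gens n). ext_scale (f S) (ext_monom S)) \<in> bidegree_span n (a, b)"
    by (rule ext.subspace_sum[OF bidegree_span_subspace])
  then show "f \<in> bidegree_span n (a, b)" using ext_space_expand[OF f(1)] by simp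
qed

definition ballot_sets :: "nat \<Rightarrow> nat \<times> nat \<Rightarrow> gen set set" where
  "ballot_sets n d = {S. S \<subseteq> gens (n - 1) \<and> ballot (n - 1) S \<and> bidegree S = d}"

lemma finite_ballot_sets: "finite (ballot_sets n d)"
  by (rule finite_subset[of _ "Pow (gens (n - 1))"]) (auto simp: ballot_sets_def finite_gens)

lemma bidegree_span_ballot: "n \<ge> 1 \<Longrightarrow> bidegree_span n d \<subseteq> ext.span (new_monom ` ballot_sets n d \<union> sum_ideal n)"
proof -
  assume n: "n \<ge> 1"
  let ?V = "ext.span (new_monom ` ballot_sets n d \<union> sum_ideal n)"
  have JV: "sum_ideal n \<subseteq> ?V" using ext.span_superset by blast
  have "new_monom S \<in> ?V" if S: "S \<subseteq> gens (n - 1)" "bidegree S = d" for S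
  proof (rule new_monom_straighten[OF n S(1) ext.subspace_span JV])
    fix T assume "T \<subseteq> gens (n - 1)" "ballot (n - 1) T" "bidegree T = bidegree S"
    then have "T \<in> ballot_sets n d" using S by (simp add: ballot_sets_def)
    then show "new_monom T \<in> ?V" by (intro ext.span_base) blast
  qed
  then show ?thesis unfolding bidegree_span_def using JV by (intro ext.span_minimal ext.subspace_span) auto
qed

lemma mul_bihomogeneous:
  assumes "x \<in> gens n" "f \<in> bihomogeneous n a b" "shift x (a, b) = (a', b')"
  shows "mul x f \<in> bihomogeneous n a' b'"
  unfolding bihomogeneous_iff
proof (intro conjI allI impI)
  show "mul x f \<in> ext_space n" using assms by (auto simp: bihomogeneous_iff ext_space_mul)
  fix U assume "mul x f U \<noteq> 0"
  then have U: "finite U" "x \<in> U" "f (U - {x}) \<noteq> 0" by (auto simp: ext_mult_gen split: if_splits)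
  have "bidegree (insert x (U - {x})) = shift x (bidegree (U - {x}))"
    using bidegree_insert[of "U - {x}" x] U(1) by (simp add: shift_def)
  moreover have "bidegree (U - {x}) = (a, b)" using assms(2) U(3) by (simp add: bihomogeneous_iff)
  ultimately show "bidegree U = (a', b')" using U(2) assms(3) by (simp add: insert_absorb)
qed

lemma new_mul_bihomogeneous:
  assumes "x \<in> gens (n - 1)" "f \<in> bihomogeneous n a b" "shift x (a, b) = (a', b')"
  shows "new_mul x f \<in> bihomogeneous n a' b'"
proof (cases x)
  case (Theta i)
  have "mul (Theta j) f \<in> bihomogeneous n a' b'" if "j \<in> {1..i}" for j
    by (rule mul_bihomogeneous[OF _ assms(2)]) (use that assms Theta in \<open>auto simp: shift_def\<close>)
  then show ?thesis unfolding Theta new_mul.simps by (rule ext.subspace_sum[OF bihomogeneous_subspace])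
next
  case (Xi i)
  have "mul (Xi j) f \<in> bihomogeneous n a' b'" if "j \<in> {i, Suc i}" for j
    by (rule mul_bihomogeneous[OF _ assms(2)]) (use that assms Xi in \<open>auto simp: shift_def\<close>)
  then show ?thesis by (simp add: Xi new_mul.simps ext.subspace_diff[OF bihomogeneous_subspace])
qed

lemma new_word_bihomogeneous:
  "set xs \<subseteq> gens (n - 1) \<Longrightarrow> distinct xs \<Longrightarrow>
    new_word xs \<in> bihomogeneous n (fst (bidegree (set xs))) (snd (bidegree (set xs)))"
proof (induction xs)
  case Nil
  then show ?case by (auto simp: new_word_def bihomogeneous_iff ext_space_monom bidegree_def) (simp add: ext_monom_def split: if_splits)+
next
  case (Cons x xs)
  show ?case unfolding new_word_Cons
    by (rule new_mul_bihomogeneous[OF _ Cons.IH])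
      (use Cons.prems in \<open>auto simp: shift_def bidegree_insert split: gen.splits\<close>)
qed

lemma new_monom_bihomogeneous: "S \<in> ballot_sets n (a, b) \<Longrightarrow> new_monom S \<in> bihomogeneous n a b"
  using new_word_bihomogeneous[of "sorted_list_of_set S" n] finite_subset[OF _ finite_gens, of S "n - 1"]
  by (auto simp: ballot_sets_def new_monom_def)

text \<open>Position i stands for the gap between i and i + 1. Only n - 1 positions occur because 1
  is always a block minimum and n always a block maximum, so neither has to be recorded.\<close>

definition path_of :: "nat \<Rightarrow> nat set set \<Rightarrow> gen set" where
  "path_of n \<pi> = Theta ` {i \<in> {1..n - 1}. Suc i \<notin> Min ` \<pi>} \<union> Xi ` {i \<in> {1..n - 1}. i \<in> Max ` \<pi>}"

lemma card_NC_Min: "\<pi> \<in> NC n \<Longrightarrow> card (Min ` \<pi>) = card \<pi>"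
  using partition_blocks(5)[OF NC_partition] by (simp add: card_image)

text \<open>\<open>N\<close> and \<open>X\<close>, read off from \<open>S\<close>, are the
  non-minima and non-maxima of the partition wanted; by the bidegree both have n - k elements. The
  counting condition of \<open>NC_exists\<close> then amounts to the ballot condition.\<close>

lemma ballot_set_path:
  assumes n: "1 \<le> k" "k \<le> n" and S: "S \<in> ballot_sets n (n - k, k - 1)"
  shows "\<exists>\<pi>\<in>NC_blocks n k. S = path_of n \<pi>"
proof -
  let ?m = "n - 1"
  have Sg: "S \<subseteq> gens ?m" and bal: "balanced (free_points ?m S) (pairs S)"
    and deg: "card (S \<inter> range Theta) = n - k" "card (S \<inter> range Xi) = k - 1"
    using S by (auto simp: ballot_sets_def ballot_def bidegree_def)
  define A where "A = {i. Theta i \<in> S}"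
  define X where "X = {i \<in> {1..?m}. Xi i \<notin> S}"
  define N where "N = Suc ` A"
  have A: "A \<subseteq> {1..?m}" using Sg by (auto simp: A_def)
  have finA: "finite A" using A finite_subset by blast
  have "S \<inter> range Theta = Theta ` A" by (auto simp: A_def)
  then have cA: "card A = n - k" using deg(1) by (simp add: card_image inj_on_def)
  have SX: "S \<inter> range Xi = Xi ` ({1..?m} - X)" using Sg by (auto simp: X_def)
  then have "card ({1..?m} - X) = k - 1" using deg(2) by (simp add: card_image inj_on_def)
  moreover have XS: "X \<subseteq> {1..?m}" by (auto simp: X_def)
  then have "card ({1..?m} - X) = ?m - card X" "card X \<le> ?m"
    using card_Diff_subset[of X "{1..?m}"] card_mono[of "{1..?m}" X] finite_subset[OF XS] by simp_all
  ultimately have cX: "card X = n - k" using n by linarith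
  have "\<exists>\<pi>\<in>NC n. Min ` \<pi> = {1..n} - N \<and> Max ` \<pi> = {1..n} - X"
  proof (rule NC_exists)
    show "N \<subseteq> {1..n}" using subsetD[OF A] by (fastforce simp: N_def)
    show "X \<subseteq> {1..n}" by (auto simp: X_def)
    show "card N = card X" unfolding cX N_def using cA by (simp add: card_image)
    fix c
    show "card {x \<in> N. x \<le> c} \<le> card {x \<in> X. x < c}"
    proof (cases c)
      case 0
      then have "{x \<in> N. x \<le> c} = {}" by (auto simp: N_def)
      then show ?thesis by (metis card.empty le0)
    next
      case (Suc j)
      have "{x \<in> N. x \<le> c} = Suc ` {i \<in> A. i \<le> j}" by (auto simp: N_def Suc)
      then have 1: "card {x \<in> N. x \<le> c} = card {i \<in> A. i \<le> j}" by (simp add: card_image)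
      \<comment> \<open>With \<open>c = Suc j\<close> the shift in \<open>N\<close> makes both
        counts run up to j. Points that carry \<open>\<theta>\<close> alone occur on both sides and
        cancel; what remains compares pairs with empty points.\<close>
      let ?t = "{i \<in> A. Xi i \<notin> S \<and> i \<le> j}"
      have fin: "finite ?t" "finite (pairs S)" "finite (free_points ?m S)"
        using finA finite_subset[of "pairs S" A] by (auto simp: A_def pairs_def free_points_def)
      have "{i \<in> A. i \<le> j} = {i \<in> pairs S. i \<le> j} \<union> ?t" by (auto simp: pairs_def A_def)
      then have 2: "card {i \<in> A. i \<le> j} = card {i \<in> pairs S. i \<le> j} + card ?t"
        using fin by (simp only:) (rule card_Un_disjoint, auto simp: pairs_def)
      have "{x \<in> X. x < c} = {i \<in> free_points ?m S - pairs S. i \<le> j} \<union> ?t"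
        using A by (auto simp: X_def Suc free_points_def pairs_def A_def)
      then have 3: "card {x \<in> X. x < c} = card {i \<in> free_points ?m S - pairs S. i \<le> j} + card ?t"
        using fin by (simp only:) (rule card_Un_disjoint, auto simp: free_points_def pairs_def A_def)
      show ?thesis unfolding 1 2 3 using bal by (simp add: balanced_def)
    qed
  qed
  then obtain \<pi> where \<pi>: "\<pi> \<in> NC n" "Min ` \<pi> = {1..n} - N" "Max ` \<pi> = {1..n} - X" by blast
  have "card N = n - k" "N \<subseteq> {1..n}" using cA subsetD[OF A] by (fastforce simp: N_def card_image)+
  then have "card \<pi> = k"
    using card_NC_Min[OF \<pi>(1)] card_Diff_subset[of N "{1..n}"] finite_subset[of N "{1..n}"] n
    unfolding \<pi>(2) by simp
  moreover have "x \<in> S \<longleftrightarrow> x \<in> path_of n \<pi>" for x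
  proof (cases x)
    case (Theta i)
    have "i \<in> {1..?m} \<Longrightarrow> Suc i \<in> {1..n}" by auto
    then show ?thesis unfolding path_of_def \<pi>(2,3) using A by (auto simp: Theta N_def A_def)
  next
    case (Xi i)
    have "i \<in> {1..?m} \<Longrightarrow> i \<in> {1..n}" by auto
    moreover have "Xi i \<in> S \<Longrightarrow> i \<in> {1..?m}" using Sg by auto
    ultimately show ?thesis unfolding path_of_def \<pi>(2,3) by (auto simp: Xi X_def)
  qed
  ultimately show ?thesis using \<pi>(1) unfolding NC_blocks_def by blast
qed

text \<open>Every ballot set is the path of a noncrossing partition, which gives the upper bound for
  the dimension; the lower bound is the independence of the \<open>f_part\<close> vectors.\<close>

lemma card_ballot_sets:
  assumes "1 \<le> k" "k \<le> n"
  shows "card (ballot_sets n (n - k, k - 1)) \<le> card (NC_blocks n k)"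
proof -
  have fin: "finite (NC_blocks n k)" using finite_NC by (simp add: NC_blocks_def)
  have "ballot_sets n (n - k, k - 1) \<subseteq> path_of n ` NC_blocks n k" using ballot_set_path[OF assms] by blast
  then have "card (ballot_sets n (n - k, k - 1)) \<le> card (path_of n ` NC_blocks n k)"
    using fin by (intro card_mono) auto
  also have "\<dots> \<le> card (NC_blocks n k)" using fin by (rule card_image_le)
  finally show ?thesis .
qed

lemma card_transversal:
  assumes "partition_on {1..n::nat} \<pi>" "transversal \<pi> Z"
  shows "card Z = card \<pi>"
proof -
  obtain z where z: "\<And>B. B \<in> \<pi> \<Longrightarrow> Z \<inter> B = {z B}" using assms(2) unfolding transversal_def by metis
  have "Z = z ` \<pi>" using assms(2) z unfolding transversal_def by blast
  moreover have "inj_on z \<pi>"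
  proof (rule inj_onI)
    fix B C assume "B \<in> \<pi>" "C \<in> \<pi>" "z B = z C"
    then show "B = C" using z[of B] z[of C] disjoint_block_unique[OF partition_blocks(3)[OF assms(1)], of B C "z B"] by blast
  qed
  ultimately show ?thesis by (simp add: card_image)
qed

lemma F_bihomogeneous:
  assumes \<pi>: "partition_on {1..n} \<pi>"
  shows "block_prod offdiag n \<pi> \<in> bihomogeneous n (n - card \<pi>) (card \<pi>)"
  unfolding bihomogeneous_iff
proof (intro conjI allI impI ext_space_F[OF \<pi>])
  fix U assume "block_prod offdiag n \<pi> U \<noteq> 0"
  then have "nice n \<pi> U" unfolding block_prod_coeffs(3)[OF \<pi>] by (auto simp: block_prod_coeffs(1)[OF \<pi>, symmetric] split: if_splits)
  then have U: "U \<subseteq> gens n" "card (Xs U) = card \<pi>" "card (Ys n U) = card \<pi>"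
    using card_transversal[OF \<pi>] by (auto simp: nice_def)
  have "U \<inter> range Theta = Theta ` ({1..n} - Ys n U)" "U \<inter> range Xi = Xi ` Xs U"
    using U(1) by (auto simp: Ys_def Xs_def)
  moreover have "card ({1..n} - Ys n U) = n - card \<pi>"
  proof -
    have "Ys n U \<subseteq> {1..n}" by (auto simp: Ys_def)
    then show ?thesis using card_Diff_subset[of "Ys n U" "{1..n}"] U(3) finite_subset[of "Ys n U" "{1..n}"] by simp
  qed
  ultimately show "bidegree U = (n - card \<pi>, card \<pi>)"
    using U(2) by (simp add: bidegree_def card_image inj_on_def)
qed

lemma f_part_bihomogeneous:
  assumes \<pi>: "partition_on {1..n} \<pi>"
  shows "f_part n \<pi> \<in> bihomogeneous n (n - card \<pi>) (card \<pi> - 1)"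
  unfolding f_part_eq
proof (rule ext.subspace_sum[OF bihomogeneous_subspace])
  fix i assume "i \<in> {1..n}"
  let ?F = "block_prod offdiag n \<pi>"
  show "contract (Xi i) ?F \<in> bihomogeneous n (n - card \<pi>) (card \<pi> - 1)"
    unfolding bihomogeneous_iff
  proof (intro conjI allI impI ext_space_contract ext_space_F[OF \<pi>])
    fix T assume "contract (Xi i) ?F T \<noteq> 0"
    then have T: "Xi i \<notin> T" "?F (insert (Xi i) T) \<noteq> 0" by (auto simp: contract_alt split: if_splits)
    then have fin: "finite T" using ext_space_finite[OF ext_space_F[OF \<pi>]] by (metis finite_insert)
    have "bidegree (insert (Xi i) T) = (n - card \<pi>, card \<pi>)"
      using F_bihomogeneous[OF \<pi>] T(2) by (simp add: bihomogeneous_iff)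
    then show "bidegree T = (n - card \<pi>, card \<pi> - 1)"
      using bidegree_insert[OF fin T(1)] by (cases "bidegree T") auto
  qed
qed

section \<open>Bases of the quotient\<close>

lemma to_FDR_add:
  assumes "f \<in> ext_space n" "g \<in> ext_space n"
  shows "to_FDR n f \<oplus>\<^bsub>FDR n\<^esub> to_FDR n g = to_FDR n (f + g)"
proof -
  interpret ideal "FDR_ideal n" "ext_alg n" by (rule ideal_FDR_ideal)
  show ?thesis
    using a_rcos_sum[OF assms] by (simp add: FDR_def ring.defs module.defs FactRing_def to_FDR_def ext_alg_ops)
qed

lemma FDR_zero: "\<zero>\<^bsub>FDR n\<^esub> = FDR_ideal n"
  by (simp add: FDR_def ring.defs module.defs FactRing_def)

lemma FDR_carrier: "carrier (FDR n) = to_FDR n ` ext_space n"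
  by (auto simp: FDR_def ring.defs module.defs FactRing_def A_RCOSETS_def' to_FDR_def)

lemma to_FDR_zero_iff:
  assumes "f \<in> ext_space n"
  shows "to_FDR n f = \<zero>\<^bsub>FDR n\<^esub> \<longleftrightarrow> f \<in> sum_ideal n"
proof -
  interpret ideal "FDR_ideal n" "ext_alg n" by (rule ideal_FDR_ideal)
  show ?thesis
    using a_rcos_self[OF assms] a_rcos_const[of f] unfolding to_FDR_def FDR_zero FDR_ideal_eq_sum_ideal by auto
qed

lemma to_FDR_scale: "f \<in> ext_space n \<Longrightarrow> c \<odot>\<^bsub>FDR n\<^esub> to_FDR n f = to_FDR n (ext_scale c f)"
  by (simp add: smult_to_FDR ext_alg_ops)

lemma to_FDR_eqD:
  assumes "f \<in> ext_space n" "g \<in> ext_space n" "to_FDR n f = to_FDR n g"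
  shows "f - g \<in> sum_ideal n"
proof -
  have neg: "ext_scale (-1) g \<in> ext_space n" using assms(2) by (rule ext.subspace_scale[OF ext_space_subspace])
  have "to_FDR n (f + ext_scale (-1) g) = to_FDR n (g + ext_scale (-1) g)"
    using assms neg by (simp only: to_FDR_add[symmetric])
  moreover have "g + ext_scale (-1) g = 0" "f + ext_scale (-1) g = f - g" by (simp_all add: fun_eq_iff ext_scale_def)
  ultimately have "to_FDR n (f - g) = to_FDR n 0" by (simp only:)
  also have "\<dots> = \<zero>\<^bsub>FDR n\<^esub>"
    using to_FDR_zero_iff[OF ext_space_zero] ext.subspace_0[OF sum_ideal_subspace] by blast
  finally show ?thesis
    using to_FDR_zero_iff[OF ext.subspace_diff[OF ext_space_subspace assms(1,2)]] by blast
qed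

abbreviation FDR_subspace :: "nat \<Rightarrow> ext set \<Rightarrow> (complex, ext set) module" where
  "FDR_subspace n V \<equiv> FDR n\<lparr>carrier := to_FDR n ` V\<rparr>"

context
  fixes n :: nat and V :: "ext set"
  assumes V: "ext.subspace V" "V \<subseteq> ext_space n"
begin

lemma vectorspace_FDR_subspace: "vectorspace class_ring (FDR_subspace n V)"
proof -
  interpret vs: vectorspace class_ring "FDR n" by (rule vectorspace_FDR)
  have "to_FDR n 0 \<in> to_FDR n ` V" using ext.subspace_0[OF V(1)] by blast
  then have z: "\<zero>\<^bsub>FDR n\<^esub> \<in> to_FDR n ` V"
    using to_FDR_zero_iff[OF ext_space_zero] ext.subspace_0[OF sum_ideal_subspace] by metis
  have "submodule class_ring (to_FDR n ` V) (FDR n)"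
  proof (rule submodule.intro)
    show "Module.module class_ring (FDR n)" by (rule vs.module_axioms)
    show "to_FDR n ` V \<subseteq> carrier (FDR n)" using V(2) by (auto simp: FDR_carrier)
    show "\<zero>\<^bsub>FDR n\<^esub> \<in> to_FDR n ` V" by (rule z)
  next
    fix v w assume "v \<in> to_FDR n ` V" "w \<in> to_FDR n ` V"
    then obtain f g where "v = to_FDR n f" "w = to_FDR n g" "f \<in> V" "g \<in> V" by blast
    moreover from this have "f + g \<in> V" using ext.subspace_add[OF V(1)] by blast
    ultimately show "v \<oplus>\<^bsub>FDR n\<^esub> w \<in> to_FDR n ` V" using V(2) to_FDR_add by blast
  next
    fix c :: complex and v assume "v \<in> to_FDR n ` V"
    then obtain f where "v = to_FDR n f" "f \<in> V" by blast
    moreover from this have "ext_scale c f \<in> V" using ext.subspace_scale[OF V(1)] by blast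
    ultimately show "c \<odot>\<^bsub>FDR n\<^esub> v \<in> to_FDR n ` V" using V(2) to_FDR_scale by blast
  qed
  then have "VectorSpace.subspace class_ring (to_FDR n ` V) (FDR n)"
    by (intro VectorSpace.subspace.intro vectorspace_FDR)
  then show ?thesis by (rule vs.subspace_is_vs)
qed

lemma finsum_FDR_subspace:
  assumes "finite A" "\<And>i. i \<in> A \<Longrightarrow> F i \<in> V"
  shows "finsum (FDR_subspace n V) (\<lambda>i. to_FDR n (F i)) A = to_FDR n (\<Sum>i\<in>A. F i)"
  using assms
proof (induction A rule: finite_induct)
  interpret vs: vectorspace class_ring "FDR_subspace n V" by (rule vectorspace_FDR_subspace)
  {
    case empty
    have "to_FDR n 0 = \<zero>\<^bsub>FDR n\<^esub>"
      using to_FDR_zero_iff[OF ext_space_zero] ext.subspace_0[OF sum_ideal_subspace] by blast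
    moreover have "finsum (FDR_subspace n V) (\<lambda>i. to_FDR n (F i)) {} = \<zero>\<^bsub>FDR n\<^esub>" by simp
    ultimately show ?case by (simp only: sum.empty)
  next
    case (insert i A)
    have "(\<Sum>i\<in>A. F i) \<in> V" using insert.prems by (intro ext.subspace_sum[OF V(1)]) auto
    then have "to_FDR n (F i) \<oplus>\<^bsub>FDR n\<^esub> to_FDR n (\<Sum>i\<in>A. F i) = to_FDR n (F i + (\<Sum>i\<in>A. F i))"
      using insert.prems V(2) by (intro to_FDR_add) auto
    moreover have "finsum (FDR_subspace n V) (\<lambda>i. to_FDR n (F i)) (insert i A)
        = to_FDR n (F i) \<oplus>\<^bsub>FDR n\<^esub> finsum (FDR_subspace n V) (\<lambda>i. to_FDR n (F i)) A"
      using insert.prems insert.hyps by (subst vs.finsum_insert) auto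
    moreover have "finsum (FDR_subspace n V) (\<lambda>i. to_FDR n (F i)) A = to_FDR n (\<Sum>i\<in>A. F i)"
      by (rule insert.IH) (use insert.prems in blast)
    moreover have "(\<Sum>i\<in>insert i A. F i) = F i + (\<Sum>i\<in>A. F i)"
      using insert.hyps by (rule sum.insert)
    ultimately show ?case by (simp only:)
  }
qed

text \<open>The images of \<open>E\<close> span, so the dimension is at most \<open>card E\<close>
  and hence at most \<open>card P\<close>; the images of \<open>P\<close> are independent, and an
  independent set of at least that size is a basis.\<close>

lemma descends_to_basisI:
  assumes n: "n \<ge> 1" and P: "P \<subseteq> NC n" "\<And>\<pi>. \<pi> \<in> P \<Longrightarrow> f_part n \<pi> \<in> V"
    and E: "finite E" "E \<subseteq> V" "card E \<le> card P" "V \<subseteq> ext.span (E \<union> sum_ideal n)"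
  shows "descends_to_basis n P (to_FDR n ` V)"
proof -
  let ?\<phi> = "\<lambda>\<pi>. to_FDR n (f_part n \<pi>)"
  interpret vs: vectorspace class_ring "FDR_subspace n V" by (rule vectorspace_FDR_subspace)
  have finP: "finite P" using P(1) finite_NC finite_subset by blast
  \<comment> \<open>Independence passes from \<open>NC n\<close> to the subfamily by extending the
    coefficients by 0.\<close>
  have indep: "c \<pi>0 = 0" if "(\<Sum>\<pi>\<in>P. ext_scale (c \<pi>) (f_part n \<pi>)) \<in> sum_ideal n" "\<pi>0 \<in> P" for c \<pi>0
  proof -
    have "(\<Sum>\<pi>\<in>NC n. ext_scale (if \<pi> \<in> P then c \<pi> else 0) (f_part n \<pi>)) = (\<Sum>\<pi>\<in>P. ext_scale (c \<pi>) (f_part n \<pi>))"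
      using P(1) by (intro sum.mono_neutral_cong_right finite_NC) auto
    then have "(if \<pi>0 \<in> P then c \<pi>0 else 0) = 0"
      using f_part_independent[OF n, of "\<lambda>\<pi>. if \<pi> \<in> P then c \<pi> else 0" \<pi>0] that P(1) by auto
    then show ?thesis using that(2) by simp
  qed
  have inj: "inj_on ?\<phi> P"
  proof (rule inj_onI, rule ccontr)
    fix \<pi> \<sigma> assume *: "\<pi> \<in> P" "\<sigma> \<in> P" "?\<phi> \<pi> = ?\<phi> \<sigma>" "\<pi> \<noteq> \<sigma>"
    let ?c = "\<lambda>\<tau>. if \<tau> = \<pi> then 1 else if \<tau> = \<sigma> then - 1 else 0 :: complex"
    have "(\<Sum>\<tau>\<in>P. ext_scale (?c \<tau>) (f_part n \<tau>)) = (\<Sum>\<tau>\<in>{\<pi>, \<sigma>}. ext_scale (?c \<tau>) (f_part n \<tau>))"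
      using * finP by (intro sum.mono_neutral_right) auto
    also have "\<dots> = f_part n \<pi> - f_part n \<sigma>" using *(4) by (simp add: fun_eq_iff ext_scale_def)
    also have "\<dots> \<in> sum_ideal n" using * P(2) V(2) by (intro to_FDR_eqD) auto
    finally have "?c \<pi> = 0" by (rule indep) (rule *(1))
    then show False by simp
  qed
  let ?B = "?\<phi> ` P"
  have B: "finite ?B" "?B \<subseteq> carrier (FDR_subspace n V)" "card ?B = card P"
    using finP P(2) inj by (auto simp: card_image)
  have li: "\<not> vs.lin_dep ?B"
  proof (rule vs.finite_lin_indpt2[OF B(1,2)])
    fix a assume 0: "vs.lincomb a ?B = \<zero>\<^bsub>FDR_subspace n V\<^esub>"
    \<comment> \<open>\<open>lincomb\<close> runs over vectors of the quotient; the inverse of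
      \<open>?\<phi>\<close> leads each of them back to its partition, so that the sum can be lifted
      to the exterior algebra.\<close>
    let ?g = "the_inv_into P ?\<phi>"
    have g: "?g v \<in> P" "?\<phi> (?g v) = v" if "v \<in> ?B" for v
      using that the_inv_into_into[OF inj that subset_refl] f_the_inv_into_f[OF inj that] by blast+
    have F: "ext_scale (a v) (f_part n (?g v)) \<in> V" if "v \<in> ?B" for v
      using ext.subspace_scale[OF V(1)] P(2) g(1)[OF that] by blast
    have "vs.lincomb a ?B = finsum (FDR_subspace n V) (\<lambda>v. to_FDR n (ext_scale (a v) (f_part n (?g v)))) ?B"
      unfolding vs.lincomb_def
    proof (rule vs.finsum_cong')
      fix v assume v: "v \<in> ?B"
      have "a v \<odot>\<^bsub>FDR n\<^esub> ?\<phi> (?g v) = to_FDR n (ext_scale (a v) (f_part n (?g v)))"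
        using P(2) g(1)[OF v] V(2) by (intro to_FDR_scale) auto
      then show "a v \<odot>\<^bsub>FDR_subspace n V\<^esub> v = to_FDR n (ext_scale (a v) (f_part n (?g v)))"
        unfolding g(2)[OF v] by simp
    qed (use F in auto)
    also have "\<dots> = to_FDR n (\<Sum>v\<in>?B. ext_scale (a v) (f_part n (?g v)))"
      by (rule finsum_FDR_subspace[OF B(1) F])
    also have "(\<Sum>v\<in>?B. ext_scale (a v) (f_part n (?g v))) = (\<Sum>\<pi>\<in>P. ext_scale (a (?\<phi> \<pi>)) (f_part n \<pi>))"
      unfolding sum.reindex[OF inj] by (intro sum.cong refl) (simp add: the_inv_into_f_f[OF inj])
    finally have "to_FDR n (\<Sum>\<pi>\<in>P. ext_scale (a (?\<phi> \<pi>)) (f_part n \<pi>)) = \<zero>\<^bsub>FDR n\<^esub>" using 0 by simp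
    moreover have "(\<Sum>\<pi>\<in>P. ext_scale (a (?\<phi> \<pi>)) (f_part n \<pi>)) \<in> ext_space n"
      using P(2) V(2) by (intro ext.subspace_sum[OF ext_space_subspace] ext.subspace_scale[OF ext_space_subspace]) auto
    ultimately have "(\<Sum>\<pi>\<in>P. ext_scale (a (?\<phi> \<pi>)) (f_part n \<pi>)) \<in> sum_ideal n" using to_FDR_zero_iff by blast
    then have "a (?\<phi> \<pi>) = 0" if "\<pi> \<in> P" for \<pi>
      by (rule indep[of "\<lambda>\<pi>. a (?\<phi> \<pi>)"]) (rule that)
    then show "\<forall>v\<in>?B. a v = \<zero>\<^bsub>class_ring\<^esub>" by simp
  qed
  let ?E = "to_FDR n ` E"
  have Ec: "finite ?E" "?E \<subseteq> carrier (FDR_subspace n V)" using E by auto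
  have sm: "submodule class_ring (vs.span ?E) (FDR_subspace n V)" by (rule vs.span_is_submodule[OF Ec(2)])
  \<comment> \<open>Spanning is pulled back to the exterior algebra: the preimage of the span of
    \<open>?E\<close> is a subspace that contains \<open>E\<close> and the ideal, hence
    \<open>V\<close>.\<close>
  let ?T = "{f \<in> ext_space n. to_FDR n f \<in> vs.span ?E}"
  have sum_ideal: "sum_ideal n \<subseteq> ?T"
  proof
    fix f assume f: "f \<in> sum_ideal n"
    then have "f \<in> ext_space n" using sum_ideal_subset by blast
    moreover from this have "to_FDR n f = \<zero>\<^bsub>FDR_subspace n V\<^esub>" using to_FDR_zero_iff f by simp
    ultimately show "f \<in> ?T" using submodule.zero_closed[OF sm] by simp
  qed
  have "E \<union> sum_ideal n \<subseteq> ?T"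
    using sum_ideal vs.in_own_span[OF Ec(2)] E(2) V(2) by auto
  moreover have "ext.subspace ?T"
  proof (rule ext.subspaceI)
    show "0 \<in> ?T" using sum_ideal ext.subspace_0[OF sum_ideal_subspace] by blast
  next
    fix f g assume fg: "f \<in> ?T" "g \<in> ?T"
    then have "to_FDR n f \<oplus>\<^bsub>FDR_subspace n V\<^esub> to_FDR n g \<in> vs.span ?E"
      by (intro submodule.m_closed[OF sm]) auto
    then have "to_FDR n (f + g) \<in> vs.span ?E" using to_FDR_add fg by simp
    then show "f + g \<in> ?T" using fg ext.subspace_add[OF ext_space_subspace] by blast
  next
    fix c f assume f: "f \<in> ?T"
    then have "c \<odot>\<^bsub>FDR_subspace n V\<^esub> to_FDR n f \<in> vs.span ?E"
      by (intro submodule.smult_closed[OF sm]) auto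
    then have "to_FDR n (ext_scale c f) \<in> vs.span ?E" using to_FDR_scale f by simp
    then show "ext_scale c f \<in> ?T" using f ext.subspace_scale[OF ext_space_subspace] by blast
  qed
  ultimately have "ext.span (E \<union> sum_ideal n) \<subseteq> ?T" by (rule ext.span_minimal)
  then have "carrier (FDR_subspace n V) \<subseteq> vs.span ?E" using E(4) by auto
  moreover have "vs.span ?E \<subseteq> carrier (FDR_subspace n V)" using submodule.subset[OF sm] .
  ultimately have gen: "vs.span ?E = carrier (FDR_subspace n V)" by blast
  have "vs.dim \<le> card ?E" by (rule vs.gen_ge_dim[OF Ec gen])
  also have "\<dots> \<le> card ?B" using card_image_le[OF E(1), of "to_FDR n"] E(3) B(3) by linarith
  finally have "vs.dim \<le> card ?B" .
  moreover have "vs.fin_dim" unfolding vs.fin_dim_def using Ec gen by blast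
  ultimately have "vs.basis ?B" using vs.dim_li_is_basis B li by blast
  then show ?thesis unfolding descends_to_basis_def using inj by blast
qed

end

section \<open>The sum of the components\<close>

definition bar_space :: "nat \<Rightarrow> ext set" where
  "bar_space n = {(\<Sum>k\<in>{1..n}. g k) | g. \<forall>k\<in>{1..n}. g k \<in> bihomogeneous n (n - k) (k - 1)}"

lemma bihomogeneous_subset: "bihomogeneous n a b \<subseteq> ext_space n"
  by (auto simp: bihomogeneous_iff)

text \<open>\<open>to_FDR n\<close> is additive, so a sum of classes lifts to the sum of chosen
  bihomogeneous representatives. This puts the sum of the components into the form that
  \<open>descends_to_basisI\<close> expects.\<close>

lemma FDR_bar_eq: "FDR_bar n = to_FDR n ` bar_space n"
proof -
  have sum: "finsum (FDR n) (\<lambda>k. to_FDR n (g k)) {1..n} = to_FDR n (\<Sum>k\<in>{1..n}. g k)"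
    if g: "\<forall>k\<in>{1..n}. g k \<in> bihomogeneous n (n - k) (k - 1)" for g
  proof -
    have "FDR_subspace n (ext_space n) = FDR n" by (simp flip: FDR_carrier)
    moreover have "g k \<in> ext_space n" if "k \<in> {1..n}" for k
      using that g bihomogeneous_subset by blast
    ultimately show ?thesis
      using finsum_FDR_subspace[OF ext_space_subspace subset_refl, of "{1..n}" g n] by (simp only: finite_atLeastAtMost)
  qed
  show ?thesis
  proof (intro equalityI subsetI)
    fix y assume "y \<in> FDR_bar n"
    then obtain x where x: "y = finsum (FDR n) x {1..n}" "\<forall>k\<in>{1..n}. x k \<in> FDR_component n (n - k) (k - 1)"
      by (auto simp: FDR_bar_def)
    then have "\<forall>k\<in>{1..n}. \<exists>g. g \<in> bihomogeneous n (n - k) (k - 1) \<and> x k = to_FDR n g"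
      by (auto simp: FDR_component_def)
    then obtain g where g: "\<forall>k\<in>{1..n}. g k \<in> bihomogeneous n (n - k) (k - 1) \<and> x k = to_FDR n (g k)"
      by metis
    interpret vs: vectorspace class_ring "FDR n" by (rule vectorspace_FDR)
    have "y = finsum (FDR n) (\<lambda>k. to_FDR n (g k)) {1..n}"
    proof -
      have "to_FDR n (g k) \<in> carrier (FDR n)" "x k = to_FDR n (g k)" if "k \<in> {1..n}" for k
        using that g bihomogeneous_subset unfolding FDR_carrier by blast+
      then show ?thesis unfolding x(1) by (intro vs.finsum_cong') auto
    qed
    also have "\<dots> = to_FDR n (\<Sum>k\<in>{1..n}. g k)" by (rule sum) (use g in blast)
    finally show "y \<in> to_FDR n ` bar_space n" unfolding bar_space_def using g by blast
  next
    fix y assume "y \<in> to_FDR n ` bar_space n"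
    then obtain g where g: "y = to_FDR n (\<Sum>k\<in>{1..n}. g k)" "\<forall>k\<in>{1..n}. g k \<in> bihomogeneous n (n - k) (k - 1)"
      unfolding bar_space_def by blast
    then have "y = finsum (FDR n) (\<lambda>k. to_FDR n (g k)) {1..n}" using sum by simp
    moreover have "\<forall>k\<in>{1..n}. to_FDR n (g k) \<in> FDR_component n (n - k) (k - 1)"
      using g(2) by (auto simp: FDR_component_def)
    ultimately show "y \<in> FDR_bar n" unfolding FDR_bar_def by blast
  qed
qed

lemma bar_space_subspace: "ext.subspace (bar_space n)"
proof (rule ext.subspaceI)
  show "0 \<in> bar_space n"
    unfolding bar_space_def mem_Collect_eq
    by (rule exI[of _ "\<lambda>k. 0"]) (simp add: ext.subspace_0[OF bihomogeneous_subspace])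
next
  fix x y assume "x \<in> bar_space n" "y \<in> bar_space n"
  then obtain g h where gh: "x = (\<Sum>k\<in>{1..n}. g k)" "\<forall>k\<in>{1..n}. g k \<in> bihomogeneous n (n - k) (k - 1)"
    "y = (\<Sum>k\<in>{1..n}. h k)" "\<forall>k\<in>{1..n}. h k \<in> bihomogeneous n (n - k) (k - 1)"
    unfolding bar_space_def by blast
  then have "x + y = (\<Sum>k\<in>{1..n}. g k + h k)" "\<forall>k\<in>{1..n}. g k + h k \<in> bihomogeneous n (n - k) (k - 1)"
    by (simp only: sum.distrib) (use ext.subspace_add[OF bihomogeneous_subspace] gh in blast)
  then show "x + y \<in> bar_space n" unfolding bar_space_def by blast
next
  fix c x assume "x \<in> bar_space n"
  then obtain g where g: "x = (\<Sum>k\<in>{1..n}. g k)" "\<forall>k\<in>{1..n}. g k \<in> bihomogeneous n (n - k) (k - 1)"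
    unfolding bar_space_def by blast
  then have "ext_scale c x = (\<Sum>k\<in>{1..n}. ext_scale c (g k))" "\<forall>k\<in>{1..n}. ext_scale c (g k) \<in> bihomogeneous n (n - k) (k - 1)"
    by (simp only: ext.scale_sum_right) (use ext.subspace_scale[OF bihomogeneous_subspace] g in blast)
  then show "ext_scale c x \<in> bar_space n" unfolding bar_space_def by blast
qed

lemma bihomogeneous_bar_space:
  assumes "k \<in> {1..n}"
  shows "bihomogeneous n (n - k) (k - 1) \<subseteq> bar_space n"
proof
  fix f assume f: "f \<in> bihomogeneous n (n - k) (k - 1)"
  let ?g = "\<lambda>i. if i = k then f else 0"
  have "(\<Sum>i\<in>{1..n}. ?g i) = f" using assms by simp
  moreover have "\<forall>i\<in>{1..n}. ?g i \<in> bihomogeneous n (n - i) (i - 1)"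
    using f ext.subspace_0[OF bihomogeneous_subspace] by auto
  ultimately show "f \<in> bar_space n" unfolding bar_space_def mem_Collect_eq by (intro exI[of _ ?g]) simp
qed

lemma NC_card:
  assumes "n \<ge> 1" "\<pi> \<in> NC n"
  shows "card \<pi> \<in> {1..n}"
proof -
  note P = partition_blocks[OF NC_partition[OF assms(2)]]
  have "\<pi> \<noteq> {}" using P(2) assms(1) by auto
  then have "card \<pi> \<ge> 1" using P(1) by (simp add: Suc_le_eq card_gt_0_iff)
  have "Min ` \<pi> \<subseteq> {1..n}" using P(4) Min_in unfolding P(2)[symmetric] by blast
  then have "card (Min ` \<pi>) \<le> n" using card_mono[of "{1..n}"] by fastforce
  then show ?thesis using \<open>card \<pi> \<ge> 1\<close> card_NC_Min[OF assms(2)] by simp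
qed

text \<open>Both claims are instances of \<open>descends_to_basisI\<close>. For the sum of the
  components, independence is available on all of \<open>NC n\<close> at once, across the bidegrees,
  and the spanning sets are united.\<close>

theorem theorem7p2:
  fixes n :: nat
  assumes "n \<ge> 1"
  shows "(\<forall>k. 1 \<le> k \<and> k \<le> n \<longrightarrow>
            descends_to_basis n (NC_blocks n k) (FDR_component n (n - k) (k - 1))) \<and>
         descends_to_basis n (NC n) (FDR_bar n)"
proof (intro conjI allI impI)
  let ?E = "\<lambda>k. new_monom ` ballot_sets n (n - k, k - 1)"
  have E: "finite (?E k)" "?E k \<subseteq> bihomogeneous n (n - k) (k - 1)"
    "bihomogeneous n (n - k) (k - 1) \<subseteq> ext.span (?E k \<union> sum_ideal n)" for k
    using finite_ballot_sets new_monom_bihomogeneous bihomogeneous_bidegree_span bidegree_span_ballot[OF assms] by blast+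
  have cardE: "card (?E k) \<le> card (NC_blocks n k)" if "1 \<le> k" "k \<le> n" for k
    using card_image_le[OF finite_ballot_sets, of new_monom] card_ballot_sets[OF that] le_trans by blast
  have f: "f_part n \<pi> \<in> bihomogeneous n (n - card \<pi>) (card \<pi> - 1)" if "\<pi> \<in> NC n" for \<pi>
    by (rule f_part_bihomogeneous[OF NC_partition[OF that]])
  show "descends_to_basis n (NC_blocks n k) (FDR_component n (n - k) (k - 1))" if k: "1 \<le> k \<and> k \<le> n" for k
    unfolding FDR_component_def
  proof (rule descends_to_basisI[OF bihomogeneous_subspace bihomogeneous_subset assms])
    show "f_part n \<pi> \<in> bihomogeneous n (n - k) (k - 1)" if "\<pi> \<in> NC_blocks n k" for \<pi>
      using f[of \<pi>] that by (auto simp: NC_blocks_def)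
    show "card (?E k) \<le> card (NC_blocks n k)" using cardE k by blast
  qed (use E in \<open>auto simp: NC_blocks_def\<close>)
  show "descends_to_basis n (NC n) (FDR_bar n)"
    unfolding FDR_bar_eq
  proof (rule descends_to_basisI[OF bar_space_subspace _ assms subset_refl])
    show "bar_space n \<subseteq> ext_space n"
    proof
      fix x assume "x \<in> bar_space n"
      then obtain g where "x = (\<Sum>k\<in>{1..n}. g k)" "\<forall>k\<in>{1..n}. g k \<in> bihomogeneous n (n - k) (k - 1)"
        unfolding bar_space_def by blast
      then show "x \<in> ext_space n" using bihomogeneous_subset ext.subspace_sum[OF ext_space_subspace, of "{1..n}" g] by blast
    qed
    show "f_part n \<pi> \<in> bar_space n" if "\<pi> \<in> NC n" for \<pi>
      using f[OF that] bihomogeneous_bar_space[OF NC_card[OF assms that]] by blast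
    let ?U = "\<Union>k\<in>{1..n}. ?E k"
    show "finite ?U" using E(1) by blast
    show "?U \<subseteq> bar_space n" using E(2) bihomogeneous_bar_space by blast
    \<comment> \<open>The bounds are added over k. \<open>NC n\<close> is the disjoint union of the
      \<open>NC_blocks n k\<close>, since a partition of a nonempty n-element set has between 1 and
      n blocks.\<close>
    have "card ?U \<le> (\<Sum>k\<in>{1..n}. card (?E k))" by (rule card_UN_le) simp
    also have "\<dots> \<le> (\<Sum>k\<in>{1..n}. card (NC_blocks n k))" using cardE by (intro sum_mono) auto
    also have "\<dots> = card (\<Union>k\<in>{1..n}. NC_blocks n k)"
      by (rule card_UN_disjoint[symmetric]) (auto simp: NC_blocks_def finite_NC)
    also have "(\<Union>k\<in>{1..n}. NC_blocks n k) = NC n" using NC_card[OF assms] by (auto simp: NC_blocks_def)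
    finally show "card ?U \<le> card (NC n)" .
    have "ext.span (?E k \<union> sum_ideal n) \<subseteq> ext.span (?U \<union> sum_ideal n)" if "k \<in> {1..n}" for k
      using that by (intro ext.span_mono) blast
    then have "bihomogeneous n (n - k) (k - 1) \<subseteq> ext.span (?U \<union> sum_ideal n)" if "k \<in> {1..n}" for k
      using E(3)[of k] that by blast
    then have "(\<Sum>k\<in>{1..n}. g k) \<in> ext.span (?U \<union> sum_ideal n)"
      if "\<forall>k\<in>{1..n}. g k \<in> bihomogeneous n (n - k) (k - 1)" for g
      using that by (intro ext.span_sum) blast
    then show "bar_space n \<subseteq> ext.span (?U \<union> sum_ideal n)"
      unfolding bar_space_def by blast
  qed
qed

end
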